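(* Let $\Phi$ be a nuclear space over $\mathbb{R}$, let $(\Omega,\mathscr{F},\mathbb{P})$ be a complete probability space with a filtration $\{\mathcal{F}_t\}_{t\ge 0}$ satisfying the usual conditions, and let $L=\{L_t\}_{t\ge 0}$ be an $\{\mathcal{F}_t\}$-adapted $\Phi'_\beta$-valued Lévy process such that $L_t-L_s$ is independent of $\mathcal{F}_s$ for all $0\le s<t$ and such that for every $T>0$ the family of linear maps $\phi\mapsto L_t[\phi]$, $t\in[0,T]$, from $\Phi$ into $L^0(\Omega,\mathscr{F},\mathbb{P})$ is equicontinuous ($L$ being identified with its regular càdlàg version). Let $\nu$ be the Borel measure on $\Phi'_\beta$ determined by $\nu(\{0\})=0$ and $\mathbb{E}\,N(t,\Gamma)=t\,\nu(\Gamma)$ for all $t\ge0$ and $\Gamma\in\mathcal{B}(\Phi'_\beta\setminus\{0\})$, where $N(t,\Gamma)=\#\{0\le s\le t:\Delta L_s\in\Gamma\}$ and $\Delta L_s=L_s-L_{s-}$. Then $\nu$ is a Lévy measure on $\Phi'_\beta$.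
   Context: $\Phi'_\beta$ is the strong dual of $\Phi$, $f[\phi]$ the pairing. A semi-norm $p$ on $\Phi$ is Hilbertian if $p(\phi)^2=Q(\phi,\phi)$ for a symmetric non-negative bilinear form $Q$. For a continuous Hilbertian semi-norm $p$, $\Phi_p$ is the Hilbert completion of $\Phi/\ker p$, $\Phi'_p$ its dual (canonically included in $\Phi'$) with dual norm $p'(f)=\sup\{|f[\phi]|:p(\phi)\le1\}$; $B_{p'}(1)=\{f\in\Phi':p'(f)\le 1\}$ is the polar of $\{p\le1\}$. For $p\le q$, $i_{p,q}:\Phi_q\to\Phi_p$ is the canonical map. A Hausdorff locally convex space is nuclear if its topology is generated by a family of Hilbertian semi-norms such that for each member $p$ there is a member $q\ge p$ with $i_{p,q}$ Hilbert-Schmidt. A Borel measure $\mu$ on $\Phi'_\beta$ is Radon if for every Borel $\Gamma$ and $\epsilon>0$ there is a compact $K\subseteq\Gamma$ with $\mu(\Gamma\setminus K)<\epsilon$; $\mathfrak{M}^b_R(\Phi'_\beta)$, $\mathfrak{M}^1_R(\Phi'_\beta)$ are the sets of bounded Radon, resp. Radon probability, measures. A Borel measure $\lambda$ on $\Phi'_\beta$ is a Lévy measure if: (1) $\lambda(\{0\})=0$; (2) $\lambda|_{U^c}\in\mathfrak{M}^b_R(\Phi'_\beta)$ for each neighbourhood of zero $U\subseteq\Phi'_\beta$; (3) there is a continuous Hilbertian semi-norm $\rho$ on $\Phi$ with $\int_{B_{\rho'}(1)}\rho'(f)^2\lambda(df)<\infty$ and $\lambda|_{B_{\rho'}(1)^c}\in\mathfrak{M}^b_R(\Phi'_\beta)$.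 $L^0(\Omega,\mathscr{F},\mathbb{P})$ has the topology of convergence in probability. A $\Phi'_\beta$-valued process $L$ is a Lévy process if $L_0=0$ a.s., it has independent and stationary increments, the law $\mu_t$ of each $L_t$ is Radon and $t\mapsto\mu_t\in\mathfrak{M}^1_R(\Phi'_\beta)$ is weakly continuous at $0$. A weaker countably Hilbertian topology $\theta$ on $\Phi$ is one generated by an increasing sequence of continuous Hilbertian semi-norms; $\Phi_\theta=(\Phi,\theta)$, $\Phi'_\theta$ its dual, $\widetilde{\Phi_\theta}$ its completion. A $\Phi'_\beta$-valued random variable $X$ is regular if $\mathbb{P}(X\in\Phi'_\theta)=1$ for some such $\theta$; a process is regular if it is so at each time. Under the assumptions on $L$, $L$ has a regular version which is a.s. càdlàg with values in $(\widetilde{\Phi_{\vartheta_L}})'_\beta$ for some countably Hilbertian topology $\vartheta_L$ on $\Phi$; $L$ denotes this version. *)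

theory Defs
  imports "HOL-Probability.Probability"
begin

(* A topological vector space is a topology T on the whole of a type of class real_vector. *)

subsection \<open>Hilbertian semi-norms and the topologies they generate\<close>

definition hilbertian_form :: "('a::real_vector \<Rightarrow> real) \<Rightarrow> ('a \<Rightarrow> 'a \<Rightarrow> real) \<Rightarrow> bool" where
  "hilbertian_form p Q \<longleftrightarrow> bilinear Q \<and> (\<forall>x y. Q x y = Q y x) \<and> (\<forall>x. 0 \<le> Q x x) \<and>
     (\<forall>x. 0 \<le> p x \<and> (p x)\<^sup>2 = Q x x)"

definition hilbertian_seminorm :: "('a::real_vector \<Rightarrow> real) \<Rightarrow> bool" where
  "hilbertian_seminorm p \<longleftrightarrow> (\<exists>Q. hilbertian_form p Q)"

definition cont_hilbertian :: "'a::real_vector topology \<Rightarrow> ('a \<Rightarrow> real) \<Rightarrow> bool" where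
  "cont_hilbertian T p \<longleftrightarrow> hilbertian_seminorm p \<and> continuous_map T euclideanreal p"

(* UNIV is in the subbase so that the whole space is open also when P is empty. *)
definition seminorm_topology :: "('a::real_vector \<Rightarrow> real) set \<Rightarrow> 'a topology" where
  "seminorm_topology P =
     topology_generated_by (insert UNIV {{y. p (y - x) < e} | p x e. p \<in> P \<and> e > 0})"

subsection \<open>Completions\<close>

(* The completion of the space seminormed by a countable family P is represented by the sequences
   that are Cauchy for every p in P; two of them stand for the same point when their difference
   tends to 0 for every p in P. A semi-norm p in P, its bilinear form and every functional
   continuous for P extend by limits along such sequences, and the limits depend only on
   the point represented. With P = {p} this is the Hilbert completion of the quotient by ker p. *)
definition cauchy_seqs :: "('a::real_vector \<Rightarrow> real) set \<Rightarrow> (nat \<Rightarrow> 'a) set" where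
  "cauchy_seqs P = {x. \<forall>p\<in>P. \<forall>e>0. \<exists>N. \<forall>m\<ge>N. \<forall>n\<ge>N. p (x m - x n) < e}"

definition extend :: "('a \<Rightarrow> real) \<Rightarrow> (nat \<Rightarrow> 'a) \<Rightarrow> real" where
  "extend f x = lim (\<lambda>k. f (x k))"

definition extend2 :: "('a \<Rightarrow> 'a \<Rightarrow> real) \<Rightarrow> (nat \<Rightarrow> 'a) \<Rightarrow> (nat \<Rightarrow> 'a) \<Rightarrow> real" where
  "extend2 Q x y = lim (\<lambda>k. Q (x k) (y k))"

(* Orthonormal basis, i.e. a maximal orthonormal system, of the Hilbert completion for q,
   whose inner product is the extension of Q. *)
definition completion_onb ::
  "('a::real_vector \<Rightarrow> real) \<Rightarrow> ('a \<Rightarrow> 'a \<Rightarrow> real) \<Rightarrow> (nat \<Rightarrow> 'a) set \<Rightarrow> bool" where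
  "completion_onb q Q E \<longleftrightarrow> E \<subseteq> cauchy_seqs {q} \<and>
     (\<forall>x\<in>E. \<forall>y\<in>E. extend2 Q x y = (if x = y then 1 else 0)) \<and>
     (\<forall>x\<in>cauchy_seqs {q}. (\<forall>e\<in>E. extend2 Q x e = 0) \<longrightarrow> extend q x = 0)"

(* For p \<le> q the canonical map from the completion for q to that for p sends the point represented
   by a q-Cauchy sequence to the point represented by the same sequence. *)
definition canonical_map_hilbert_schmidt ::
  "('a::real_vector \<Rightarrow> real) \<Rightarrow> ('a \<Rightarrow> real) \<Rightarrow> bool" where
  "canonical_map_hilbert_schmidt p q \<longleftrightarrow>
     (\<exists>Q E. hilbertian_form q Q \<and> completion_onb q Q E \<and> (\<lambda>e. (extend p e)\<^sup>2) summable_on E)"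

definition nuclear_space :: "'a::real_vector topology \<Rightarrow> bool" where
  "nuclear_space T \<longleftrightarrow> Hausdorff_space T \<and>
     (\<exists>P. (\<forall>p\<in>P. hilbertian_seminorm p) \<and> T = seminorm_topology P \<and>
        (\<forall>p\<in>P. \<exists>q\<in>P. (\<forall>x. p x \<le> q x) \<and> canonical_map_hilbert_schmidt p q))"

subsection \<open>Duals\<close>

definition dual :: "'a::real_vector topology \<Rightarrow> ('a \<Rightarrow> real) set" where
  "dual T = {f. linear f \<and> continuous_map T euclideanreal f}"

(* Topology on D of uniform convergence on the members of S, the functional f being evaluated
   at x as app f x; the subbasic sets are the balls for sup {|app g x - app f x| : x in B}. *)
definition uniform_conv_topology ::
  "('a \<Rightarrow> real) set \<Rightarrow> (('a \<Rightarrow> real) \<Rightarrow> 'x \<Rightarrow> real) \<Rightarrow> 'x set set \<Rightarrow> ('a \<Rightarrow> real) topology" where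
  "uniform_conv_topology D app S =
     topology_generated_by (insert D
       {{g\<in>D. \<exists>d<e. \<forall>x\<in>B. \<bar>app g x - app f x\<bar> \<le> d} | f B e. f \<in> D \<and> B \<in> S \<and> (e::real) > 0})"

lemma topspace_uniform_conv_topology [simp]: "topspace (uniform_conv_topology D app S) = D"
  unfolding uniform_conv_topology_def topology_generated_by_topspace by auto

definition tvs_bounded :: "'a::real_vector topology \<Rightarrow> 'a set \<Rightarrow> bool" where
  "tvs_bounded T B \<longleftrightarrow> (\<forall>U. openin T U \<and> 0 \<in> U \<longrightarrow> (\<exists>s>0. \<forall>t>s. B \<subseteq> (\<lambda>x. t *\<^sub>R x) ` U))"

definition strong_dual :: "'a::real_vector topology \<Rightarrow> ('a \<Rightarrow> real) topology" where
  "strong_dual T = uniform_conv_topology (dual T) (\<lambda>f x. f x) {B. tvs_bounded T B}"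

lemma topspace_strong_dual [simp]: "topspace (strong_dual T) = dual T"
  by (simp add: strong_dual_def)

(* A countably Hilbertian topology weaker than T is seminorm_topology (range r) for such an r. *)
definition weaker_countably_hilbertian ::
  "'a::real_vector topology \<Rightarrow> (nat \<Rightarrow> 'a \<Rightarrow> real) \<Rightarrow> bool" where
  "weaker_countably_hilbertian T r \<longleftrightarrow>
     (\<forall>n. cont_hilbertian T (r n)) \<and> (\<forall>n x. r n x \<le> r (Suc n) x)"

(* Strong dual of the completion of seminorm_topology (range r). A functional on the completion is
   identified with its restriction to the original space; the bounded sets are those of the
   completion, which need not come from bounded sets of the original space. *)
definition completion_strong_dual ::
  "(nat \<Rightarrow> 'a::real_vector \<Rightarrow> real) \<Rightarrow> ('a \<Rightarrow> real) topology" where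
  "completion_strong_dual r =
     uniform_conv_topology (dual (seminorm_topology (range r))) extend
       {B. B \<subseteq> cauchy_seqs (range r) \<and> (\<forall>n. \<exists>C. \<forall>x\<in>B. extend (r n) x \<le> C)}"

definition dual_seminorm :: "('a \<Rightarrow> real) \<Rightarrow> ('a \<Rightarrow> real) \<Rightarrow> ennreal" where
  "dual_seminorm \<rho> f = (SUP \<phi>\<in>{\<phi>. \<rho> \<phi> \<le> 1}. ennreal \<bar>f \<phi>\<bar>)"

definition dual_ball :: "'a::real_vector topology \<Rightarrow> ('a \<Rightarrow> real) \<Rightarrow> ('a \<Rightarrow> real) set" where
  "dual_ball T \<rho> = {f \<in> dual T. dual_seminorm \<rho> f \<le> 1}"

subsection \<open>Radon and Levy measures\<close>

definition borel_of :: "'b topology \<Rightarrow> 'b measure" where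
  "borel_of X = sigma (topspace X) {U. openin X U}"

lemma space_borel_of [simp]: "space (borel_of X) = topspace X"
  unfolding borel_of_def by (rule space_measure_of) (auto dest: openin_subset)

lemma sets_borel_of: "sets (borel_of X) = sigma_sets (topspace X) {U. openin X U}"
  unfolding borel_of_def by (rule sets_measure_of) (auto dest: openin_subset)

definition radon_measure :: "'b topology \<Rightarrow> 'b measure \<Rightarrow> bool" where
  "radon_measure X \<mu> \<longleftrightarrow> sets \<mu> = sets (borel_of X) \<and>
     (\<forall>\<Gamma>\<in>sets \<mu>. \<forall>\<epsilon>>0. \<exists>K. compactin X K \<and> K \<subseteq> \<Gamma> \<and> emeasure \<mu> (\<Gamma> - K) < ennreal \<epsilon>)"

definition bounded_radon_measure :: "'b topology \<Rightarrow> 'b measure \<Rightarrow> bool" where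
  "bounded_radon_measure X \<mu> \<longleftrightarrow> radon_measure X \<mu> \<and> finite_measure \<mu>"

(* The restriction of a measure to A, as a measure on the same space: it maps \<Gamma> to m (\<Gamma> \<inter> A). *)
definition restrict_to :: "'b measure \<Rightarrow> 'b set \<Rightarrow> 'b measure" where
  "restrict_to m A = density m (indicator A)"

(* Restrictions make sense for Borel sets only, hence the Borel neighbourhoods of zero. *)
definition levy_measure :: "'a::real_vector topology \<Rightarrow> ('a \<Rightarrow> real) measure \<Rightarrow> bool" where
  "levy_measure T m \<longleftrightarrow>
     sets m = sets (borel_of (strong_dual T)) \<and>
     emeasure m {\<lambda>_. 0} = 0 \<and>
     (\<forall>U\<in>sets (borel_of (strong_dual T)).
        (\<exists>V. openin (strong_dual T) V \<and> (\<lambda>_. 0) \<in> V \<and> V \<subseteq> U) \<longrightarrow>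
        bounded_radon_measure (strong_dual T) (restrict_to m (dual T - U))) \<and>
     (\<exists>\<rho>. cont_hilbertian T \<rho> \<and>
        (\<integral>\<^sup>+f\<in>dual_ball T \<rho>. (dual_seminorm \<rho> f)\<^sup>2 \<partial>m) < \<infinity> \<and>
        bounded_radon_measure (strong_dual T) (restrict_to m (dual T - dual_ball T \<rho>)))"

subsection \<open>Processes in the dual\<close>

(* Processes are indexed by real; only their values at times t \<ge> 0 matter. *)

definition usual_filtration :: "'w measure \<Rightarrow> (real \<Rightarrow> 'w measure) \<Rightarrow> bool" where
  "usual_filtration M F \<longleftrightarrow>
     (\<forall>t\<ge>0. subalgebra M (F t)) \<and>
     (\<forall>s t. 0 \<le> s \<and> s \<le> t \<longrightarrow> sets (F s) \<subseteq> sets (F t)) \<and>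
     (\<forall>t\<ge>0. sets (F t) = (\<Inter>s\<in>{t<..}. sets (F s))) \<and>
     null_sets M \<subseteq> sets (F 0)"

definition law :: "'w measure \<Rightarrow> 'a::real_vector topology \<Rightarrow> ('w \<Rightarrow> 'a \<Rightarrow> real) \<Rightarrow> ('a \<Rightarrow> real) measure" where
  "law M T X = distr M (borel_of (strong_dual T)) X"

definition levy_process ::
  "'w measure \<Rightarrow> 'a::real_vector topology \<Rightarrow> (real \<Rightarrow> 'w \<Rightarrow> 'a \<Rightarrow> real) \<Rightarrow> bool" where
  "levy_process M T L \<longleftrightarrow>
     (\<forall>t\<ge>0. L t \<in> M \<rightarrow>\<^sub>M borel_of (strong_dual T)) \<and>
     (AE \<omega> in M. L 0 \<omega> = (\<lambda>_. 0)) \<and>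
     (\<forall>n (t :: nat \<Rightarrow> real). 0 \<le> t 0 \<and> strict_mono_on {..n} t \<longrightarrow>
        prob_space.indep_vars M (\<lambda>_. borel_of (strong_dual T))
          (\<lambda>i \<omega>. L (t (Suc i)) \<omega> - L (t i) \<omega>) {..<n}) \<and>
     (\<forall>s t. 0 \<le> s \<and> s \<le> t \<longrightarrow> law M T (\<lambda>\<omega>. L t \<omega> - L s \<omega>) = law M T (L (t - s))) \<and>
     (\<forall>t\<ge>0. radon_measure (strong_dual T) (law M T (L t))) \<and>
     (\<forall>h. continuous_map (strong_dual T) euclideanreal h \<and> bounded (h ` dual T) \<longrightarrow>
        ((\<lambda>t. \<integral>f. h f \<partial>law M T (L t)) \<longlongrightarrow> (\<integral>f. h f \<partial>law M T (L 0))) (at_right 0))"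

definition increments_indep_of_past ::
  "'w measure \<Rightarrow> (real \<Rightarrow> 'w measure) \<Rightarrow> 'a::real_vector topology \<Rightarrow> (real \<Rightarrow> 'w \<Rightarrow> 'a \<Rightarrow> real) \<Rightarrow> bool" where
  "increments_indep_of_past M F T L \<longleftrightarrow>
     (\<forall>s t. 0 \<le> s \<and> s < t \<longrightarrow>
        prob_space.indep_set M
          {(\<lambda>\<omega>. L t \<omega> - L s \<omega>) -` \<Gamma> \<inter> space M | \<Gamma>. \<Gamma> \<in> sets (borel_of (strong_dual T))}
          (sets (F s)))"

(* Equicontinuity of the linear maps \<phi> \<mapsto> L t _ \<phi>, t \<in> I, into L^0 with convergence in probability. *)
definition equicontinuous_in_prob ::
  "'w measure \<Rightarrow> 'a::real_vector topology \<Rightarrow> (real \<Rightarrow> 'w \<Rightarrow> 'a \<Rightarrow> real) \<Rightarrow> real set \<Rightarrow> bool" where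
  "equicontinuous_in_prob M T L I \<longleftrightarrow>
     (\<forall>\<phi>0. \<forall>\<epsilon>>0. \<forall>\<delta>>0. \<exists>U. openin T U \<and> \<phi>0 \<in> U \<and>
        (\<forall>t\<in>I. \<forall>\<phi>\<in>U. measure M {\<omega> \<in> space M. \<bar>L t \<omega> \<phi> - L t \<omega> \<phi>0\<bar> \<ge> \<epsilon>} < \<delta>))"

definition regular_process ::
  "'w measure \<Rightarrow> 'a::real_vector topology \<Rightarrow> (real \<Rightarrow> 'w \<Rightarrow> 'a \<Rightarrow> real) \<Rightarrow> bool" where
  "regular_process M T L \<longleftrightarrow>
     (\<forall>t\<ge>0. \<exists>r. weaker_countably_hilbertian T r \<and>
        (AE \<omega> in M. L t \<omega> \<in> dual (seminorm_topology (range r))))"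

definition cadlag_in :: "'b topology \<Rightarrow> (real \<Rightarrow> 'b) \<Rightarrow> bool" where
  "cadlag_in X l \<longleftrightarrow>
     (\<forall>t\<ge>0. limitin X l (l t) (at_right t)) \<and> (\<forall>t>0. \<exists>y. limitin X l y (at_left t))"

definition regular_cadlag_process ::
  "'w measure \<Rightarrow> 'a::real_vector topology \<Rightarrow> (real \<Rightarrow> 'w \<Rightarrow> 'a \<Rightarrow> real) \<Rightarrow> bool" where
  "regular_cadlag_process M T L \<longleftrightarrow> regular_process M T L \<and>
     (\<exists>r. weaker_countably_hilbertian T r \<and>
        (AE \<omega> in M. cadlag_in (completion_strong_dual r) (\<lambda>t. L t \<omega>)))"

(* The completion's strong dual embeds continuously in strong_dual T, so the left limits of a path
   that is cadlag in the former are its left limits in the latter. There is no jump at time 0. *)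
definition left_limit :: "'b topology \<Rightarrow> (real \<Rightarrow> 'b) \<Rightarrow> real \<Rightarrow> 'b" where
  "left_limit X l s = (if s = 0 then l 0 else (THE y. limitin X l y (at_left s)))"

definition jump :: "'a::real_vector topology \<Rightarrow> (real \<Rightarrow> 'a \<Rightarrow> real) \<Rightarrow> real \<Rightarrow> 'a \<Rightarrow> real" where
  "jump T l s = l s - left_limit (strong_dual T) l s"

(* Cardinality with value \<infinity> for infinite sets. *)
definition jump_count ::
  "'a::real_vector topology \<Rightarrow> (real \<Rightarrow> 'a \<Rightarrow> real) \<Rightarrow> real \<Rightarrow> ('a \<Rightarrow> real) set \<Rightarrow> ennreal" where
  "jump_count T l t \<Gamma> = emeasure (count_space UNIV) {s. 0 \<le> s \<and> s \<le> t \<and> jump T l s \<in> \<Gamma>}"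

end

theory Submission
  imports Defs
begin

text \<open>
  Let \<open>h f = 1 - exp (- (\<Sum>j. (f (b j))\<^sup>2) / 2)\<close> for finitely many vectors \<open>b j\<close>. Along the
  partition of \<open>[0, 1]\<close> into \<open>n\<close> equal parts, the sums of \<open>h\<close> over the increments of a cadlag path
  have a lower limit that dominates the sum of \<open>h\<close> over the jumps; by Fatou's lemma the integral
  of \<open>h\<close> with respect to \<open>\<nu>\<close> is at most the lower limit of the expected sums.
  If all \<open>L t \<phi>\<close> with \<open>t \<le> 1\<close> are small in probability, then
  \<open>z = E exp (i L (1/n) \<phi>)\<close> has all powers up to the \<open>n\<close>-th close to 1, whence \<open>n |1 - z| \<le> 1\<close>;
  averaging over Gaussian \<open>\<phi>\<close> bounds the expected sums by \<open>2 (1 + \<Sum>j. (p (b j))\<^sup>2)\<close> for a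
  continuous Hilbertian seminorm \<open>p\<close>. For \<open>s \<ge> p\<close> with a Hilbert-Schmidt canonical map this
  stays bounded over all \<open>s\<close>-orthonormal families \<open>b\<close>, so the function \<open>min 1 (s')\<^sup>2\<close>, where \<open>s'\<close> is
  the dual seminorm, is \<open>\<nu>\<close>-integrable. Since \<open>s\<close> is bounded on bounded sets, \<open>\<nu>\<close> is finite outside
  every neighbourhood of zero. The jumps lie in countably many polars, which are compact and
  metrizable in the strong dual, so the finite restrictions of \<open>\<nu>\<close> are Radon.
\<close>

section \<open>Positive semidefinite forms\<close>

text \<open>The function \<open>h\<close> is one minus a Gaussian characteristic function: with
  independent standard normal weights \<open>g j\<close>, the mean of
  \<open>cos (f (\<Sum>j. g j * b j))\<close> is \<open>exp (- (\<Sum>j. (f (b j))^2) / 2)\<close>.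
  Averaging therefore turns a bound on \<open>1 - cos\<close> that is quadratic in
  \<open>\<phi>\<close> into a trace \<open>\<Sum>j. (p (b j))^2\<close>, which is what nuclearity
  controls. Two obstacles shape the proof. The functionals charged by \<open>\<nu>\<close> are not
  known beforehand to be continuous for \<open>s\<close>: they may be nonzero on null vectors of
  \<open>s\<close>, and \<open>s'\<close> may be infinite. Hence the families \<open>b\<close> are
  only contractive and include large multiples of null vectors; a countable set of test vectors
  still suffices, because almost every functional is bounded by a multiple of some
  \<open>r k\<close>. Moreover, jump counts are not shown to be measurable in
  \<open>\<omega>\<close>, so their integrals are treated as lower integrals. These are
  superadditive, which is the direction required for an upper bound on \<open>\<nu>\<close>; Fatou's
  lemma is applied to sums over increments, which are measurable.\<close>

lemma hilbertian_formD:
  assumes "hilbertian_form p Q"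
  shows hilbertian_bilinear: "bilinear Q"
    and hilbertian_sym: "Q x y = Q y x"
    and hilbertian_form_self: "Q x x = (p x)\<^sup>2"
    and hilbertian_nonneg: "0 \<le> p x"
  using assms by (simp_all add: hilbertian_form_def)

lemma hilbertian_add: "hilbertian_form p Q \<Longrightarrow> Q (x + y) z = Q x z + Q y z"
  and hilbertian_diff: "hilbertian_form p Q \<Longrightarrow> Q (x - y) z = Q x z - Q y z"
  and hilbertian_scale: "hilbertian_form p Q \<Longrightarrow> Q (c *\<^sub>R x) z = c * Q x z"
  and hilbertian_add2: "hilbertian_form p Q \<Longrightarrow> Q z (x + y) = Q z x + Q z y"
  and hilbertian_diff2: "hilbertian_form p Q \<Longrightarrow> Q z (x - y) = Q z x - Q z y"
  and hilbertian_scale2: "hilbertian_form p Q \<Longrightarrow> Q z (c *\<^sub>R x) = c * Q z x"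
  and hilbertian_zero: "hilbertian_form p Q \<Longrightarrow> Q 0 z = 0"
  and hilbertian_zero2: "hilbertian_form p Q \<Longrightarrow> Q z 0 = 0"
  and hilbertian_sum: "hilbertian_form p Q \<Longrightarrow> Q (sum g A) z = (\<Sum>a\<in>A. Q (g a) z)"
  and hilbertian_sum2: "hilbertian_form p Q \<Longrightarrow> Q z (sum g A) = (\<Sum>a\<in>A. Q z (g a))"
proof -
  assume "hilbertian_form p Q"
  then have l: "linear (\<lambda>x. Q x z)" "linear (Q z)" for z
    using hilbertian_bilinear unfolding bilinear_def by blast+
  show "Q (x + y) z = Q x z + Q y z" "Q (x - y) z = Q x z - Q y z" "Q (c *\<^sub>R x) z = c * Q x z"
    "Q 0 z = 0" "Q (sum g A) z = (\<Sum>a\<in>A. Q (g a) z)"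
    using linear_add[OF l(1)] linear_diff[OF l(1)] linear_cmul[OF l(1)] linear_0[OF l(1)]
      linear_sum[OF l(1)] by simp_all
  show "Q z (x + y) = Q z x + Q z y" "Q z (x - y) = Q z x - Q z y" "Q z (c *\<^sub>R x) = c * Q z x"
    "Q z 0 = 0" "Q z (sum g A) = (\<Sum>a\<in>A. Q z (g a))"
    using linear_add[OF l(2)] linear_diff[OF l(2)] linear_cmul[OF l(2)] linear_0[OF l(2)]
      linear_sum[OF l(2)] by simp_all
qed

lemmas hilbertian_simps = hilbertian_add hilbertian_diff hilbertian_scale hilbertian_add2
  hilbertian_diff2 hilbertian_scale2 hilbertian_zero hilbertian_zero2

lemma hilbertian_scaleR:
  assumes "hilbertian_form p Q" shows "p (c *\<^sub>R x) = \<bar>c\<bar> * p x"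
proof -
  have "(p (c *\<^sub>R x))\<^sup>2 = (\<bar>c\<bar> * p x)\<^sup>2"
    using hilbertian_form_self[OF assms, of "c *\<^sub>R x"] hilbertian_form_self[OF assms, of x]
    by (simp add: hilbertian_simps[OF assms] power_mult_distrib power2_eq_square[of c])
  thus ?thesis
    using hilbertian_nonneg[OF assms] by (metis abs_ge_zero mult_nonneg_nonneg power2_eq_imp_eq)
qed

lemma hilbertian_0: "hilbertian_form p Q \<Longrightarrow> p 0 = 0"
  using hilbertian_scaleR[of p Q 0 0] by simp

lemma hilbertian_minus_commute: "hilbertian_form p Q \<Longrightarrow> p (x - y) = p (y - x)"
  using hilbertian_scaleR[of p Q "-1" "x - y"] by simp

lemma hilbertian_Cauchy_Schwarz:
  assumes "hilbertian_form p Q" shows "\<bar>Q x y\<bar> \<le> p x * p y"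
proof -
  note s = hilbertian_simps[OF assms] and sq = hilbertian_form_self[OF assms]
    and sym = hilbertian_sym[OF assms] and nn = hilbertian_nonneg[OF assms]
  have pos: "0 \<le> (p x)\<^sup>2 + 2 * t * Q x y + t\<^sup>2 * (p y)\<^sup>2" for t
  proof -
    have "(p (x + t *\<^sub>R y))\<^sup>2 = (p x)\<^sup>2 + 2 * t * Q x y + t\<^sup>2 * (p y)\<^sup>2"
      unfolding sq[symmetric] using sym[of y x] by (simp add: s algebra_simps power2_eq_square)
    thus ?thesis by (metis zero_le_power2)
  qed
  have "(Q x y)\<^sup>2 \<le> (p x * p y)\<^sup>2"
  proof (cases "p y = 0")
    case True
    have "Q x y = 0"
    proof (rule ccontr)
      assume "Q x y \<noteq> 0"
      \<comment> \<open>When \<open>p y = 0\<close> the expression in \<open>pos\<close> is affine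
        in \<open>t\<close>, and this \<open>t\<close> gives it the value -1.\<close>
      then show False using pos[of "- ((p x)\<^sup>2 + 1) / (2 * Q x y)"] True by (simp add: field_simps)
    qed
    thus ?thesis by simp
  next
    case False
    have "0 \<le> (p x)\<^sup>2 - (Q x y)\<^sup>2 / (p y)\<^sup>2"
      using pos[of "- Q x y / (p y)\<^sup>2"] False by (simp add: power2_eq_square field_simps)
    thus ?thesis using False by (simp add: field_simps power_mult_distrib)
  qed
  thus ?thesis using nn by (metis abs_le_square_iff abs_of_nonneg mult_nonneg_nonneg)
qed

lemma hilbertian_triangle:
  assumes "hilbertian_form p Q" shows "p (x + y) \<le> p x + p y"
proof -
  note s = hilbertian_simps[OF assms] and sq = hilbertian_form_self[OF assms]
  have "(p (x + y))\<^sup>2 = (p x)\<^sup>2 + 2 * Q x y + (p y)\<^sup>2"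
    unfolding sq[symmetric] using hilbertian_sym[OF assms, of y x] by (simp add: s)
  also have "\<dots> \<le> (p x + p y)\<^sup>2"
    using hilbertian_Cauchy_Schwarz[OF assms, of x y] by (simp add: power2_sum)
  finally show ?thesis
    using hilbertian_nonneg[OF assms] by (meson add_nonneg_nonneg power2_le_imp_le)
qed

lemma hilbertian_triangle_diff:
  assumes "hilbertian_form p Q" shows "\<bar>p x - p y\<bar> \<le> p (x - y)"
  using hilbertian_triangle[OF assms, of "x - y" y] hilbertian_triangle[OF assms, of "y - x" x]
    hilbertian_minus_commute[OF assms, of x y] by simp

lemma hilbertian_sum_le:
  assumes "hilbertian_form p Q" shows "p (sum g A) \<le> (\<Sum>a\<in>A. p (g a))"
proof (induction A rule: infinite_finite_induct)
  case (insert a A)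
  thus ?case using hilbertian_triangle[OF assms, of "g a" "sum g A"] by simp
qed (simp_all add: hilbertian_0[OF assms])

lemma hilbertian_orthogonal_sum:
  assumes "hilbertian_form p Q" and "finite A"
    and "\<And>a b. a \<in> A \<Longrightarrow> b \<in> A \<Longrightarrow> a \<noteq> b \<Longrightarrow> Q (g a) (g b) = 0"
  shows "Q (\<Sum>a\<in>A. c a *\<^sub>R g a) (\<Sum>a\<in>A. d a *\<^sub>R g a) = (\<Sum>a\<in>A. c a * d a * (p (g a))\<^sup>2)"
proof -
  have "Q (\<Sum>a\<in>A. c a *\<^sub>R g a) (\<Sum>a\<in>A. d a *\<^sub>R g a)
      = (\<Sum>a\<in>A. \<Sum>b\<in>A. if a = b then c a * d a * (p (g a))\<^sup>2 else 0)"
    unfolding hilbertian_sum[OF assms(1)] hilbertian_sum2[OF assms(1)]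
    using assms(3)
    by (intro sum.cong refl)
      (auto simp: hilbertian_simps[OF assms(1)] hilbertian_form_self[OF assms(1)])
  thus ?thesis using assms(2) by simp
qed

text \<open>Division by zero yields 0, which is the right coefficient for null vectors,
  as these are orthogonal to everything.\<close>

lemma hilbertian_orthogonal_spanning:
  assumes "hilbertian_form p Q" and "finite X"
  shows "\<exists>E. finite E \<and> pairwise (\<lambda>x y. Q x y = 0) E \<and> X \<subseteq> span E"
  using assms(2)
proof (induction X)
  case empty
  show ?case by (rule exI[of _ "{}"]) auto
next
  case (insert x X)
  then obtain E where E: "finite E" "pairwise (\<lambda>x y. Q x y = 0) E" "X \<subseteq> span E" by blast
  define y where "y = x - (\<Sum>e\<in>E. (Q x e / Q e e) *\<^sub>R e)"
  have orth: "Q y e = 0" if "e \<in> E" for e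
  proof -
    have "Q (\<Sum>a\<in>E. (Q x a / Q a a) *\<^sub>R a) e = (\<Sum>a\<in>E. (if a = e then Q x e / Q e e * Q e e else 0))"
      using E(2) that by (auto simp: hilbertian_sum[OF assms(1)] hilbertian_simps[OF assms(1)]
          pairwise_def intro!: sum.cong)
    moreover have "Q x e / Q e e * Q e e = Q x e"
      using hilbertian_Cauchy_Schwarz[OF assms(1), of x e] hilbertian_form_self[OF assms(1), of e]
      by auto
    ultimately show ?thesis using E(1) that by (simp add: y_def hilbertian_simps[OF assms(1)])
  qed
  have "x = y + (\<Sum>e\<in>E. (Q x e / Q e e) *\<^sub>R e)" by (simp add: y_def)
  also have "\<dots> \<in> span (insert y E)"
    by (intro span_add span_sum span_scale) (auto intro: span_base)
  finally have "x \<in> span (insert y E)" .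
  moreover have "X \<subseteq> span (insert y E)" using E(3) span_mono[of E "insert y E"] by auto
  moreover have "pairwise (\<lambda>x y. Q x y = 0) (insert y E)"
    using E(2) orth hilbertian_sym[OF assms(1)] by (auto simp: pairwise_insert)
  ultimately show ?case using E(1) by (intro exI[of _ "insert y E"]) auto
qed

text \<open>The coordinate map from Euclidean space into the space seminormed by \<open>p\<close>
  has norm at most 1. Unlike orthonormality, this admits arbitrary multiples of null vectors and
  survives passing to a smaller seminorm.\<close>

definition contractive :: "('a::real_vector \<Rightarrow> real) \<Rightarrow> 'i set \<Rightarrow> ('i \<Rightarrow> 'a) \<Rightarrow> bool" where
  "contractive p I b \<longleftrightarrow> finite I \<and> (\<forall>c. (p (\<Sum>i\<in>I. c i *\<^sub>R b i))\<^sup>2 \<le> (\<Sum>i\<in>I. (c i)\<^sup>2))"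

text \<open>The null vectors of the orthogonal system may be multiplied by a large factor;
  \<open>\<kappa>\<close> is what remains of their coefficients.\<close>

lemma contractive_family_dominating:
  assumes hf: "hilbertian_form p Q" and "finite (X::'a::real_vector set)" and "\<kappa> > 0"
  shows "\<exists>(I::'a set) b. contractive p I b \<and>
    (\<forall>f::'a \<Rightarrow> real. linear f \<longrightarrow> (\<forall>x\<in>X. (f x)\<^sup>2 \<le> ((p x)\<^sup>2 + \<kappa>) * (\<Sum>i\<in>I. (f (b i))\<^sup>2)))"
proof -
  obtain E where E: "finite E" "pairwise (\<lambda>x y. Q x y = 0) E" "X \<subseteq> span E"
    using hilbertian_orthogonal_spanning[OF hf assms(2)] by blast
  have "\<forall>x\<in>X. \<exists>u. x = (\<Sum>e\<in>E. u e *\<^sub>R e)"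
    using E(3) by (auto simp: span_finite[OF E(1)])
  then obtain u where u: "\<And>x. x \<in> X \<Longrightarrow> x = (\<Sum>e\<in>E. u x e *\<^sub>R e)" by metis
  \<comment> \<open>\<open>R\<close> bounds the squared coefficients of every
    \<open>x \<in> X\<close>. Null vectors receive the factor \<open>N\<close>, so their share is at
    most \<open>R / N^2 = \<kappa> * R / (R + 1) \<le> \<kappa>\<close>; the added 1 keeps
    \<open>N\<close> positive when \<open>R = 0\<close>.\<close>
  define R where "R = (\<Sum>x\<in>X. \<Sum>e\<in>E. (u x e)\<^sup>2)"
  have R: "R \<ge> 0" unfolding R_def by (intro sum_nonneg) auto
  define N where "N = sqrt ((R + 1) / \<kappa>)"
  have N: "N > 0" "N\<^sup>2 = (R + 1) / \<kappa>" unfolding N_def using R assms(3) by auto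
  define s where "s e = (if p e = 0 then N else 1 / p e)" for e
  define b where "b e = s e *\<^sub>R e" for e
  note nn = hilbertian_nonneg[OF hf]
  have s: "s e > 0" for e using nn[of e] N by (auto simp: s_def)
  have pb: "p (b e) \<le> 1" for e
    using nn[of e] by (auto simp: b_def s_def hilbertian_scaleR[OF hf])
  have Eo: "Q a b = 0" if "a \<in> E" "b \<in> E" "a \<noteq> b" for a b using E(2) that by (auto simp: pairwise_def)
  hence bo: "Q (b a) (b a') = 0" if "a \<in> E" "a' \<in> E" "a \<noteq> a'" for a a'
    using that by (simp add: b_def hilbertian_simps[OF hf])
  have c: "contractive p E b" unfolding contractive_def
  proof (intro conjI allI E(1))
    fix c
    have "(p (\<Sum>i\<in>E. c i *\<^sub>R b i))\<^sup>2 = (\<Sum>i\<in>E. c i * c i * (p (b i))\<^sup>2)"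
      using hilbertian_orthogonal_sum[OF hf E(1), of b c c] bo by (simp add: hilbertian_form_self[OF hf])
    also have "\<dots> \<le> (\<Sum>i\<in>E. (c i)\<^sup>2)"
      using pb nn by (intro sum_mono) (simp add: power2_eq_square mult_left_le mult_le_one)
    finally show "(p (\<Sum>i\<in>E. c i *\<^sub>R b i))\<^sup>2 \<le> (\<Sum>i\<in>E. (c i)\<^sup>2)" .
  qed
  have "(f x)\<^sup>2 \<le> ((p x)\<^sup>2 + \<kappa>) * (\<Sum>i\<in>E. (f (b i))\<^sup>2)" if f: "linear f" and x: "x \<in> X" for f :: "'a \<Rightarrow> real" and x
  proof -
    have "f x = (\<Sum>e\<in>E. (u x e / s e) * f (b e))"
    proof -
      have "f x = (\<Sum>e\<in>E. u x e * f e)"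
        by (subst u[OF x]) (simp add: linear_sum[OF f] linear_cmul[OF f])
      also have "\<dots> = (\<Sum>e\<in>E. (u x e / s e) * f (b e))"
        by (intro sum.cong refl) (use s in \<open>auto simp: b_def linear_cmul[OF f] less_imp_neq[THEN not_sym]\<close>)
      finally show ?thesis .
    qed
    hence "(f x)\<^sup>2 \<le> (\<Sum>e\<in>E. (u x e / s e)\<^sup>2) * (\<Sum>e\<in>E. (f (b e))\<^sup>2)"
      using Cauchy_Schwarz_ineq_sum by metis
    moreover have "(\<Sum>e\<in>E. (u x e / s e)\<^sup>2) \<le> (p x)\<^sup>2 + \<kappa>"
    proof -
      have "(u x e / s e)\<^sup>2 \<le> (u x e)\<^sup>2 * (p e)\<^sup>2 + (u x e)\<^sup>2 / N\<^sup>2" for e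
        by (auto simp: s_def power_divide power_mult_distrib)
      hence "(\<Sum>e\<in>E. (u x e / s e)\<^sup>2) \<le> (\<Sum>e\<in>E. (u x e)\<^sup>2 * (p e)\<^sup>2 + (u x e)\<^sup>2 / N\<^sup>2)"
        by (rule sum_mono)
      also have "\<dots> = (\<Sum>e\<in>E. (u x e)\<^sup>2 * (p e)\<^sup>2) + (\<Sum>e\<in>E. (u x e)\<^sup>2) / N\<^sup>2"
        by (simp add: sum.distrib sum_divide_distrib)
      also have "(\<Sum>e\<in>E. (u x e)\<^sup>2 * (p e)\<^sup>2) = (p x)\<^sup>2"
        using hilbertian_orthogonal_sum[OF hf E(1), of "\<lambda>e. e" "u x" "u x"] Eo u[OF x]
        by (simp add: hilbertian_form_self[OF hf] power2_eq_square)
      also have "(\<Sum>e\<in>E. (u x e)\<^sup>2) / N\<^sup>2 \<le> R / N\<^sup>2"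
        unfolding R_def using x assms(2)
        by (intro divide_right_mono member_le_sum[of x X "\<lambda>x. \<Sum>e\<in>E. (u x e)\<^sup>2"]) (auto intro: sum_nonneg)
      also have "R / N\<^sup>2 \<le> \<kappa>" using R assms(3) by (simp add: N(2) field_simps)
      finally show ?thesis by simp
    qed
    ultimately show ?thesis
      by (meson mult_right_mono order_trans sum_nonneg zero_le_power2)
  qed
  with c show ?thesis by blast
qed

text \<open>Composition with a contraction does not increase a Hilbert-Schmidt norm. In coordinates
  of a \<open>p\<close>-orthogonal system \<open>p^2\<close> is a weighted sum of squares, so the
  hypothesis on \<open>a\<close> applies to each coordinate separately.\<close>

lemma gram_trace_le:
  fixes x :: "'j \<Rightarrow> 'a::real_vector"
  assumes hf: "hilbertian_form p P" and J: "finite J" and I: "finite I"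
    and a: "\<And>v. (\<Sum>i\<in>I. (\<Sum>j\<in>J. a i j * v j)\<^sup>2) \<le> (\<Sum>j\<in>J. (v j)\<^sup>2)"
  shows "(\<Sum>i\<in>I. (p (\<Sum>j\<in>J. a i j *\<^sub>R x j))\<^sup>2) \<le> (\<Sum>j\<in>J. (p (x j))\<^sup>2)"
proof -
  obtain E where E: "finite E" "pairwise (\<lambda>x y. P x y = 0) E" "x ` J \<subseteq> span E"
    using hilbertian_orthogonal_spanning[OF hf, of "x ` J"] J by blast
  have "\<forall>j\<in>J. \<exists>u. x j = (\<Sum>e\<in>E. u e *\<^sub>R e)"
    using E(3) by (auto simp: span_finite[OF E(1)])
  then obtain u where u: "\<And>j. j \<in> J \<Longrightarrow> x j = (\<Sum>e\<in>E. u j e *\<^sub>R e)" by metis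
  have sq: "(p (\<Sum>e\<in>E. c e *\<^sub>R e))\<^sup>2 = (\<Sum>e\<in>E. (c e)\<^sup>2 * (p e)\<^sup>2)" for c
    using hilbertian_orthogonal_sum[OF hf E(1), of "\<lambda>e. e" c c] E(2)
    by (simp add: hilbertian_form_self[OF hf] power2_eq_square pairwise_def)
  have y: "(\<Sum>j\<in>J. a i j *\<^sub>R x j) = (\<Sum>e\<in>E. (\<Sum>j\<in>J. a i j * u j e) *\<^sub>R e)" for i
    by (simp add: u scaleR_sum_right scaleR_sum_left sum.swap[of _ E])
  have "(\<Sum>i\<in>I. (p (\<Sum>j\<in>J. a i j *\<^sub>R x j))\<^sup>2) = (\<Sum>e\<in>E. (\<Sum>i\<in>I. (\<Sum>j\<in>J. a i j * u j e)\<^sup>2) * (p e)\<^sup>2)"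
    by (simp add: y sq sum.swap[of _ I] sum_distrib_right)
  also have "\<dots> \<le> (\<Sum>e\<in>E. (\<Sum>j\<in>J. (u j e)\<^sup>2) * (p e)\<^sup>2)"
    by (intro sum_mono mult_right_mono a) auto
  also have "\<dots> = (\<Sum>j\<in>J. (p (x j))\<^sup>2)"
    by (simp add: u sq sum_distrib_right sum.swap[of _ E])
  finally show ?thesis .
qed

section \<open>The Hilbert completion and Hilbert-Schmidt maps\<close>

lemma cauchy_seqs_singleton:
  "x \<in> cauchy_seqs {q} \<longleftrightarrow> (\<forall>e>0. \<exists>N. \<forall>m\<ge>N. \<forall>n\<ge>N. q (x m - x n) < e)"
  by (simp add: cauchy_seqs_def)

lemma cauchy_seqs_const: "hilbertian_form q Q \<Longrightarrow> (\<lambda>_. b) \<in> cauchy_seqs {q}"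
  by (simp add: cauchy_seqs_singleton hilbertian_0)

lemma cauchy_seqs_add:
  assumes hf: "hilbertian_form q Q" and x: "x \<in> cauchy_seqs {q}" and y: "y \<in> cauchy_seqs {q}"
  shows "(\<lambda>k. x k + y k) \<in> cauchy_seqs {q}"
  unfolding cauchy_seqs_singleton
proof (intro allI impI)
  fix e :: real assume "e > 0"
  then obtain N1 N2 where "\<And>m n. m \<ge> N1 \<Longrightarrow> n \<ge> N1 \<Longrightarrow> q (x m - x n) < e / 2"
    "\<And>m n. m \<ge> N2 \<Longrightarrow> n \<ge> N2 \<Longrightarrow> q (y m - y n) < e / 2"
    using x y unfolding cauchy_seqs_singleton by (meson half_gt_zero)
  moreover have "q (x m + y m - (x n + y n)) \<le> q (x m - x n) + q (y m - y n)" for m n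
    using hilbertian_triangle[OF hf, of "x m - x n" "y m - y n"] by (simp add: algebra_simps)
  ultimately show "\<exists>N. \<forall>m\<ge>N. \<forall>n\<ge>N. q (x m + y m - (x n + y n)) < e"
    by (intro exI[of _ "max N1 N2"]) (smt (verit) field_sum_of_halves max.bounded_iff)
qed

lemma cauchy_seqs_scale:
  assumes hf: "hilbertian_form q Q" and x: "x \<in> cauchy_seqs {q}"
  shows "(\<lambda>k. c *\<^sub>R x k) \<in> cauchy_seqs {q}"
  unfolding cauchy_seqs_singleton
proof (intro allI impI)
  fix e :: real assume e: "e > 0"
  then obtain N where N: "\<And>m n. m \<ge> N \<Longrightarrow> n \<ge> N \<Longrightarrow> q (x m - x n) < e / (\<bar>c\<bar> + 1)"
    using x unfolding cauchy_seqs_singleton by (meson abs_ge_zero add_nonneg_pos divide_pos_pos zero_less_one)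
  have "q (c *\<^sub>R x m - c *\<^sub>R x n) < e" if "m \<ge> N" "n \<ge> N" for m n
  proof -
    have "q (c *\<^sub>R x m - c *\<^sub>R x n) = \<bar>c\<bar> * q (x m - x n)"
      using hilbertian_scaleR[OF hf, of c "x m - x n"] by (simp add: scaleR_diff_right)
    also have "\<dots> \<le> \<bar>c\<bar> * (e / (\<bar>c\<bar> + 1))"
      using N[OF that] by (intro mult_left_mono) auto
    also have "\<dots> < e" using e by (simp add: field_simps add_pos_nonneg)
    finally show ?thesis .
  qed
  thus "\<exists>N. \<forall>m\<ge>N. \<forall>n\<ge>N. q (c *\<^sub>R x m - c *\<^sub>R x n) < e" by blast
qed

lemma cauchy_seqs_lincomb:
  assumes hf: "hilbertian_form q Q" and "\<And>j. j \<in> J \<Longrightarrow> x j \<in> cauchy_seqs {q}"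
  shows "(\<lambda>k. \<Sum>j\<in>J. c j *\<^sub>R x j k) \<in> cauchy_seqs {q}"
  using assms(2)
proof (induction J rule: infinite_finite_induct)
  case (insert j J)
  thus ?case
    using cauchy_seqs_add[OF hf cauchy_seqs_scale[OF hf, of "x j" "c j"]] by auto
qed (simp_all add: cauchy_seqs_const[OF hf])

lemma extend_tendsto:
  assumes hp: "hilbertian_form p P" and "\<And>x. p x \<le> q x" and x: "x \<in> cauchy_seqs {q}"
  shows "(\<lambda>k. p (x k)) \<longlonglongrightarrow> extend p x"
proof -
  have "Cauchy (\<lambda>k. p (x k))"
  proof (rule metric_CauchyI)
    fix e :: real assume "e > 0"
    then obtain N where N: "\<And>m n. m \<ge> N \<Longrightarrow> n \<ge> N \<Longrightarrow> q (x m - x n) < e"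
      using x unfolding cauchy_seqs_singleton by metis
    have "dist (p (x m)) (p (x n)) < e" if "m \<ge> N" "n \<ge> N" for m n
      using hilbertian_triangle_diff[OF hp, of "x m" "x n"] assms(2)[of "x m - x n"] N[OF that]
      by (simp add: dist_real_def)
    thus "\<exists>N. \<forall>m\<ge>N. \<forall>n\<ge>N. dist (p (x m)) (p (x n)) < e" by blast
  qed
  thus ?thesis by (simp add: Cauchy_convergent_iff convergent_LIMSEQ_iff extend_def)
qed

lemma cauchy_seqs_bounded:
  assumes hf: "hilbertian_form q Q" and x: "x \<in> cauchy_seqs {q}"
  obtains B where "B > 0" "\<And>k. q (x k) \<le> B"
proof -
  have "Bseq (\<lambda>k. q (x k))"
    using extend_tendsto[OF hf order_refl x] convergent_imp_Bseq convergentI by blast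
  then obtain B where B: "B > 0" "\<And>k. norm (q (x k)) \<le> B" by (auto elim: BseqE)
  show ?thesis by (rule that[of B]) (use B in \<open>auto intro: abs_le_D1\<close>)
qed

lemma extend2_tendsto:
  assumes hf: "hilbertian_form q Q" and x: "x \<in> cauchy_seqs {q}" and y: "y \<in> cauchy_seqs {q}"
  shows "(\<lambda>k. Q (x k) (y k)) \<longlonglongrightarrow> extend2 Q x y"
proof -
  note nn = hilbertian_nonneg[OF hf]
  obtain B1 where B1: "B1 > 0" "\<And>k. q (x k) \<le> B1" using cauchy_seqs_bounded[OF hf x] by blast
  obtain B2 where B2: "B2 > 0" "\<And>k. q (y k) \<le> B2" using cauchy_seqs_bounded[OF hf y] by blast
  have "Cauchy (\<lambda>k. Q (x k) (y k))"
  proof (rule metric_CauchyI)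
    fix e :: real assume e: "e > 0"
    obtain N1 where N1: "\<And>m n. m \<ge> N1 \<Longrightarrow> n \<ge> N1 \<Longrightarrow> q (x m - x n) < e / (2 * B2)"
      using x e B2(1) unfolding cauchy_seqs_singleton by (meson divide_pos_pos mult_pos_pos zero_less_numeral)
    obtain N2 where N2: "\<And>m n. m \<ge> N2 \<Longrightarrow> n \<ge> N2 \<Longrightarrow> q (y m - y n) < e / (2 * B1)"
      using y e B1(1) unfolding cauchy_seqs_singleton by (meson divide_pos_pos mult_pos_pos zero_less_numeral)
    have "\<bar>Q (x m) (y m) - Q (x n) (y n)\<bar> < e" if "m \<ge> max N1 N2" "n \<ge> max N1 N2" for m n
    proof -
      have "Q (x m) (y m) - Q (x n) (y n) = Q (x m - x n) (y m) + Q (x n) (y m - y n)"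
        by (simp add: hilbertian_simps[OF hf])
      hence "\<bar>Q (x m) (y m) - Q (x n) (y n)\<bar> \<le> q (x m - x n) * q (y m) + q (x n) * q (y m - y n)"
        using hilbertian_Cauchy_Schwarz[OF hf, of "x m - x n" "y m"]
          hilbertian_Cauchy_Schwarz[OF hf, of "x n" "y m - y n"] by linarith
      also have "\<dots> \<le> q (x m - x n) * B2 + B1 * q (y m - y n)"
        using nn B1 B2 by (intro add_mono mult_mono) (auto intro: less_imp_le)
      also have "\<dots> < e / (2 * B2) * B2 + B1 * (e / (2 * B1))"
        using N1[of m n] N2[of m n] that B1(1) B2(1)
        by (intro add_strict_mono mult_strict_right_mono mult_strict_left_mono) auto
      also have "\<dots> = e" using B1(1) B2(1) by (simp add: field_simps)
      finally show ?thesis .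
    qed
    thus "\<exists>N. \<forall>m\<ge>N. \<forall>n\<ge>N. dist (Q (x m) (y m)) (Q (x n) (y n)) < e"
      unfolding dist_real_def by blast
  qed
  thus ?thesis by (simp add: Cauchy_convergent_iff convergent_LIMSEQ_iff extend2_def)
qed

section \<open>Fourier expansion with respect to an orthonormal basis of the completion\<close>

context
  fixes q :: "'a::real_vector \<Rightarrow> real" and Q E
  assumes hf: "hilbertian_form q Q" and onb: "completion_onb q Q E"
begin

lemma onb_cauchy: "e \<in> E \<Longrightarrow> e \<in> cauchy_seqs {q}"
  using onb by (auto simp: completion_onb_def)

lemma onb_tendsto:
  assumes "e \<in> E" "e' \<in> E" shows "(\<lambda>k. Q (e k) (e' k)) \<longlonglongrightarrow> (if e = e' then 1 else 0)"
  using extend2_tendsto[OF hf onb_cauchy[OF assms(1)] onb_cauchy[OF assms(2)]] onb assms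
  unfolding completion_onb_def by auto

lemma onb_lincomb_tendsto:
  assumes J: "finite J" "J \<subseteq> E"
  shows "(\<lambda>k. Q (\<Sum>e\<in>J. c e *\<^sub>R e k) (\<Sum>e\<in>J. d e *\<^sub>R e k)) \<longlonglongrightarrow> (\<Sum>e\<in>J. c e * d e)"
proof -
  have "(\<lambda>k. \<Sum>e\<in>J. \<Sum>e'\<in>J. c e' * (d e * Q (e' k) (e k)))
      \<longlonglongrightarrow> (\<Sum>e\<in>J. \<Sum>e'\<in>J. c e' * (d e * (if e' = e then 1 else 0)))"
    using J by (intro tendsto_intros onb_tendsto) auto
  moreover have "Q (\<Sum>e\<in>J. c e *\<^sub>R e k) (\<Sum>e\<in>J. d e *\<^sub>R e k)
      = (\<Sum>e\<in>J. \<Sum>e'\<in>J. c e' * (d e * Q (e' k) (e k)))" for k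
    by (simp add: hilbertian_sum[OF hf] hilbertian_sum2[OF hf] hilbertian_simps[OF hf]
        sum_distrib_left algebra_simps)
  moreover have "(\<Sum>e\<in>J. \<Sum>e'\<in>J. c e' * (d e * (if e' = e then 1 else 0))) = (\<Sum>e\<in>J. c e * d e)"
    using J(1) by (intro sum.cong refl) (simp add: mult_if_delta if_distrib[of "(*) _"] cong: if_cong)
  ultimately show ?thesis by simp
qed

lemma onb_lincomb_norm_tendsto:
  assumes J: "finite J" "J \<subseteq> E"
  shows "(\<lambda>k. (q (\<Sum>e\<in>J. c e *\<^sub>R e k))\<^sup>2) \<longlonglongrightarrow> (\<Sum>e\<in>J. (c e)\<^sup>2)"
  using onb_lincomb_tendsto[OF J, of c c] by (simp add: hilbertian_form_self[OF hf] power2_eq_square)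

definition fourier_coeff :: "'a \<Rightarrow> (nat \<Rightarrow> 'a) \<Rightarrow> real" where
  "fourier_coeff b e = extend2 Q (\<lambda>_. b) e"

lemma fourier_coeff_tendsto: "e \<in> E \<Longrightarrow> (\<lambda>k. Q b (e k)) \<longlonglongrightarrow> fourier_coeff b e"
  unfolding fourier_coeff_def
  using extend2_tendsto[OF hf cauchy_seqs_const[OF hf] onb_cauchy] by auto

text \<open>Along representing sequences the orthonormality relations hold only in the limit, so the
  usual identity for the Fourier remainder becomes a limit over \<open>k\<close>.\<close>

lemma bessel_remainder_tendsto:
  assumes J: "finite J" "J \<subseteq> E"
  shows "(\<lambda>k. (q (b - (\<Sum>e\<in>J. fourier_coeff b e *\<^sub>R e k)))\<^sup>2)
    \<longlonglongrightarrow> (q b)\<^sup>2 - (\<Sum>e\<in>J. (fourier_coeff b e)\<^sup>2)"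
proof -
  let ?a = "fourier_coeff b"
  have "(\<lambda>k. (q b)\<^sup>2 - 2 * (\<Sum>e\<in>J. ?a e * Q b (e k)) + (q (\<Sum>e\<in>J. ?a e *\<^sub>R e k))\<^sup>2)
      \<longlonglongrightarrow> (q b)\<^sup>2 - 2 * (\<Sum>e\<in>J. ?a e * ?a e) + (\<Sum>e\<in>J. (?a e)\<^sup>2)"
    using J by (intro tendsto_intros onb_lincomb_norm_tendsto fourier_coeff_tendsto) auto
  moreover have "(q (b - (\<Sum>e\<in>J. ?a e *\<^sub>R e k)))\<^sup>2
      = (q b)\<^sup>2 - 2 * (\<Sum>e\<in>J. ?a e * Q b (e k)) + (q (\<Sum>e\<in>J. ?a e *\<^sub>R e k))\<^sup>2" for k
  proof -
    let ?s = "\<Sum>e\<in>J. ?a e *\<^sub>R e k"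
    have "Q b ?s = (\<Sum>e\<in>J. ?a e * Q b (e k))"
      by (simp add: hilbertian_sum2[OF hf] hilbertian_simps[OF hf])
    thus ?thesis using hilbertian_sym[OF hf, of ?s b]
      by (simp add: hilbertian_form_self[OF hf, symmetric] hilbertian_diff[OF hf] hilbertian_diff2[OF hf])
  qed
  ultimately show ?thesis by (simp add: power2_eq_square)
qed

lemma bessel:
  assumes J: "finite J" "J \<subseteq> E" shows "(\<Sum>e\<in>J. (fourier_coeff b e)\<^sup>2) \<le> (q b)\<^sup>2"
  using LIMSEQ_le_const[OF bessel_remainder_tendsto[OF J, of b], of 0] by simp

text \<open>A diagonal sequence turns the Fourier expansion in the completion into a Cauchy sequence of
  the space itself; the remainder is orthogonal to the basis, so it is null by maximality.\<close>

lemma parseval: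
  assumes "\<epsilon> > 0"
  shows "\<exists>J\<subseteq>E. finite J \<and>
    (\<forall>J'. finite J' \<and> J \<subseteq> J' \<and> J' \<subseteq> E \<longrightarrow> (q b)\<^sup>2 - (\<Sum>e\<in>J'. (fourier_coeff b e)\<^sup>2) < \<epsilon>)"
proof -
  let ?a = "fourier_coeff b"
  note nn = hilbertian_nonneg[OF hf] and tri = hilbertian_triangle[OF hf]
  define FJ where "FJ = {J. finite J \<and> J \<subseteq> E}"
  \<comment> \<open>The basis need not be countable. Countably many finite sets whose partial sums
    approach this supremum carry the whole expansion of \<open>b\<close>.\<close>
  define s where "s = (SUP J\<in>FJ. \<Sum>e\<in>J. (?a e)\<^sup>2)"
  have bdd: "bdd_above ((\<lambda>J. \<Sum>e\<in>J. (?a e)\<^sup>2) ` FJ)"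
    unfolding FJ_def using bessel by (intro bdd_aboveI2[of _ _ "(q b)\<^sup>2"]) auto
  have ne: "FJ \<noteq> {}" unfolding FJ_def by auto
  define r where "r m = 1 / (real m + 1)" for m
  have r: "r m > 0" "r n \<le> r m" if "m \<le> n" for m n using that by (auto simp: r_def frac_le)
  have rp: "r m > 0" for m using r(1)[of m m] by simp
  have r0: "r \<longlonglongrightarrow> 0" unfolding r_def by real_asymp
  have "\<exists>J\<in>FJ. s - (r m)\<^sup>2 < (\<Sum>e\<in>J. (?a e)\<^sup>2)" for m
    using less_cSUP_iff[OF ne bdd, of "s - (r m)\<^sup>2"] rp[of m] by (simp add: s_def)
  then obtain J0 where J0: "\<And>m. J0 m \<in> FJ" "\<And>m. s - (r m)\<^sup>2 < (\<Sum>e\<in>J0 m. (?a e)\<^sup>2)" by metis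
  define J where "J m = (\<Union>i\<le>m. J0 i)" for m
  have J: "finite (J m)" "J m \<subseteq> E" for m using J0(1) by (auto simp: J_def FJ_def)
  have Jmono: "J m \<subseteq> J n" if "m \<le> n" for m n using that by (force simp: J_def)
  \<comment> \<open>A finite set disjoint from \<open>J m\<close> with more weight would push a
    partial sum above the supremum \<open>s\<close>.\<close>
  have tail: "(\<Sum>e\<in>K - J m. (?a e)\<^sup>2) < (r m)\<^sup>2" if "K \<in> FJ" for K m
  proof -
    have "(\<Sum>e\<in>J0 m. (?a e)\<^sup>2) \<le> (\<Sum>e\<in>J m. (?a e)\<^sup>2)"
      using J(1) by (intro sum_mono2) (auto simp: J_def)
    moreover have "(\<Sum>e\<in>K \<union> J m. (?a e)\<^sup>2) \<le> s"
      unfolding s_def using that J by (intro cSUP_upper bdd) (auto simp: FJ_def)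
    moreover have "(\<Sum>e\<in>K \<union> J m. (?a e)\<^sup>2) = (\<Sum>e\<in>K - J m. (?a e)\<^sup>2) + (\<Sum>e\<in>J m. (?a e)\<^sup>2)"
      using that J(1) by (subst sum.union_disjoint[symmetric]) (auto simp: FJ_def intro: sum.cong)
    ultimately show ?thesis using J0(2)[of m] by linarith
  qed
  define y where "y m k = (\<Sum>e\<in>J m. ?a e *\<^sub>R e k)" for m k
  have "y m \<in> cauchy_seqs {q}" for m
    unfolding y_def using J(2) onb_cauchy by (intro cauchy_seqs_lincomb[OF hf]) auto
  hence "\<exists>K. \<forall>k\<ge>K. \<forall>l\<ge>K. q (y m k - y m l) < r m" for m
    using rp[of m] unfolding cauchy_seqs_singleton by blast
  then obtain K where K: "\<And>m k l. k \<ge> K m \<Longrightarrow> l \<ge> K m \<Longrightarrow> q (y m k - y m l) < r m" by metis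
  \<comment> \<open>The diagonal choice: \<open>w m\<close> is a vector of the space within
    \<open>r m\<close> of every late member of the sequence representing the \<open>m\<close>-th
    partial sum.\<close>
  define w where "w m = y m (K m)" for m
  have wy: "q (w m - y m k) < r m" if "k \<ge> K m" for m k unfolding w_def using K that by auto
  \<comment> \<open>One \<open>r m\<close> for the coefficients in \<open>J l - J m\<close>, one for
    replacing \<open>y m k\<close> by \<open>w m\<close>, and \<open>r l \<le> r m\<close> for
    replacing \<open>y l k\<close> by \<open>w l\<close>.\<close>
  have w: "q (w m - w l) < 3 * r m" if "m \<le> l" for m l
  proof -
    have ev: "eventually (\<lambda>k. (q (\<Sum>e\<in>J l - J m. ?a e *\<^sub>R e k))\<^sup>2 < (r m)\<^sup>2) sequentially"
      using J tail[of "J l" m]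
      by (intro order_tendstoD(2)[OF onb_lincomb_norm_tendsto]) (auto simp: FJ_def)
    have "eventually (\<lambda>k. q (w m - w l) < 3 * r m) sequentially"
      using ev eventually_ge_at_top[of "K m"] eventually_ge_at_top[of "K l"]
    proof eventually_elim
      case (elim k)
      have "y l k - y m k = (\<Sum>e\<in>J l - J m. ?a e *\<^sub>R e k)"
        unfolding y_def using J(1) Jmono[OF that] by (simp add: sum_diff)
      hence "q (y l k - y m k) < r m"
        using elim(1) rp[of m] by (metis power2_less_imp_less less_imp_le)
      hence "q (y m k - y l k) < r m" by (metis hilbertian_minus_commute[OF hf])
      moreover have "q (w m - w l) \<le> q (w m - y m k) + (q (y m k - y l k) + q (y l k - w l))"
        using tri[of "w m - y m k" "y m k - w l"] tri[of "y m k - y l k" "y l k - w l"] by simp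
      moreover have "q (y l k - w l) < r l"
        using wy[OF elim(3)] by (metis hilbertian_minus_commute[OF hf])
      ultimately show ?case using wy[OF elim(2)] r(2)[OF that] by linarith
    qed
    thus ?thesis by simp
  qed
  define z where "z m = b - w m" for m
  have z: "z \<in> cauchy_seqs {q}"
    unfolding cauchy_seqs_singleton
  proof (intro allI impI)
    fix e :: real assume "e > 0"
    then obtain N where N: "r N < e / 6"
      using order_tendstoD(2)[OF r0, of "e / 6"] by (auto simp: eventually_sequentially)
    have "q (z m - z n) < e" if "m \<ge> N" "n \<ge> N" for m n
    proof -
      have "q (z m - z n) \<le> q (w N - w m) + q (w N - w n)"
        using tri[of "w n - w N" "w N - w m"] hilbertian_minus_commute[OF hf, of "w n" "w N"]
        by (simp add: z_def)
      thus ?thesis using w[OF that(1)] w[OF that(2)] N by linarith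
    qed
    thus "\<exists>N. \<forall>m\<ge>N. \<forall>n\<ge>N. q (z m - z n) < e" by blast
  qed
  then obtain B where B: "B > 0" "\<And>k. q (z k) \<le> B" using cauchy_seqs_bounded[OF hf] by blast
  have "extend2 Q z e = 0" if e: "e \<in> E" for e
  proof -
    \<comment> \<open>Against the partial sum \<open>y m\<close>, the remainder has the coefficient
      0 at \<open>e\<close> if \<open>e \<in> J m\<close>, and otherwise a coefficient below
      \<open>r m\<close> by \<open>tail\<close>. Passing from \<open>y m k\<close> to
      \<open>w m\<close> costs at most \<open>2 * r m\<close>, as \<open>q (e k) < 2\<close>
      eventually.\<close>
    have G: "eventually (\<lambda>k. \<bar>Q (z m) (e k)\<bar> < 4 * r m) sequentially" for m
    proof -
      \<comment> \<open>Indicator coefficients write \<open>e k\<close> as a combination over the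
        same index set as \<open>y m k\<close>, as \<open>onb_lincomb_tendsto\<close>
        requires.\<close>
      define d where "d e' = (if e' = e then 1 else 0 :: real)" for e'
      let ?J = "insert e (J m)"
      have y': "y m k = (\<Sum>e'\<in>?J. (if e' \<in> J m then ?a e' else 0) *\<^sub>R e' k)" for k
        unfolding y_def using J(1) by (intro sum.mono_neutral_cong_left) auto
      have e': "e k = (\<Sum>e'\<in>?J. d e' *\<^sub>R e' k)" for k
        unfolding d_def using J(1)[of m]
        by (simp add: if_distrib[of "\<lambda>c. c *\<^sub>R _"] sum.delta cong: if_cong)
      have "(\<lambda>k. Q (y m k) (e k)) \<longlonglongrightarrow> (\<Sum>e'\<in>?J. (if e' \<in> J m then ?a e' else 0) * d e')"
        unfolding y' by (subst e') (use J[of m] e in \<open>intro onb_lincomb_tendsto; auto\<close>)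
      also have "(\<Sum>e'\<in>?J. (if e' \<in> J m then ?a e' else 0) * d e') = (if e \<in> J m then ?a e else 0)"
        unfolding d_def using J(1)[of m] by (simp add: if_distrib[of "(*) _"] cong: if_cong)
      finally have "(\<lambda>k. Q b (e k) - Q (y m k) (e k)) \<longlonglongrightarrow> ?a e - (if e \<in> J m then ?a e else 0)"
        by (intro tendsto_diff fourier_coeff_tendsto e)
      moreover have "\<bar>?a e - (if e \<in> J m then ?a e else 0)\<bar> < r m"
      proof (cases "e \<in> J m")
        case False
        have "(?a e)\<^sup>2 < (r m)\<^sup>2" using tail[of "{e}" m] e False by (simp add: FJ_def insert_Diff_if)
        thus ?thesis using False rp[of m] power2_less_imp_less[of "\<bar>?a e\<bar>" "r m"] by simp
      qed (use rp in auto)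
      ultimately have 1: "eventually (\<lambda>k. \<bar>Q b (e k) - Q (y m k) (e k)\<bar> < r m) sequentially"
        using order_tendstoD(2)[OF tendsto_rabs] by blast
      have "(\<lambda>k. (q (e k))\<^sup>2) \<longlonglongrightarrow> 1"
        using onb_tendsto[OF e e] by (simp add: hilbertian_form_self[OF hf])
      hence 2: "eventually (\<lambda>k. (q (e k))\<^sup>2 < 2\<^sup>2) sequentially" by (rule order_tendstoD) simp
      show ?thesis using 1 2 eventually_ge_at_top[of "K m"]
      proof eventually_elim
        case (elim k)
        have "\<bar>Q (w m - y m k) (e k)\<bar> \<le> q (w m - y m k) * q (e k)"
          by (rule hilbertian_Cauchy_Schwarz[OF hf])
        also have "\<dots> \<le> r m * 2"
          using wy[OF elim(3)] power2_less_imp_less[OF elim(2)] nn rp[of m]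
          by (intro mult_mono) auto
        moreover have "Q (z m) (e k) = (Q b (e k) - Q (y m k) (e k)) - Q (w m - y m k) (e k)"
          by (simp add: z_def hilbertian_simps[OF hf])
        ultimately show ?case using elim(1) rp[of m] by linarith
      qed
    qed
    have "(\<lambda>m. Q (z m) (e m)) \<longlonglongrightarrow> 0"
    proof (rule LIMSEQ_I)
      fix \<eta> :: real assume \<eta>: "\<eta> > 0"
      obtain N where N: "\<And>m n. m \<ge> N \<Longrightarrow> n \<ge> N \<Longrightarrow> q (e m - e n) < \<eta> / (2 * B)"
        using onb_cauchy[OF e] \<eta> B(1) unfolding cauchy_seqs_singleton
        by (meson divide_pos_pos mult_pos_pos zero_less_numeral)
      \<comment> \<open>\<open>G\<close> contributes \<open>4 * r m < \<eta> / 2\<close>; moving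
        from \<open>e k\<close> to \<open>e m\<close> contributes the other
        \<open>\<eta> / 2\<close>.\<close>
      obtain N' where N': "\<And>m. m \<ge> N' \<Longrightarrow> r m < \<eta> / 8"
        using order_tendstoD(2)[OF r0, of "\<eta> / 8"] \<eta> by (auto simp: eventually_sequentially)
      have "norm (Q (z m) (e m) - 0) < \<eta>" if m: "m \<ge> max N N'" for m
      proof -
        obtain k where k: "k \<ge> N" "\<bar>Q (z m) (e k)\<bar> < 4 * r m"
          using eventually_happens[OF eventually_conj[OF G[of m] eventually_ge_at_top[of N]]] by auto
        have "\<bar>Q (z m) (e m - e k)\<bar> \<le> q (z m) * q (e m - e k)"
          by (rule hilbertian_Cauchy_Schwarz[OF hf])
        also have "\<dots> \<le> B * (\<eta> / (2 * B))"
          using B N[of m k] m k(1) nn by (intro mult_mono) (auto intro: less_imp_le)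
        also have "\<dots> = \<eta> / 2" using B(1) by simp
        finally have "\<bar>Q (z m) (e m) - Q (z m) (e k)\<bar> \<le> \<eta> / 2"
          by (simp only: hilbertian_diff2[OF hf])
        moreover have "r m < \<eta> / 8" using N' m by simp
        ultimately show ?thesis using k(2) unfolding real_norm_def by linarith
      qed
      thus "\<exists>no. \<forall>n\<ge>no. norm (Q (z n) (e n) - 0) < \<eta>" by blast
    qed
    thus ?thesis using extend2_tendsto[OF hf z onb_cauchy[OF e]] LIMSEQ_unique by blast
  qed
  hence "extend q z = 0" using onb z by (auto simp: completion_onb_def)
  hence z0: "(\<lambda>m. q (z m)) \<longlonglongrightarrow> 0" using extend_tendsto[OF hf order_refl z] by simp
  \<comment> \<open>The remainder is compared in norm, not in squared norm: \<open>q (z m)\<close>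
    and \<open>q (w m - y m k)\<close> are each below \<open>\<delta> / 4\<close>, so its square is
    at most \<open>\<epsilon> / 4\<close>.\<close>
  define \<delta> where "\<delta> = sqrt \<epsilon>"
  have \<delta>: "\<delta> > 0" "\<delta>\<^sup>2 = \<epsilon>" using assms by (auto simp: \<delta>_def)
  obtain m where m: "q (z m) < \<delta> / 4" "r m < \<delta> / 4"
    using eventually_happens[OF eventually_conj[OF order_tendstoD(2)[OF z0, of "\<delta> / 4"]
          order_tendstoD(2)[OF r0, of "\<delta> / 4"]]] \<delta> by auto
  have ev: "eventually (\<lambda>k. (q (b - (\<Sum>e\<in>J m. ?a e *\<^sub>R e k)))\<^sup>2 \<le> (\<delta> / 2)\<^sup>2) sequentially"
    using eventually_ge_at_top[of "K m"]
  proof eventually_elim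
    case (elim k)
    have "q (b - y m k) \<le> q (z m) + q (w m - y m k)"
      using tri[of "z m" "w m - y m k"] by (simp add: z_def)
    hence "q (b - y m k) \<le> \<delta> / 2" using wy[OF elim] m by linarith
    thus ?case using nn unfolding y_def by (intro power_mono) auto
  qed
  have "(q b)\<^sup>2 - (\<Sum>e\<in>J m. (?a e)\<^sup>2) \<le> (\<delta> / 2)\<^sup>2"
    by (rule tendsto_upperbound[OF bessel_remainder_tendsto ev]) (use J in auto)
  also have "\<dots> < \<epsilon>" using \<delta> assms by (simp add: power_divide)
  finally have less: "(q b)\<^sup>2 - (\<Sum>e\<in>J m. (?a e)\<^sup>2) < \<epsilon>" .
  show ?thesis
  proof (intro exI[of _ "J m"] conjI allI impI J)
    fix J' assume J': "finite J' \<and> J m \<subseteq> J' \<and> J' \<subseteq> E"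
    have "(\<Sum>e\<in>J m. (?a e)\<^sup>2) \<le> (\<Sum>e\<in>J'. (?a e)\<^sup>2)"
      using J' by (intro sum_mono2) auto
    thus "(q b)\<^sup>2 - (\<Sum>e\<in>J'. (?a e)\<^sup>2) < \<epsilon>" using less by linarith
  qed
qed

end

text \<open>The Hilbert-Schmidt property of the canonical map between the completions,
  expressed inside the space itself.\<close>

definition hs_bounded :: "('a::real_vector \<Rightarrow> real) \<Rightarrow> ('a \<Rightarrow> real) \<Rightarrow> real \<Rightarrow> bool" where
  "hs_bounded p q C \<longleftrightarrow>
     (\<forall>(I::'a set) b. contractive q I b \<longrightarrow> (\<Sum>i\<in>I. (p (b i))\<^sup>2) \<le> C)"

text \<open>All \<open>b i\<close> are replaced by Fourier sums over one finite set
  \<open>J\<close>. The coefficient matrix is a contraction, so \<open>gram_trace_le\<close>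
  compares the trace over \<open>I\<close> with the trace over the basis. The bound
  \<open>4 + 2 * C\<close> is \<open>2 * 1\<close> for the approximation errors plus
  \<open>2 * (C + 1)\<close> for the basis, the factors 2 coming from
  \<open>(x + y)^2 \<le> 2 * x^2 + 2 * y^2\<close>.\<close>

lemma hilbert_schmidt_imp_hs_bounded:
  fixes p q :: "'a::real_vector \<Rightarrow> real"
  assumes hp: "hilbertian_form p P" and pq: "\<And>x. p x \<le> q x"
    and hs: "canonical_map_hilbert_schmidt p q"
  shows "\<exists>C. hs_bounded p q C"
proof -
  obtain Q E where hf: "hilbertian_form q Q" and onb: "completion_onb q Q E"
    and summ: "(\<lambda>e. (extend p e)\<^sup>2) summable_on E"
    using hs unfolding canonical_map_hilbert_schmidt_def by blast
  define C where "C = infsum (\<lambda>e. (extend p e)\<^sup>2) E"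
  note nn = hilbertian_nonneg[OF hp] and nnq = hilbertian_nonneg[OF hf]
  let ?a = "fourier_coeff Q"
  have "(\<Sum>i\<in>I. (p (b i))\<^sup>2) \<le> 4 + 2 * C" if cb: "contractive q I b" for I :: "'a set" and b
  proof -
    have I: "finite I" using cb by (simp add: contractive_def)
    \<comment> \<open>The squared errors of all \<open>card I\<close> vectors then add up to at most
      1.\<close>
    define \<epsilon> where "\<epsilon> = 1 / (real (card I) + 1)"
    have \<epsilon>: "\<epsilon> > 0" "\<epsilon> \<le> 1" by (auto simp: \<epsilon>_def)
    have "\<forall>i. \<exists>J\<subseteq>E. finite J \<and> (\<forall>J'. finite J' \<and> J \<subseteq> J' \<and> J' \<subseteq> E \<longrightarrow>
         (q (b i))\<^sup>2 - (\<Sum>e\<in>J'. (?a (b i) e)\<^sup>2) < \<epsilon>\<^sup>2)"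
      using parseval[OF hf onb, of "\<epsilon>\<^sup>2"] \<epsilon> by simp
    then obtain J0 where J0: "\<And>i. J0 i \<subseteq> E" "\<And>i. finite (J0 i)"
      "\<And>i J'. finite J' \<Longrightarrow> J0 i \<subseteq> J' \<Longrightarrow> J' \<subseteq> E \<Longrightarrow> (q (b i))\<^sup>2 - (\<Sum>e\<in>J'. (?a (b i) e)\<^sup>2) < \<epsilon>\<^sup>2"
      by metis
    define J where "J = (\<Union>i\<in>I. J0 i)"
    have J: "finite J" "J \<subseteq> E" using I J0 by (auto simp: J_def)
    define y where "y i k = (\<Sum>e\<in>J. ?a (b i) e *\<^sub>R e k)" for i k
    have ev1: "eventually (\<lambda>k. \<forall>i\<in>I. (q (b i - y i k))\<^sup>2 < \<epsilon>\<^sup>2) sequentially"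
      unfolding y_def using J J0(3)[OF J(1)]
      by (intro eventually_ball_finite I ballI order_tendstoD(2)[OF bessel_remainder_tendsto[OF hf onb]])
        (auto simp: J_def)
    have "(\<lambda>k. \<Sum>e\<in>J. (p (e k))\<^sup>2) \<longlonglongrightarrow> (\<Sum>e\<in>J. (extend p e)\<^sup>2)"
      using J(2) by (intro tendsto_intros extend_tendsto[OF hp pq] onb_cauchy[OF hf onb]) auto
    moreover have "(\<Sum>e\<in>J. (extend p e)\<^sup>2) \<le> C"
      unfolding C_def using J by (intro finite_sum_le_infsum summ) auto
    ultimately have ev2: "eventually (\<lambda>k. (\<Sum>e\<in>J. (p (e k))\<^sup>2) < C + 1) sequentially"
      by (intro order_tendstoD(2)) auto
    \<comment> \<open>Duality: pairing \<open>\<Sum>i\<in>I. c i *\<^sub>R b i\<close> with the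
      combination of the basis by \<open>v\<close> gives at most the product of the Euclidean norms
      of \<open>c\<close> and \<open>v\<close>. For \<open>c\<close> equal to the image of
      \<open>v\<close> under the matrix, the pairing is the squared norm of \<open>c\<close>, and
      one factor cancels.\<close>
    have a: "(\<Sum>i\<in>I. (\<Sum>e\<in>J. ?a (b i) e * v e)\<^sup>2) \<le> (\<Sum>e\<in>J. (v e)\<^sup>2)" for v
    proof -
      define c where "c i = (\<Sum>e\<in>J. ?a (b i) e * v e)" for i
      let ?c = "\<Sum>i\<in>I. (c i)\<^sup>2" and ?v = "\<Sum>e\<in>J. (v e)\<^sup>2"
      have nnc: "?c \<ge> 0" "?v \<ge> 0" by (auto intro: sum_nonneg)
      have "(\<lambda>k. Q (\<Sum>i\<in>I. c i *\<^sub>R b i) (\<Sum>e\<in>J. v e *\<^sub>R e k)) \<longlonglongrightarrow> ?c"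
      proof -
        have "(\<lambda>k. \<Sum>i\<in>I. c i * (\<Sum>e\<in>J. v e * Q (b i) (e k))) \<longlonglongrightarrow> (\<Sum>i\<in>I. c i * (\<Sum>e\<in>J. v e * ?a (b i) e))"
          using J(2) by (intro tendsto_intros fourier_coeff_tendsto[OF hf onb]) auto
        moreover have "(\<Sum>e\<in>J. v e * ?a (b i) e) = c i" for i
          by (simp add: c_def mult.commute)
        moreover have "Q (\<Sum>i\<in>I. c i *\<^sub>R b i) (\<Sum>e\<in>J. v e *\<^sub>R e k)
            = (\<Sum>i\<in>I. c i * (\<Sum>e\<in>J. v e * Q (b i) (e k)))" for k
          by (subst hilbertian_sum[OF hf], simp only: hilbertian_scale[OF hf])
            (simp add: hilbertian_sum2[OF hf] hilbertian_scale2[OF hf])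
        ultimately show ?thesis by (simp add: power2_eq_square)
      qed
      moreover have "(\<lambda>k. sqrt ?c * sqrt ((q (\<Sum>e\<in>J. v e *\<^sub>R e k))\<^sup>2)) \<longlonglongrightarrow> sqrt ?c * sqrt ?v"
        by (intro tendsto_intros onb_lincomb_norm_tendsto[OF hf onb] J)
      moreover have "Q (\<Sum>i\<in>I. c i *\<^sub>R b i) (\<Sum>e\<in>J. v e *\<^sub>R e k)
          \<le> sqrt ?c * sqrt ((q (\<Sum>e\<in>J. v e *\<^sub>R e k))\<^sup>2)" for k
      proof -
        have "q (\<Sum>i\<in>I. c i *\<^sub>R b i) \<le> sqrt ?c"
          using cb by (auto simp: contractive_def intro: real_le_rsqrt)
        hence "q (\<Sum>i\<in>I. c i *\<^sub>R b i) * q (\<Sum>e\<in>J. v e *\<^sub>R e k) \<le> sqrt ?c * q (\<Sum>e\<in>J. v e *\<^sub>R e k)"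
          by (rule mult_right_mono) (rule nnq)
        thus ?thesis
          using hilbertian_Cauchy_Schwarz[OF hf, of "\<Sum>i\<in>I. c i *\<^sub>R b i" "\<Sum>e\<in>J. v e *\<^sub>R e k"]
            nnq[of "\<Sum>e\<in>J. v e *\<^sub>R e k"] by simp
      qed
      ultimately have le: "?c \<le> sqrt ?c * sqrt ?v" by (blast intro: LIMSEQ_le)
      have "?c \<le> ?v"
      proof (cases "?c = 0")
        case False
        hence "sqrt ?c > 0" using nnc by simp
        moreover have "sqrt ?c * sqrt ?c \<le> sqrt ?c * sqrt ?v" using le nnc by simp
        ultimately have "sqrt ?c \<le> sqrt ?v" by (rule mult_left_le_imp_le[rotated])
        thus ?thesis by (simp only: real_sqrt_le_iff)
      qed (use nnc in simp)
      thus ?thesis by (simp add: c_def)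
    qed
    obtain k where k: "\<And>i. i \<in> I \<Longrightarrow> (q (b i - y i k))\<^sup>2 < \<epsilon>\<^sup>2" "(\<Sum>e\<in>J. (p (e k))\<^sup>2) < C + 1"
      using eventually_happens[OF eventually_conj[OF ev1 ev2]] by auto
    have "(p (b i))\<^sup>2 \<le> 2 * \<epsilon>\<^sup>2 + 2 * (p (y i k))\<^sup>2" if "i \<in> I" for i
    proof -
      have "(p (b i))\<^sup>2 \<le> (p (b i - y i k) + p (y i k))\<^sup>2"
        using hilbertian_triangle[OF hp, of "b i - y i k" "y i k"] nn by (intro power_mono) auto
      also have "\<dots> \<le> 2 * (p (b i - y i k))\<^sup>2 + 2 * (p (y i k))\<^sup>2"
        using zero_le_power2[of "p (b i - y i k) - p (y i k)"] by (simp add: power2_eq_square algebra_simps)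
      also have "(p (b i - y i k))\<^sup>2 \<le> (q (b i - y i k))\<^sup>2" using pq nn by (intro power_mono) auto
      finally show ?thesis using k(1)[OF that] by simp
    qed
    hence "(\<Sum>i\<in>I. (p (b i))\<^sup>2) \<le> (\<Sum>i\<in>I. 2 * \<epsilon>\<^sup>2 + 2 * (p (y i k))\<^sup>2)" by (rule sum_mono)
    also have "\<dots> = 2 * (card I * \<epsilon>\<^sup>2) + 2 * (\<Sum>i\<in>I. (p (y i k))\<^sup>2)"
      by (simp add: sum.distrib sum_distrib_left)
    also have "(\<Sum>i\<in>I. (p (y i k))\<^sup>2) \<le> (\<Sum>e\<in>J. (p (e k))\<^sup>2)"
      unfolding y_def by (rule gram_trace_le[OF hp J(1) I a])
    also have "\<dots> \<le> C + 1" using k(2) by simp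
    also have "card I * \<epsilon>\<^sup>2 \<le> 1"
    proof -
      have "card I * \<epsilon> \<le> 1" by (simp add: \<epsilon>_def field_simps)
      thus ?thesis using \<epsilon> by (simp add: power2_eq_square mult_le_one flip: mult.assoc)
    qed
    finally show ?thesis by simp
  qed
  thus ?thesis unfolding hs_bounded_def by blast
qed

section \<open>Nuclear spaces\<close>

lemma cont_hilbertianE:
  assumes "cont_hilbertian T p" obtains P where "hilbertian_form p P"
  using assms by (auto simp: cont_hilbertian_def hilbertian_seminorm_def)

lemma continuous_map_realI:
  assumes "\<And>x e. x \<in> topspace X \<Longrightarrow> e > 0 \<Longrightarrow> \<exists>U. openin X U \<and> x \<in> U \<and> (\<forall>y\<in>U. \<bar>f y - f x\<bar> < e)"
  shows "continuous_map X euclideanreal f"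
proof -
  have loc: "openin X {x \<in> topspace X. P (f x)}"
    if "\<And>t. P t \<Longrightarrow> \<exists>e>0. \<forall>u. \<bar>u - t\<bar> < e \<longrightarrow> P u" for P
  proof (subst openin_subopen, intro ballI)
    fix x assume "x \<in> {x \<in> topspace X. P (f x)}"
    hence x: "x \<in> topspace X" "P (f x)" by auto
    from that[OF x(2)] obtain e where e: "e > 0" "\<And>u. \<bar>u - f x\<bar> < e \<Longrightarrow> P u" by blast
    obtain U where "openin X U" "x \<in> U" "\<forall>y\<in>U. \<bar>f y - f x\<bar> < e" using assms[OF x(1) e(1)] by blast
    thus "\<exists>U. openin X U \<and> x \<in> U \<and> U \<subseteq> {x \<in> topspace X. P (f x)}"
      using e(2) by (intro exI[of _ U]) (auto dest: openin_subset)
  qed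
  have "openin X {x \<in> topspace X. f x > a}" for a
  proof (rule loc)
    fix t assume "t > a"
    thus "\<exists>e>0. \<forall>u. \<bar>u - t\<bar> < e \<longrightarrow> u > a" by (intro exI[of _ "t - a"]) auto
  qed
  moreover have "openin X {x \<in> topspace X. f x < a}" for a
  proof (rule loc)
    fix t assume "t < a"
    thus "\<exists>e>0. \<forall>u. \<bar>u - t\<bar> < e \<longrightarrow> u < a" by (intro exI[of _ "a - t"]) auto
  qed
  ultimately show ?thesis by (simp add: continuous_map_upper_lower_semicontinuous_lt)
qed

lemma hilbertian_form_sum:
  assumes "finite F" and hf: "\<And>i. i \<in> F \<Longrightarrow> hilbertian_form (g i) (Q i)"
  shows "hilbertian_form (\<lambda>x. sqrt (\<Sum>i\<in>F. (g i x)\<^sup>2)) (\<lambda>x y. \<Sum>i\<in>F. Q i x y)"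
  unfolding hilbertian_form_def bilinear_def
proof (intro conjI allI)
  fix x y
  show "linear (\<lambda>y. \<Sum>i\<in>F. Q i x y)" "linear (\<lambda>x. \<Sum>i\<in>F. Q i x y)"
    using hilbertian_bilinear[OF hf] by (auto intro!: linear_compose_sum simp: bilinear_def)
  show "(\<Sum>i\<in>F. Q i x y) = (\<Sum>i\<in>F. Q i y x)"
    using hilbertian_sym[OF hf] by (intro sum.cong) auto
  show "0 \<le> (\<Sum>i\<in>F. Q i x x)"
    using hilbertian_form_self[OF hf] by (intro sum_nonneg) auto
  show "0 \<le> sqrt (\<Sum>i\<in>F. (g i x)\<^sup>2)" by (simp add: sum_nonneg)
  show "(sqrt (\<Sum>i\<in>F. (g i x)\<^sup>2))\<^sup>2 = (\<Sum>i\<in>F. Q i x x)"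
    using hilbertian_form_self[OF hf] by (simp add: sum_nonneg cong: sum.cong)
qed

lemma hilbertian_form_scale:
  assumes hf: "hilbertian_form p Q" and "c \<ge> 0"
  shows "hilbertian_form (\<lambda>x. c * p x) (\<lambda>x y. c\<^sup>2 * Q x y)"
  unfolding hilbertian_form_def bilinear_def
proof (intro conjI allI)
  fix x y
  show "linear (\<lambda>y. c\<^sup>2 * Q x y)" "linear (\<lambda>x. c\<^sup>2 * Q x y)"
    using hilbertian_bilinear[OF hf]
    by (auto intro!: linear_compose_scale_right[where 'b=real, simplified] simp: bilinear_def)
  show "c\<^sup>2 * Q x y = c\<^sup>2 * Q y x" using hilbertian_sym[OF hf] by simp
  show "0 \<le> c\<^sup>2 * Q x x" "0 \<le> c * p x" "(c * p x)\<^sup>2 = c\<^sup>2 * Q x x"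
    using hilbertian_form_self[OF hf] hilbertian_nonneg[OF hf] assms(2) by (simp_all add: power_mult_distrib)
qed

lemma cont_hilbertian_sum:
  assumes "finite F" and "\<And>i. i \<in> F \<Longrightarrow> cont_hilbertian T (g i)"
  shows "cont_hilbertian T (\<lambda>x. sqrt (\<Sum>i\<in>F. (g i x)\<^sup>2))"
proof -
  have "\<forall>i\<in>F. \<exists>Q. hilbertian_form (g i) Q"
    using assms(2) by (auto simp: cont_hilbertian_def hilbertian_seminorm_def)
  then obtain Q where "\<And>i. i \<in> F \<Longrightarrow> hilbertian_form (g i) (Q i)" by metis
  hence "hilbertian_seminorm (\<lambda>x. sqrt (\<Sum>i\<in>F. (g i x)\<^sup>2))"
    using hilbertian_form_sum[OF assms(1)] unfolding hilbertian_seminorm_def by blast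
  moreover have "continuous_map T euclideanreal (\<lambda>x. sqrt (\<Sum>i\<in>F. (g i x)\<^sup>2))"
    using assms by (intro continuous_map_sqrt continuous_map_sum continuous_map_real_pow)
      (auto simp: cont_hilbertian_def)
  ultimately show ?thesis by (simp add: cont_hilbertian_def)
qed

lemma cont_hilbertian_scale:
  assumes "cont_hilbertian T p" and "c \<ge> 0"
  shows "cont_hilbertian T (\<lambda>x. c * p x)"
  using assms hilbertian_form_scale[of p _ c] continuous_map_real_mult[of T "\<lambda>_. c" p]
  unfolding cont_hilbertian_def hilbertian_seminorm_def by auto

lemma topspace_seminorm_topology [simp]: "topspace (seminorm_topology P) = UNIV"
  unfolding seminorm_topology_def topology_generated_by_topspace by auto


lemma seminorm_topology_nbhd:
  assumes P: "\<And>p. p \<in> P \<Longrightarrow> hilbertian_seminorm p"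
    and "openin (seminorm_topology P) U" and "x \<in> U"
  shows "\<exists>F \<delta>. finite F \<and> F \<subseteq> P \<and> \<delta> > 0 \<and> {y. \<forall>p\<in>F. p (y - x) < \<delta>} \<subseteq> U"
proof -
  have "generate_topology_on (insert UNIV {{y. p (y - x) < e} | p x e. p \<in> P \<and> e > 0}) U"
    using assms(2) unfolding seminorm_topology_def openin_topology_generated_by_iff .
  thus ?thesis using assms(3)
  proof (induction)
    case (Int a b)
    then obtain F1 d1 F2 d2 where "finite F1" "F1 \<subseteq> P" "d1 > 0" "{y. \<forall>p\<in>F1. p (y - x) < d1} \<subseteq> a"
      "finite F2" "F2 \<subseteq> P" "d2 > 0" "{y. \<forall>p\<in>F2. p (y - x) < d2} \<subseteq> b" by auto
    thus ?case by (intro exI[of _ "F1 \<union> F2"] exI[of _ "min d1 d2"]) auto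
  next
    case (UN K)
    then obtain k where k: "k \<in> K" "x \<in> k" by blast
    show ?case using UN.IH[OF k] k(1) by blast
  next
    case (Basis s)
    show ?case
    proof (cases "s = UNIV")
      case False
      then obtain p x0 e where p: "p \<in> P" "e > 0" "s = {y. p (y - x0) < e}" using Basis(1) by auto
      obtain Q where Q: "hilbertian_form p Q" using P[OF p(1)] by (auto simp: hilbertian_seminorm_def)
      have "{y. \<forall>p\<in>{p}. p (y - x) < e - p (x - x0)} \<subseteq> s"
        unfolding p(3) using hilbertian_triangle[OF Q, of "y - x" "x - x0" for y]
        by (auto intro: order_le_less_trans simp: less_diff_eq)
      thus ?thesis using p Basis(2) by (intro exI[of _ "{p}"] exI[of _ "e - p (x - x0)"]) auto
    qed (intro exI[of _ "{}"] exI[of _ 1], auto)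
  qed auto
qed

lemma cont_hilbertian_seminorm_topology:
  assumes "p \<in> P" and "hilbertian_seminorm p"
  shows "cont_hilbertian (seminorm_topology P) p"
proof -
  obtain Q where Q: "hilbertian_form p Q" using assms(2) by (auto simp: hilbertian_seminorm_def)
  have "continuous_map (seminorm_topology P) euclideanreal p"
  proof (rule continuous_map_realI)
    fix x and e :: real assume "e > 0"
    hence "openin (seminorm_topology P) {y. p (y - x) < e}"
      unfolding seminorm_topology_def using assms(1) by (intro topology_generated_by_Basis) blast
    thus "\<exists>U. openin (seminorm_topology P) U \<and> x \<in> U \<and> (\<forall>y\<in>U. \<bar>p y - p x\<bar> < e)"
      using \<open>e > 0\<close> hilbertian_0[OF Q] hilbertian_triangle_diff[OF Q]
      by (intro exI[of _ "{y. p (y - x) < e}"]) (auto intro: order_le_less_trans)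
  qed
  thus ?thesis using assms(2) by (simp add: cont_hilbertian_def)
qed

lemma hilbertian_le_of_unit:
  assumes p: "hilbertian_form p P" and h: "hilbertian_form h H"
    and "\<And>x. h x < 1 \<Longrightarrow> p x < 1"
  shows "p x \<le> h x"
proof (rule field_le_epsilon)
  fix e :: real assume "e > 0"
  \<comment> \<open>The slack \<open>e\<close> allows division by \<open>t\<close> also when
    \<open>h x = 0\<close>.\<close>
  define t where "t = h x + e"
  have t: "t > 0" "h x < t" using hilbertian_nonneg[OF h, of x] \<open>e > 0\<close> by (auto simp: t_def)
  have "h ((1 / t) *\<^sub>R x) < 1" using t by (simp add: hilbertian_scaleR[OF h])
  hence "p ((1 / t) *\<^sub>R x) < 1" by (rule assms(3))
  thus "p x \<le> h x + e" using t by (simp add: hilbertian_scaleR[OF p] t_def)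
qed

text \<open>The seminorms are merged as the root of a sum of squares and not as a maximum, so that
  the result is again Hilbertian.\<close>

lemma seminorm_topology_nbhd_zero:
  assumes P: "\<And>p. p \<in> P \<Longrightarrow> hilbertian_seminorm p"
    and "openin (seminorm_topology P) U" and "0 \<in> U"
  obtains F \<delta> where "finite F" "F \<subseteq> P" "\<delta> > 0"
    "{x. (1 / \<delta>) * sqrt (\<Sum>p\<in>F. (p x)\<^sup>2) < 1} \<subseteq> U"
proof -
  obtain F \<delta> where F: "finite F" "F \<subseteq> P" "\<delta> > 0" "{y. \<forall>p\<in>F. p (y - 0) < \<delta>} \<subseteq> U"
    using seminorm_topology_nbhd[OF assms] by blast
  have "p x < \<delta>" if x: "(1 / \<delta>) * sqrt (\<Sum>p\<in>F. (p x)\<^sup>2) < 1" and p: "p \<in> F" for x p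
  proof -
    have "(p x)\<^sup>2 \<le> (\<Sum>p\<in>F. (p x)\<^sup>2)" by (rule member_le_sum[OF p]) (use F(1) in auto)
    hence "p x \<le> sqrt (\<Sum>p\<in>F. (p x)\<^sup>2)" by (rule real_le_rsqrt)
    thus "p x < \<delta>" using x F(3) by simp
  qed
  hence "{x. (1 / \<delta>) * sqrt (\<Sum>p\<in>F. (p x)\<^sup>2) < 1} \<subseteq> U"
    using F(4) by auto
  thus ?thesis using F(1-3) that by blast
qed

lemma cont_hilbertian_ball_open:
  assumes "cont_hilbertian T p" "topspace T = UNIV" shows "openin T {x. p x < a}"
  using openin_continuous_map_preimage[of T euclideanreal p "{..<a}"] assms
  by (simp add: cont_hilbertian_def)

lemma nuclear_topspace: "nuclear_space T \<Longrightarrow> topspace T = UNIV"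
  by (auto simp: nuclear_space_def)

lemma nuclear_nbhd:
  assumes "nuclear_space T" and "openin T U" and "0 \<in> U"
  obtains p where "cont_hilbertian T p" "{x. p x < 1} \<subseteq> U"
proof -
  obtain P where P: "\<And>p. p \<in> P \<Longrightarrow> hilbertian_seminorm p" "T = seminorm_topology P"
    using assms(1) by (auto simp: nuclear_space_def)
  obtain F \<delta> where F: "finite F" "F \<subseteq> P" "\<delta> > 0" "{x. (1 / \<delta>) * sqrt (\<Sum>p\<in>F. (p x)\<^sup>2) < 1} \<subseteq> U"
    by (rule seminorm_topology_nbhd_zero[OF P(1)]) (use assms P in auto)
  have "cont_hilbertian T (\<lambda>x. (1 / \<delta>) * sqrt (\<Sum>p\<in>F. (p x)\<^sup>2))"
    unfolding P(2) using F P(1)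
    by (intro cont_hilbertian_scale cont_hilbertian_sum cont_hilbertian_seminorm_topology) auto
  thus ?thesis using that F(4) by blast
qed

section \<open>Hilbert-Schmidt majorants, total boundedness and separability\<close>

lemma contractive_scale_mono:
  assumes "contractive s I b" and "hilbertian_form p P" and "c \<ge> 0"
    and "\<And>x. c * p x \<le> s x"
  shows "contractive p I (\<lambda>i. c *\<^sub>R b i)"
  unfolding contractive_def
proof (intro conjI allI)
  show "finite I" using assms(1) by (simp add: contractive_def)
  fix d
  have "p (\<Sum>i\<in>I. d i *\<^sub>R c *\<^sub>R b i) = c * p (\<Sum>i\<in>I. d i *\<^sub>R b i)"
    using assms(3) hilbertian_scaleR[OF assms(2), of c "\<Sum>i\<in>I. d i *\<^sub>R b i"]
    by (simp add: scaleR_sum_right mult.commute)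
  also have "\<dots> \<le> s (\<Sum>i\<in>I. d i *\<^sub>R b i)" by (rule assms(4))
  finally have "(p (\<Sum>i\<in>I. d i *\<^sub>R c *\<^sub>R b i))\<^sup>2 \<le> (s (\<Sum>i\<in>I. d i *\<^sub>R b i))\<^sup>2"
    using hilbertian_nonneg[OF assms(2)] by (intro power_mono)
  thus "(p (\<Sum>i\<in>I. d i *\<^sub>R c *\<^sub>R b i))\<^sup>2 \<le> (\<Sum>i\<in>I. (d i)\<^sup>2)"
    using assms(1) by (auto simp: contractive_def intro: order_trans)
qed

text \<open>Nuclearity concerns the generating seminorms only. An arbitrary continuous
  \<open>p\<close> lies below a multiple of the root of a sum of squares over finitely many of them,
  and \<open>s\<close> is built in the same way from their Hilbert-Schmidt majorants. Multiplying
  \<open>s\<close> by \<open>c\<close> divides the traces by \<open>c^2\<close>, whence the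
  normalized bound 1.\<close>

lemma nuclear_hs_bounded:
  fixes T :: "'a::real_vector topology"
  assumes "nuclear_space T" and p: "cont_hilbertian T p"
  obtains s where "cont_hilbertian T s" "\<And>x. p x \<le> s x" "hs_bounded p s 1"
proof -
  obtain P where P: "\<And>p. p \<in> P \<Longrightarrow> hilbertian_seminorm p" "T = seminorm_topology P"
    and "\<forall>p\<in>P. \<exists>q\<in>P. (\<forall>x. p x \<le> q x) \<and> canonical_map_hilbert_schmidt p q"
    using assms(1) by (auto simp: nuclear_space_def)
  then obtain g where g: "\<And>p. p \<in> P \<Longrightarrow> g p \<in> P" "\<And>p x. p \<in> P \<Longrightarrow> p x \<le> g p x"
    "\<And>p. p \<in> P \<Longrightarrow> canonical_map_hilbert_schmidt p (g p)" by metis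
  obtain Q where Q: "\<And>p. p \<in> P \<Longrightarrow> hilbertian_form p (Q p)"
    using P(1) unfolding hilbertian_seminorm_def by metis
  have "\<forall>p\<in>P. \<exists>C. hs_bounded p (g p) C"
    using hilbert_schmidt_imp_hs_bounded[OF Q] g by blast
  then obtain C where C: "\<And>p. p \<in> P \<Longrightarrow> hs_bounded p (g p) (C p)" by metis
  have C0: "C p \<ge> 0" if "p \<in> P" for p
  proof -
    have "contractive (g p) {} (\<lambda>_. 0)"
      by (simp add: contractive_def hilbertian_0[OF Q[OF g(1)[OF that]]])
    thus ?thesis using C[OF that] unfolding hs_bounded_def by fastforce
  qed
  obtain R where R: "hilbertian_form p R" using p by (elim cont_hilbertianE)
  have tu: "topspace T = UNIV" using P(2) by simp
  obtain F \<delta> where F: "finite F" "F \<subseteq> P" "\<delta> > 0"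
    "{x. (1 / \<delta>) * sqrt (\<Sum>p\<in>F. (p x)\<^sup>2) < 1} \<subseteq> {x. p x < 1}"
    by (rule seminorm_topology_nbhd_zero[of P "{x. p x < 1}"])
      (use P cont_hilbertian_ball_open[OF p tu] hilbertian_0[OF R] in auto)
  have hF: "hilbertian_form (\<lambda>x. (1 / \<delta>) * sqrt (\<Sum>p\<in>F. (p x)\<^sup>2)) (\<lambda>x y. (1 / \<delta>)\<^sup>2 * (\<Sum>p\<in>F. Q p x y))"
    using F by (intro hilbertian_form_scale hilbertian_form_sum Q) auto
  have le: "p x \<le> (1 / \<delta>) * sqrt (\<Sum>p\<in>F. (p x)\<^sup>2)" for x
    by (rule hilbertian_le_of_unit[OF R hF]) (use F(4) in auto)
  define CC where "CC = (\<Sum>p\<in>F. C p)"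
  have CC: "CC \<ge> 0" unfolding CC_def using F C0 by (intro sum_nonneg) auto
  \<comment> \<open>Two demands on \<open>c\<close>: at least \<open>1 / \<delta>\<close> to have
    \<open>p \<le> s\<close>, and \<open>c^2 \<ge> CC / \<delta>^2\<close> to bring the trace down
    to 1.\<close>
  define c where "c = (sqrt CC + 1) / \<delta>"
  have c: "c > 0" "c \<ge> 1 / \<delta>" unfolding c_def using F(3) CC
    by (auto intro!: divide_pos_pos divide_right_mono add_nonneg_pos)
  have c2: "CC / \<delta>\<^sup>2 \<le> c\<^sup>2"
  proof -
    have "CC \<le> (sqrt CC + 1)\<^sup>2" using CC by (simp add: power2_sum)
    thus ?thesis using F(3) by (simp add: c_def power_divide divide_right_mono)
  qed
  define s where "s x = c * sqrt (\<Sum>p\<in>F. (g p x)\<^sup>2)" for x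
  have s: "cont_hilbertian T s"
    unfolding s_def P(2) using F P(1) g(1) c
    by (intro cont_hilbertian_scale cont_hilbertian_sum cont_hilbertian_seminorm_topology) auto
  have nn: "0 \<le> q x" if "q \<in> P" for q x using hilbertian_nonneg[OF Q[OF that]] .
  have ps: "p x \<le> s x" for x
  proof -
    have "sqrt (\<Sum>p\<in>F. (p x)\<^sup>2) \<le> sqrt (\<Sum>p\<in>F. (g p x)\<^sup>2)"
      using F g nn by (intro real_sqrt_le_mono sum_mono power_mono) auto
    hence "(1 / \<delta>) * sqrt (\<Sum>p\<in>F. (p x)\<^sup>2) \<le> c * sqrt (\<Sum>p\<in>F. (g p x)\<^sup>2)"
      using c F(3) by (intro mult_mono) (auto simp: sum_nonneg)
    thus ?thesis using le[of x] by (simp add: s_def)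
  qed
  have gs: "c * g q x \<le> s x" if "q \<in> F" for q x
  proof -
    have "(g q x)\<^sup>2 \<le> (\<Sum>p\<in>F. (g p x)\<^sup>2)" by (rule member_le_sum[OF that]) (use F in auto)
    hence "g q x \<le> sqrt (\<Sum>p\<in>F. (g p x)\<^sup>2)" by (rule real_le_rsqrt)
    thus ?thesis using c by (simp add: s_def)
  qed
  have "(\<Sum>i\<in>I. (p (b i))\<^sup>2) \<le> 1" if cb: "contractive s I b" for I :: "'a set" and b
  proof -
    have 1: "c\<^sup>2 * (\<Sum>i\<in>I. (q (b i))\<^sup>2) \<le> C q" if q: "q \<in> F" for q
    proof -
      have qP: "q \<in> P" "g q \<in> P" using q F g by auto
      have "contractive (g q) I (\<lambda>i. c *\<^sub>R b i)"
        using cb c gs[OF q] by (intro contractive_scale_mono[OF _ Q[OF qP(2)]]) auto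
      hence "(\<Sum>i\<in>I. (q (c *\<^sub>R b i))\<^sup>2) \<le> C q" using C[OF qP(1)] unfolding hs_bounded_def by blast
      thus ?thesis by (simp add: hilbertian_scaleR[OF Q[OF qP(1)]] power_mult_distrib sum_distrib_left)
    qed
    have "(p (b i))\<^sup>2 \<le> (1 / \<delta>)\<^sup>2 * (\<Sum>q\<in>F. (q (b i))\<^sup>2)" for i
    proof -
      have "(p (b i))\<^sup>2 \<le> ((1 / \<delta>) * sqrt (\<Sum>q\<in>F. (q (b i))\<^sup>2))\<^sup>2"
        using le hilbertian_nonneg[OF R] by (intro power_mono) auto
      thus ?thesis by (simp only: power_mult_distrib) (simp add: sum_nonneg)
    qed
    hence "c\<^sup>2 * (\<Sum>i\<in>I. (p (b i))\<^sup>2) \<le> c\<^sup>2 * (\<Sum>i\<in>I. (1 / \<delta>)\<^sup>2 * (\<Sum>q\<in>F. (q (b i))\<^sup>2))"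
      by (intro mult_left_mono sum_mono) auto
    also have "\<dots> = (1 / \<delta>)\<^sup>2 * (\<Sum>q\<in>F. c\<^sup>2 * (\<Sum>i\<in>I. (q (b i))\<^sup>2))"
      by (simp add: sum_distrib_left sum.swap[of _ I] mult.left_commute)
    also have "\<dots> \<le> (1 / \<delta>)\<^sup>2 * CC"
      unfolding CC_def by (intro mult_left_mono sum_mono 1) auto
    also have "\<dots> \<le> c\<^sup>2" using c2 by (simp add: power_divide)
    finally show ?thesis using c(1) by simp
  qed
  hence "hs_bounded p s 1" unfolding hs_bounded_def by blast
  thus ?thesis using that s ps by blast
qed

text \<open>A maximal orthonormal family for \<open>s\<close> of vectors with \<open>p\<close> larger than \<open>\<epsilon>\<close> is finite;
  orthogonally to it \<open>p\<close> is small.\<close>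

lemma hs_bounded_totally_bounded:
  fixes p s :: "'a::real_vector \<Rightarrow> real"
  assumes hp: "hilbertian_form p P" and hs: "hilbertian_form s S" and ps: "\<And>x. p x \<le> s x"
    and hb: "hs_bounded p s C" and e: "\<epsilon> > 0"
  obtains F where "finite F" "\<And>x. s x \<le> 1 \<Longrightarrow> \<exists>y\<in>F. p (x - y) < \<epsilon>"
proof -
  note nn = hilbertian_nonneg[OF hp] and nns = hilbertian_nonneg[OF hs]
  define on where "on G \<longleftrightarrow> finite G \<and> (\<forall>a\<in>G. s a = 1 \<and> p a > \<epsilon> / 2) \<and> pairwise (\<lambda>a b. S a b = 0) G" for G
  have card: "real (card G) \<le> C / (\<epsilon> / 2)\<^sup>2" if G: "on G" for G
  proof -
    have "contractive s G (\<lambda>a. a)" unfolding contractive_def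
    proof (intro conjI allI)
      show "finite G" using G by (simp add: on_def)
      fix c
      have "S (\<Sum>i\<in>G. c i *\<^sub>R i) (\<Sum>i\<in>G. c i *\<^sub>R i) = (\<Sum>i\<in>G. c i * c i * (s i)\<^sup>2)"
        using G by (intro hilbertian_orthogonal_sum[OF hs]) (auto simp: on_def pairwise_def)
      thus "(s (\<Sum>i\<in>G. c i *\<^sub>R i))\<^sup>2 \<le> (\<Sum>i\<in>G. (c i)\<^sup>2)"
        using G by (simp add: hilbertian_form_self[OF hs] on_def power2_eq_square cong: sum.cong)
    qed
    hence "(\<Sum>a\<in>G. (p a)\<^sup>2) \<le> C" using hb unfolding hs_bounded_def by blast
    moreover have "(\<Sum>a\<in>G. (\<epsilon> / 2)\<^sup>2) \<le> (\<Sum>a\<in>G. (p a)\<^sup>2)"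
      using G e by (intro sum_mono power_mono) (auto simp: on_def less_imp_le)
    ultimately show ?thesis using e by (simp add: pos_le_divide_eq)
  qed
  have "on {}" by (simp add: on_def)
  moreover have "\<forall>G. on G \<longrightarrow> card G \<le> nat \<lceil>C / (\<epsilon> / 2)\<^sup>2\<rceil>" 
  proof (intro allI impI)
    fix G assume "on G"
    from card[OF this] have "real (card G) \<le> real (nat \<lceil>C / (\<epsilon> / 2)\<^sup>2\<rceil>)"
      by (meson order_trans real_nat_ceiling_ge)
    thus "card G \<le> nat \<lceil>C / (\<epsilon> / 2)\<^sup>2\<rceil>" by simp
  qed
  ultimately have "\<exists>G. on G \<and> (\<forall>G'. on G' \<longrightarrow> card G' \<le> card G)"
    using ex_has_greatest_nat[of on "{}" card "Suc (nat \<lceil>C / (\<epsilon> / 2)\<^sup>2\<rceil>)"]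
    by (simp add: less_Suc_eq_le)
  then obtain G where G: "on G" "\<And>G'. on G' \<Longrightarrow> card G' \<le> card G" by metis
  have fG: "finite G" and sG: "\<And>a. a \<in> G \<Longrightarrow> s a = 1" and oG: "\<And>a b. a \<in> G \<Longrightarrow> b \<in> G \<Longrightarrow> a \<noteq> b \<Longrightarrow> S a b = 0"
    using G(1) by (auto simp: on_def pairwise_def)
  have rem: "p (x - (\<Sum>g\<in>G. S x g *\<^sub>R g)) \<le> \<epsilon> / 2" if x: "s x \<le> 1" for x
  proof (rule ccontr)
    define r where "r = x - (\<Sum>g\<in>G. S x g *\<^sub>R g)"
    assume "\<not> p (x - (\<Sum>g\<in>G. S x g *\<^sub>R g)) \<le> \<epsilon> / 2"
    hence pr: "p r > \<epsilon> / 2" by (simp add: r_def)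
    hence sr: "s r > 0" using ps[of r] e by linarith
    have orth: "S r g = 0" if "g \<in> G" for g
    proof -
      have "(\<Sum>g'\<in>G. S x g' * S g' g) = (\<Sum>g'\<in>G. if g' = g then S x g else 0)"
        using oG that sG by (intro sum.cong) (auto simp: hilbertian_form_self[OF hs])
      thus ?thesis unfolding r_def
        by (simp add: hilbertian_diff[OF hs] hilbertian_sum[OF hs] hilbertian_scale[OF hs] fG that)
    qed
    \<comment> \<open>The remainder \<open>r\<close> is orthogonal to the projection, so
      \<open>s r \<le> s x \<le> 1\<close>. Normalizing \<open>r\<close> for \<open>s\<close> thus
      does not decrease \<open>p\<close>, and the normalized vector would enlarge the maximal family
      \<open>G\<close>.\<close>
    have "(s r)\<^sup>2 = S r x"
    proof -
      have "S r (\<Sum>g\<in>G. S x g *\<^sub>R g) = 0"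
        by (simp add: hilbertian_sum2[OF hs] hilbertian_scale2[OF hs] orth)
      hence "S r x = S r r" unfolding r_def by (simp add: hilbertian_diff2[OF hs])
      thus ?thesis by (simp add: hilbertian_form_self[OF hs])
    qed
    also have "\<dots> \<le> s r * s x" using hilbertian_Cauchy_Schwarz[OF hs, of r x] by simp
    finally have "s r \<le> s x" using sr by (simp add: power2_eq_square)
    hence sr1: "s r \<le> 1" using x by simp
    define r' where "r' = (1 / s r) *\<^sub>R r"
    have "s r' = 1" unfolding r'_def using sr by (simp add: hilbertian_scaleR[OF hs])
    moreover have "p r' \<ge> p r"
      unfolding r'_def using sr sr1 nn[of r]
      by (simp add: hilbertian_scaleR[OF hp] le_divide_eq mult_left_le)
    moreover have o': "S r' g = 0" if "g \<in> G" for g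
      unfolding r'_def using orth[OF that] by (simp add: hilbertian_scale[OF hs])
    moreover have "r' \<notin> G"
    proof
      assume "r' \<in> G"
      from o'[OF this] \<open>s r' = 1\<close> show False by (simp add: hilbertian_form_self[OF hs])
    qed
    ultimately have "on (insert r' G)"
      using G(1) pr hilbertian_sym[OF hs, of _ r'] by (auto simp: on_def pairwise_insert)
    from G(2)[OF this] \<open>r' \<notin> G\<close> fG show False by simp
  qed
  define B where "B = (\<Sum>g\<in>G. p g)"
  have B: "B \<ge> 0" unfolding B_def by (intro sum_nonneg nn)
  \<comment> \<open>Rounding the coefficients \<open>S x g\<close>, which lie in
    \<open>[-1, 1]\<close>, down to multiples of \<open>1 / N\<close> costs at most
    \<open>B / N < \<epsilon> / 2\<close> in \<open>p\<close> and leaves finitely many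
    vectors.\<close>
  obtain N :: nat where N: "real N > 2 * B / \<epsilon>" using reals_Archimedean2 by blast
  have N0: "real N > 0" using N B e by (smt (verit) divide_nonneg_pos)
  define F where "F = (\<lambda>k. \<Sum>g\<in>G. (of_int (k g) / N) *\<^sub>R g) ` (G \<rightarrow>\<^sub>E {- int N..int N})"
  show ?thesis
  proof (rule that)
    show "finite F" unfolding F_def by (intro finite_imageI finite_PiE fG) auto
    fix x assume x: "s x \<le> 1"
    define k where "k = (\<lambda>g\<in>G. \<lfloor>N * S x g\<rfloor>)"
    define y where "y = (\<Sum>g\<in>G. (of_int (k g) / N) *\<^sub>R g)"
    have k: "k \<in> G \<rightarrow>\<^sub>E {- int N..int N}"
    proof (unfold k_def, intro PiE_I)
      fix g assume g: "g \<in> G"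
      have "\<bar>S x g\<bar> \<le> 1"
        using hilbertian_Cauchy_Schwarz[OF hs, of x g] sG[OF g] x by simp
      hence "\<bar>N * S x g\<bar> \<le> N" by (simp add: abs_mult mult_left_le)
      thus "(\<lambda>g\<in>G. \<lfloor>N * S x g\<rfloor>) g \<in> {- int N..int N}"
        using g by (simp add: floor_le_iff le_floor_iff abs_le_iff)
    qed auto
    have y: "y \<in> F" unfolding F_def y_def using k by blast
    have "p (x - y) \<le> p (x - (\<Sum>g\<in>G. S x g *\<^sub>R g)) + p ((\<Sum>g\<in>G. S x g *\<^sub>R g) - y)"
      using hilbertian_triangle[OF hp, of "x - (\<Sum>g\<in>G. S x g *\<^sub>R g)" "(\<Sum>g\<in>G. S x g *\<^sub>R g) - y"] by simp
    also have "(\<Sum>g\<in>G. S x g *\<^sub>R g) - y = (\<Sum>g\<in>G. (S x g - of_int (k g) / N) *\<^sub>R g)"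
      by (simp add: y_def sum_subtractf scaleR_diff_left)
    also have "p \<dots> \<le> (\<Sum>g\<in>G. p ((S x g - of_int (k g) / N) *\<^sub>R g))" by (rule hilbertian_sum_le[OF hp])
    also have "\<dots> \<le> (\<Sum>g\<in>G. (1 / N) * p g)"
    proof (rule sum_mono)
      fix g assume g: "g \<in> G"
      have "\<bar>N * S x g - of_int (k g)\<bar> \<le> 1" using g unfolding k_def by simp linarith
      hence "\<bar>N * S x g - of_int (k g)\<bar> / N \<le> 1 / N" using N0 by (intro divide_right_mono) auto
      moreover have "S x g - of_int (k g) / N = (N * S x g - of_int (k g)) / N"
        using N0 by (simp add: field_simps)
      ultimately have "\<bar>S x g - of_int (k g) / N\<bar> \<le> 1 / N" by simp
      thus "p ((S x g - of_int (k g) / N) *\<^sub>R g) \<le> (1 / N) * p g"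
        unfolding hilbertian_scaleR[OF hp] by (rule mult_right_mono) (rule nn)
    qed
    also have "\<dots> = B / N" by (simp add: B_def sum_divide_distrib)
    also have "B / N < \<epsilon> / 2" using N N0 e by (simp add: field_simps)
    finally have "p (x - y) < \<epsilon>" using rem[OF x] by simp
    thus "\<exists>y\<in>F. p (x - y) < \<epsilon>" using y by blast
  qed
qed

lemma nuclear_totally_bounded:
  assumes "nuclear_space T" and p: "cont_hilbertian T p"
  obtains s where "cont_hilbertian T s"
    "\<And>\<epsilon>. \<epsilon> > 0 \<Longrightarrow> \<exists>F. finite F \<and> (\<forall>x. s x \<le> 1 \<longrightarrow> (\<exists>y\<in>F. p (x - y) < \<epsilon>))"
proof -
  obtain s where s: "cont_hilbertian T s" "\<And>x. p x \<le> s x" "hs_bounded p s 1"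
    using nuclear_hs_bounded[OF assms] by blast
  obtain P S where PS: "hilbertian_form p P" "hilbertian_form s S"
    by (meson p s(1) cont_hilbertianE)
  show ?thesis using that[OF s(1)] hs_bounded_totally_bounded[OF PS s(2,3)] by metis
qed

text \<open>Every vector lies in some multiple \<open>n\<close> of the \<open>s\<close>-unit ball,
  which has finite \<open>p\<close>-nets of every mesh \<open>1 / (m + 1)\<close>. The nets scaled
  by \<open>n\<close> are dense, since \<open>m\<close> may be taken large compared with
  \<open>n / \<epsilon>\<close>.\<close>

lemma nuclear_separable:
  assumes "nuclear_space T" and p: "cont_hilbertian T p"
  obtains D where "countable D" "\<And>x \<epsilon>. \<epsilon> > 0 \<Longrightarrow> \<exists>d\<in>D. p (x - d) < \<epsilon>"
proof -
  obtain s where s: "cont_hilbertian T s"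
    "\<And>\<epsilon>. \<epsilon> > 0 \<Longrightarrow> \<exists>F. finite F \<and> (\<forall>x. s x \<le> 1 \<longrightarrow> (\<exists>y\<in>F. p (x - y) < \<epsilon>))"
    using nuclear_totally_bounded[OF assms] by blast
  obtain P S where PS: "hilbertian_form p P" "hilbertian_form s S"
    by (meson p s(1) cont_hilbertianE)
  have "\<forall>m. \<exists>F. finite F \<and> (\<forall>x. s x \<le> 1 \<longrightarrow> (\<exists>y\<in>F. p (x - y) < 1 / (real m + 1)))"
    using s(2) by simp
  then obtain F where F: "\<And>m. finite (F m)"
    "\<And>m x. s x \<le> 1 \<Longrightarrow> \<exists>y\<in>F m. p (x - y) < 1 / (real m + 1)" by metis
  show ?thesis
  proof (rule that)
    show "countable (\<Union>n::nat. \<Union>m. (\<lambda>y. real n *\<^sub>R y) ` F m)"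
      by (intro countable_UN countable_image countableI_type countable_finite[OF F(1)])
    fix x and \<epsilon> :: real assume e: "\<epsilon> > 0"
    obtain n :: nat where n: "real n > max 1 (s x)" using reals_Archimedean2 by blast
    obtain m :: nat where m: "real m > n / \<epsilon>" using reals_Archimedean2 by blast
    have n0: "real n > 0" using n by simp
    have "s ((1 / n) *\<^sub>R x) \<le> 1" using n by (simp add: hilbertian_scaleR[OF PS(2)])
    then obtain y where y: "y \<in> F m" "p ((1 / n) *\<^sub>R x - y) < 1 / (real m + 1)" using F(2) by blast
    have "x - real n *\<^sub>R y = real n *\<^sub>R ((1 / n) *\<^sub>R x - y)"
      using n0 by (simp add: scaleR_diff_right)
    hence "p (x - real n *\<^sub>R y) = n * p ((1 / n) *\<^sub>R x - y)"
      using n0 by (simp add: hilbertian_scaleR[OF PS(1)])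
    also have "\<dots> < n * (1 / (real m + 1))" using y(2) n0 by (intro mult_strict_left_mono)
    also have "\<dots> \<le> \<epsilon>" using m e by (simp add: field_simps)
    finally show "\<exists>d\<in>(\<Union>n::nat. \<Union>m. (\<lambda>y. real n *\<^sub>R y) ` F m). p (x - d) < \<epsilon>"
      using y(1) by blast
  qed
qed

section \<open>The strong dual\<close>

lemma tvs_bounded_Un:
  assumes "tvs_bounded T A" "tvs_bounded T B" shows "tvs_bounded T (A \<union> B)"
  unfolding tvs_bounded_def
proof (intro allI impI)
  fix U assume U: "openin T U \<and> 0 \<in> U"
  obtain s1 where "s1 > 0" "\<And>t. t > s1 \<Longrightarrow> A \<subseteq> (\<lambda>x. t *\<^sub>R x) ` U"
    using assms(1) U unfolding tvs_bounded_def by blast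
  moreover obtain s2 where "s2 > 0" "\<And>t. t > s2 \<Longrightarrow> B \<subseteq> (\<lambda>x. t *\<^sub>R x) ` U"
    using assms(2) U unfolding tvs_bounded_def by blast
  ultimately show "\<exists>s>0. \<forall>t>s. A \<union> B \<subseteq> (\<lambda>x. t *\<^sub>R x) ` U"
    by (intro exI[of _ "max s1 s2"]) auto
qed

lemma tvs_bounded_cont_hilbertian:
  assumes "topspace T = UNIV" "tvs_bounded T B" "cont_hilbertian T s"
  obtains C where "C > 0" "\<And>x. x \<in> B \<Longrightarrow> s x \<le> C"
proof -
  obtain S where S: "hilbertian_form s S" using assms(3) by (elim cont_hilbertianE)
  have "openin T {x. s x < 1} \<and> 0 \<in> {x. s x < 1}"
    using cont_hilbertian_ball_open[OF assms(3,1)] hilbertian_0[OF S] by simp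
  then obtain c where c: "c > 0" "\<And>t. t > c \<Longrightarrow> B \<subseteq> (\<lambda>x. t *\<^sub>R x) ` {x. s x < 1}"
    using assms(2) unfolding tvs_bounded_def by blast
  show ?thesis
  proof (rule that)
    show "c + 1 > 0" using c by simp
    fix x assume "x \<in> B"
    then obtain y where "x = (c + 1) *\<^sub>R y" "s y < 1" using c(2)[of "c + 1"] by auto
    thus "s x \<le> c + 1" using c(1) by (simp add: hilbertian_scaleR[OF S] mult_left_le)
  qed
qed

lemma nuclear_bounded_singleton:
  assumes "nuclear_space T" shows "tvs_bounded T {x}"
  unfolding tvs_bounded_def
proof (intro allI impI)
  fix U assume U: "openin T U \<and> 0 \<in> U"
  then obtain p where p: "cont_hilbertian T p" "{x. p x < 1} \<subseteq> U"
    using nuclear_nbhd[OF assms] by blast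
  then obtain P where P: "hilbertian_form p P" by (elim cont_hilbertianE)
  have "x \<in> (\<lambda>x. t *\<^sub>R x) ` U" if t: "t > p x + 1" for t
  proof -
    have t0: "t > 0" "p x < t" using t hilbertian_nonneg[OF P, of x] by auto
    have "p ((1 / t) *\<^sub>R x) < 1" using t0 by (simp add: hilbertian_scaleR[OF P])
    moreover have "x = t *\<^sub>R ((1 / t) *\<^sub>R x)" using t0 by simp
    ultimately show ?thesis using p(2) by blast
  qed
  thus "\<exists>s>0. \<forall>t>s. {x} \<subseteq> (\<lambda>x. t *\<^sub>R x) ` U"
    using hilbertian_nonneg[OF P, of x] by (intro exI[of _ "p x + 1"]) auto
qed

text \<open>Makes the balls of a continuous seminorm open around every centre, even if the seminorm
  is not a member of \<open>P\<close>.\<close>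

lemma continuous_map_seminorm_translation:
  "continuous_map (seminorm_topology P) (seminorm_topology P) (\<lambda>y. y - x)"
  unfolding seminorm_topology_def[of P]
proof (rule continuous_on_generated_topo)
  fix U assume U: "U \<in> insert UNIV {{y. p (y - x) < e} | p x e. p \<in> P \<and> e > 0}"
  show "openin (topology_generated_by (insert UNIV {{y. p (y - x) < e} | p x e. p \<in> P \<and> e > 0}))
     ((\<lambda>y. y - x) -` U \<inter> topspace (topology_generated_by (insert UNIV {{y. p (y - x) < e} | p x e. p \<in> P \<and> e > 0})))"
  proof (cases "U = UNIV")
    case False
    then obtain p x0 e where "p \<in> P" "e > 0" "U = {y. p (y - x0) < e}" using U by auto
    moreover have "(\<lambda>y. y - x) -` {y. p (y - x0) < e} = {y. p (y - (x + x0)) < e}"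
      by (auto simp: algebra_simps)
    ultimately show ?thesis
      by (intro openin_Int openin_topspace topology_generated_by_Basis) auto
  qed (auto intro: topology_generated_by_Basis)
qed auto

text \<open>The rank-one case, which lets \<open>hilbertian_le_of_unit\<close> bound
  functionals.\<close>

lemma hilbertian_form_abs_linear:
  "linear f \<Longrightarrow> hilbertian_form (\<lambda>x. \<bar>f x\<bar>) (\<lambda>x y. f x * f y)" for f :: "'a::real_vector \<Rightarrow> real"
  unfolding hilbertian_form_def bilinear_def
  by (auto simp: power2_eq_square linear_iff algebra_simps)

lemma dual_if_le_cont_hilbertian:
  assumes T: "nuclear_space T" and p: "cont_hilbertian T p" and f: "linear f" and "\<And>x. \<bar>f x\<bar> \<le> p x"
  shows "f \<in> dual T"
proof -
  obtain P where P: "T = seminorm_topology P" using T by (auto simp: nuclear_space_def)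
  have tu: "topspace T = UNIV" by (rule nuclear_topspace[OF T])
  have ball: "openin T {y. p (y - x) < e}" for x e
    using openin_continuous_map_preimage[OF continuous_map_seminorm_translation[of P x], of "{y. p y < e}"]
      cont_hilbertian_ball_open[OF p tu] by (simp add: P)
  obtain R where R: "hilbertian_form p R" using p by (elim cont_hilbertianE)
  have p0: "p (x - x) = 0" for x by (simp add: hilbertian_0[OF R])
  have d: "\<bar>f y - f x\<bar> \<le> p (y - x)" for x y using assms(4)[of "y - x"] by (simp add: linear_diff[OF f])
  have "continuous_map T euclideanreal f"
  proof (rule continuous_map_realI)
    fix x and e :: real assume "e > 0"
    thus "\<exists>U. openin T U \<and> x \<in> U \<and> (\<forall>y\<in>U. \<bar>f y - f x\<bar> < e)"
      using p0 d by (intro exI[of _ "{y. p (y - x) < e}"]) (auto intro: ball order_le_less_trans)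
  qed
  thus ?thesis using f by (simp add: dual_def)
qed

text \<open>Continuity bounds \<open>f\<close> by finitely many of the seminorms; monotonicity lets
  the one of largest index replace them all.\<close>

lemma dual_increasing_seminorms:
  assumes r: "\<And>n. hilbertian_seminorm (r n)" "\<And>n x. r n x \<le> r (Suc n) x"
    and f: "f \<in> dual (seminorm_topology (range r))"
  obtains n c where "c \<ge> 0" "\<And>x. \<bar>f x\<bar> \<le> c * r n x"
proof -
  have lin: "linear f" and cont: "continuous_map (seminorm_topology (range r)) euclideanreal f"
    using f by (auto simp: dual_def)
  obtain R where R: "\<And>n. hilbertian_form (r n) (R n)" using r(1) unfolding hilbertian_seminorm_def by metis
  have hr: "hilbertian_seminorm p" if "p \<in> range r" for p using that r(1) by auto
  have z: "0 \<in> {x. \<bar>f x\<bar> < 1}" using linear_0[OF lin] by simp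
  have "openin (seminorm_topology (range r)) {x. \<bar>f x\<bar> < 1}"
  proof -
    have "{x. \<bar>f x\<bar> < 1} = {x \<in> topspace (seminorm_topology (range r)). f x \<in> {-1<..<1}}" by auto
    thus ?thesis using openin_continuous_map_preimage[OF cont, of "{-1<..<1}"] by simp
  qed
  from seminorm_topology_nbhd_zero[OF hr this z]
  obtain F \<delta> where F: "finite F" "F \<subseteq> range r" "\<delta> > 0"
    "{x. (1 / \<delta>) * sqrt (\<Sum>p\<in>F. (p x)\<^sup>2) < 1} \<subseteq> {x. \<bar>f x\<bar> < 1}"
    by metis
  have hF: "hilbertian_form (\<lambda>x. (1 / \<delta>) * sqrt (\<Sum>p\<in>F. (p x)\<^sup>2))
      (\<lambda>x y. (1 / \<delta>)\<^sup>2 * (\<Sum>p\<in>F. (SOME Q. hilbertian_form p Q) x y))"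
    using F r(1) by (intro hilbertian_form_scale hilbertian_form_sum someI_ex[of "hilbertian_form _"])
      (auto simp: hilbertian_seminorm_def)
  have le: "\<bar>f x\<bar> \<le> (1 / \<delta>) * sqrt (\<Sum>p\<in>F. (p x)\<^sup>2)" for x
    by (rule hilbertian_le_of_unit[OF hilbertian_form_abs_linear[OF lin] hF]) (use F(4) in auto)
  obtain I where I: "finite I" "F = r ` I" using F(1,2) by (meson finite_subset_image)
  \<comment> \<open>Inserting 0 covers the case of no seminorms at all, in which \<open>f\<close>
    vanishes.\<close>
  define n where "n = Max (insert 0 I)"
  have mono: "r i x \<le> r n x" if "i \<in> I" for i x
    using lift_Suc_mono_le[of "\<lambda>n. r n x" i n] r(2) that I(1) by (simp add: n_def)
  show ?thesis
  proof (rule that)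
    \<comment> \<open>A sum of \<open>card F\<close> squares, each at most \<open>(r n x)^2\<close>,
      accounts for the factor \<open>sqrt (card F)\<close>.\<close>
    show "0 \<le> (1 / \<delta>) * sqrt (card F)" using F(3) by simp
    fix x
    have rn: "0 \<le> r i x" for i by (rule hilbertian_nonneg[OF R])
    have "(\<Sum>p\<in>F. (p x)\<^sup>2) \<le> (\<Sum>p\<in>F. (r n x)\<^sup>2)"
      using mono rn I(2) by (intro sum_mono power_mono) auto
    hence "sqrt (\<Sum>p\<in>F. (p x)\<^sup>2) \<le> sqrt (card F * (r n x)\<^sup>2)" by simp
    also have "\<dots> = sqrt (card F) * r n x" using rn by (simp add: real_sqrt_mult)
    finally have "(1 / \<delta>) * sqrt (\<Sum>p\<in>F. (p x)\<^sup>2) \<le> (1 / \<delta>) * (sqrt (card F) * r n x)"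
      using F(3) by (intro mult_left_mono) auto
    with le[of x] show "\<bar>f x\<bar> \<le> (1 / \<delta>) * sqrt (card F) * r n x" by simp
  qed
qed

lemma openin_strong_dual_subbasis:
  assumes "f \<in> dual T" "tvs_bounded T B" "e > 0"
  shows "openin (strong_dual T) {g\<in>dual T. \<exists>d<e. \<forall>x\<in>B. \<bar>g x - f x\<bar> \<le> d}"
  unfolding strong_dual_def uniform_conv_topology_def using assms
  by (intro topology_generated_by_Basis) blast

lemma strong_dual_nbhd_zero:
  assumes "openin (strong_dual T) V" "(\<lambda>_. 0) \<in> V"
  obtains B e where "tvs_bounded T B" "e > 0" "{f\<in>dual T. \<forall>x\<in>B. \<bar>f x\<bar> \<le> e} \<subseteq> V"
proof -
  have "generate_topology_on (insert (dual T) {{g\<in>dual T. \<exists>d<e. \<forall>x\<in>B. \<bar>g x - f x\<bar> \<le> d} | f B e.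
      f \<in> dual T \<and> B \<in> {B. tvs_bounded T B} \<and> (e::real) > 0}) V"
    using assms(1) unfolding strong_dual_def uniform_conv_topology_def openin_topology_generated_by_iff .
  hence "\<exists>B e. tvs_bounded T B \<and> e > 0 \<and> {f\<in>dual T. \<forall>x\<in>B. \<bar>f x\<bar> \<le> e} \<subseteq> V"
    using assms(2)
  proof (induction)
    case (Int a b)
    then obtain B1 e1 B2 e2 where "tvs_bounded T B1" "e1 > 0" "{f\<in>dual T. \<forall>x\<in>B1. \<bar>f x\<bar> \<le> e1} \<subseteq> a"
      "tvs_bounded T B2" "e2 > 0" "{f\<in>dual T. \<forall>x\<in>B2. \<bar>f x\<bar> \<le> e2} \<subseteq> b" by auto
    thus ?case
      by (intro exI[of _ "B1 \<union> B2"] exI[of _ "min e1 e2"]) (auto simp: tvs_bounded_Un)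
  next
    case (UN K)
    then obtain k where k: "k \<in> K" "(\<lambda>_. 0) \<in> k" by blast
    show ?case using UN.IH[OF k] k(1) by blast
  next
    case (Basis s)
    show ?case
    proof (cases "s = dual T")
      case True
      have "tvs_bounded T {}" by (auto simp: tvs_bounded_def intro: exI[of _ 1])
      thus ?thesis using True by (intro exI[of _ "{}"] exI[of _ 1]) auto
    next
      case False
      then obtain f B e where f: "f \<in> dual T" "tvs_bounded T B" "e > 0"
        "s = {g\<in>dual T. \<exists>d<e. \<forall>x\<in>B. \<bar>g x - f x\<bar> \<le> d}" using Basis(1) by auto
      then obtain d where d: "d < e" "\<And>x. x \<in> B \<Longrightarrow> \<bar>f x\<bar> \<le> d" using Basis(2) by auto
      \<comment> \<open>The subbasic sets demand a uniform bound strictly below \<open>e\<close>, so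
        \<open>f\<close> leaves a margin \<open>e - d\<close>. Half of it goes to \<open>g\<close>;
        the other half preserves strictness.\<close>
      have "{g\<in>dual T. \<forall>x\<in>B. \<bar>g x\<bar> \<le> (e - d) / 2} \<subseteq> s"
        unfolding f(4)
      proof safe
        fix g assume g: "\<forall>x\<in>B. \<bar>g x\<bar> \<le> (e - d) / 2"
        show "\<exists>d<e. \<forall>x\<in>B. \<bar>g x - f x\<bar> \<le> d"
        proof (intro exI[of _ "d + (e - d) / 2"] conjI ballI)
          show "d + (e - d) / 2 < e" using d(1) by (simp add: field_simps)
          fix x assume "x \<in> B"
          hence "\<bar>g x\<bar> \<le> (e - d) / 2" "\<bar>f x\<bar> \<le> d" using g d(2) by auto
          thus "\<bar>g x - f x\<bar> \<le> d + (e - d) / 2" by linarith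
        qed
      qed
      thus ?thesis using f(2) d(1) by (intro exI[of _ B] exI[of _ "(e - d) / 2"]) auto
    qed
  qed simp
  thus ?thesis using that by blast
qed

lemma continuous_map_strong_dual_eval:
  assumes T: "nuclear_space T" shows "continuous_map (strong_dual T) euclideanreal (\<lambda>f. f x)"
proof (rule continuous_map_realI)
  fix f and e :: real assume "f \<in> topspace (strong_dual T)" and e: "e > 0"
  hence f: "f \<in> dual T" by simp
  have "{g\<in>dual T. \<bar>g x - f x\<bar> < e} = {g\<in>dual T. \<exists>d<e. \<forall>y\<in>{x}. \<bar>g y - f y\<bar> \<le> d}"
    by (auto intro: order_le_less_trans)
  hence "openin (strong_dual T) {g\<in>dual T. \<bar>g x - f x\<bar> < e}"
    using openin_strong_dual_subbasis[OF f nuclear_bounded_singleton[OF T, of x] e] by simp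
  thus "\<exists>U. openin (strong_dual T) U \<and> f \<in> U \<and> (\<forall>g\<in>U. \<bar>g x - f x\<bar> < e)"
    using f e by (intro exI[of _ "{g\<in>dual T. \<bar>g x - f x\<bar> < e}"]) auto
qed

lemma continuous_map_strong_dual_product:
  assumes "nuclear_space T" shows "continuous_map (strong_dual T) euclidean (\<lambda>f k. f (d k))"
  unfolding euclidean_product_topology[symmetric] continuous_map_componentwise_UNIV
  using continuous_map_strong_dual_eval[OF assms] by blast

lemma Hausdorff_strong_dual:
  assumes "nuclear_space T" shows "Hausdorff_space (strong_dual T)"
  unfolding Hausdorff_space_def
proof (intro allI impI, elim conjE)
  fix f g assume f: "f \<in> topspace (strong_dual T)" and g: "g \<in> topspace (strong_dual T)" and "f \<noteq> g"
  then obtain x where "f x \<noteq> g x" by blast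
  then obtain U V where UV: "open U" "open V" "f x \<in> U" "g x \<in> V" "U \<inter> V = {}"
    using hausdorff by metis
  let ?pre = "\<lambda>U. {f \<in> topspace (strong_dual T). f x \<in> U}"
  have "openin (strong_dual T) (?pre U)" "openin (strong_dual T) (?pre V)"
    using UV(1,2) openin_continuous_map_preimage[OF continuous_map_strong_dual_eval[OF assms]]
    by auto
  moreover have "f \<in> ?pre U" "g \<in> ?pre V" "disjnt (?pre U) (?pre V)"
    using f g UV by (auto simp: disjnt_def)
  ultimately show "\<exists>U V. openin (strong_dual T) U \<and> openin (strong_dual T) V \<and> f \<in> U \<and> g \<in> V \<and> disjnt U V"
    by blast
qed

section \<open>Borel sets of the strong dual, polars and Radon measures\<close>

lemma borel_of_open: "openin X U \<Longrightarrow> U \<in> sets (borel_of X)"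
  by (auto simp: sets_borel_of)

lemma borel_of_closed: "closedin X C \<Longrightarrow> C \<in> sets (borel_of X)"
  using sets.compl_sets[OF borel_of_open[of X "topspace X - C"]]
  by (auto simp: closedin_def double_diff)

lemma measurable_borel_of_continuous:
  fixes f :: "'b \<Rightarrow> 'c::topological_space"
  assumes "continuous_map X euclidean f" shows "f \<in> borel_of X \<rightarrow>\<^sub>M borel"
proof (rule borel_measurableI)
  fix S :: "'c set" assume "open S"
  hence "openin X {x \<in> topspace X. f x \<in> S}"
    using openin_continuous_map_preimage[OF assms, of S] by simp
  moreover have "{x \<in> topspace X. f x \<in> S} = f -` S \<inter> space (borel_of X)" by auto
  ultimately show "f -` S \<inter> space (borel_of X) \<in> sets (borel_of X)" using borel_of_open by metis
qed

text \<open>For a continuous Hilbertian \<open>p\<close> this is \<open>dual_ball\<close>, see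
  \<open>dual_ball_eq_polar\<close>. The pointwise form exhibits it as a closed subset of a product
  of compact intervals.\<close>

definition polar :: "('a::real_vector \<Rightarrow> real) \<Rightarrow> ('a \<Rightarrow> real) set" where
  "polar p = {f. linear f \<and> (\<forall>x. \<bar>f x\<bar> \<le> p x)}"

text \<open>By Tychonoff the polar is compact for pointwise convergence; on it pointwise convergence
  is uniform on \<open>p\<close>-totally bounded sets.\<close>

lemma compactin_polar:
  fixes T :: "'a::real_vector topology"
  assumes T: "nuclear_space T" and p: "cont_hilbertian T p"
  shows "compactin (strong_dual T) (polar p)"
proof -
  obtain P where P: "hilbertian_form p P" using p by (elim cont_hilbertianE)
  have sub: "polar p \<subseteq> dual T"
    using dual_if_le_cont_hilbertian[OF T p] by (auto simp: polar_def)
  have eval: "continuous_on UNIV (\<lambda>f::'a \<Rightarrow> real. f x)" for x by simp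
  have "compactin (product_topology (\<lambda>_. euclideanreal) UNIV) (PiE UNIV (\<lambda>x. {- p x..p x}))"
    by (simp add: compactin_PiE)
  hence "compact (PiE UNIV (\<lambda>x. {- p x..p x}))" by (simp add: euclidean_product_topology)
  moreover have "closed {f::'a \<Rightarrow> real. linear f}"
    unfolding linear_iff real_scaleR_def
    by (intro closed_Collect_conj closed_Collect_all closed_Collect_eq continuous_intros eval)
  moreover have "polar p = PiE UNIV (\<lambda>x. {- p x..p x}) \<inter> {f. linear f}"
    by (auto simp: polar_def PiE_def abs_le_iff minus_le_iff)
  ultimately have cpt: "compact (polar p)" by (simp add: compact_Int_closed)
  obtain s where s: "cont_hilbertian T s"
    and tb: "\<And>\<epsilon>. \<epsilon> > 0 \<Longrightarrow> \<exists>F. finite F \<and> (\<forall>x. s x \<le> 1 \<longrightarrow> (\<exists>y\<in>F. p (x - y) < \<epsilon>))"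
    using nuclear_totally_bounded[OF T p] by blast
  obtain S where S: "hilbertian_form s S" using s by (elim cont_hilbertianE)
  have "continuous_map (top_of_set (polar p)) (strong_dual T) (\<lambda>f. f)"
    unfolding strong_dual_def uniform_conv_topology_def
  proof (rule continuous_on_generated_topo)
    fix U assume U: "U \<in> insert (dual T) {{g \<in> dual T. \<exists>d<e. \<forall>x\<in>B. \<bar>g x - f x\<bar> \<le> d} | f B e.
        f \<in> dual T \<and> B \<in> {B. tvs_bounded T B} \<and> (e::real) > 0}"
    show "openin (top_of_set (polar p)) ((\<lambda>f. f) -` U \<inter> topspace (top_of_set (polar p)))"
    proof (cases "U = dual T")
      case True
      thus ?thesis using sub by (simp add: inf.absorb2)
    next
      case False
      then obtain f B e where B: "tvs_bounded T B" and U: "U = {g \<in> dual T. \<exists>d<e. \<forall>x\<in>B. \<bar>g x - f x\<bar> \<le> d}"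
        using U by auto
      obtain C where C: "C > 0" "\<And>x. x \<in> B \<Longrightarrow> s x \<le> C"
        using tvs_bounded_cont_hilbertian[OF nuclear_topspace[OF T] B s] by blast
      have "\<exists>W. open W \<and> g0 \<in> W \<and> polar p \<inter> W \<subseteq> U" if g0: "g0 \<in> polar p" "g0 \<in> U" for g0
      proof -
        obtain d where d: "d < e" "\<And>x. x \<in> B \<Longrightarrow> \<bar>g0 x - f x\<bar> \<le> d" using g0(2) U by auto
        \<comment> \<open>Three errors of size \<open>\<eta>\<close> must fit between
          \<open>d\<close> and \<open>e\<close>: moving from \<open>x\<close> to a net point for
          \<open>g\<close>, the same for \<open>g0\<close>, and the distance of \<open>g\<close> and
          \<open>g0\<close> at the net point.\<close>
        define \<eta> where "\<eta> = (e - d) / 4"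
        have \<eta>: "\<eta> > 0" using d(1) by (simp add: \<eta>_def)
        obtain F where F: "finite F" "\<And>x. s x \<le> 1 \<Longrightarrow> \<exists>y\<in>F. p (x - y) < \<eta> / C"
          using tb[of "\<eta> / C"] \<eta> C(1) by auto
        \<comment> \<open>The net covers the \<open>s\<close>-unit ball, while \<open>B\<close> lies
          in \<open>C\<close> times that ball; hence the test points
          \<open>C *\<^sub>R y\<close>.\<close>
        define W where "W = {g::'a \<Rightarrow> real. \<forall>y\<in>F. \<bar>g (C *\<^sub>R y) - g0 (C *\<^sub>R y)\<bar> < \<eta>}"
        have "W = (\<Inter>y\<in>F. {g. \<bar>g (C *\<^sub>R y) - g0 (C *\<^sub>R y)\<bar> < \<eta>})" by (auto simp: W_def)
        moreover have "open {g::'a \<Rightarrow> real. \<bar>g (C *\<^sub>R y) - g0 (C *\<^sub>R y)\<bar> < \<eta>}" for y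
          by (intro open_Collect_less continuous_intros eval)
        ultimately have "open W" by (auto intro!: open_INT F(1))
        moreover have "g0 \<in> W" using \<eta> by (simp add: W_def)
        moreover have "polar p \<inter> W \<subseteq> U"
        proof
          fix g assume g: "g \<in> polar p \<inter> W"
          have "\<bar>g x - f x\<bar> \<le> d + 3 * \<eta>" if x: "x \<in> B" for x
          proof -
            have "s ((1 / C) *\<^sub>R x) \<le> 1" using C x by (simp add: hilbertian_scaleR[OF S])
            then obtain y where y: "y \<in> F" "p ((1 / C) *\<^sub>R x - y) < \<eta> / C" using F(2) by blast
            have "x - C *\<^sub>R y = C *\<^sub>R ((1 / C) *\<^sub>R x - y)" using C(1) by (simp add: scaleR_diff_right)
            hence "p (x - C *\<^sub>R y) = C * p ((1 / C) *\<^sub>R x - y)" using C(1) by (simp add: hilbertian_scaleR[OF P])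
            hence py: "p (x - C *\<^sub>R y) < \<eta>" using y(2) C(1) by (simp add: field_simps)
            have lin: "\<bar>h x - h (C *\<^sub>R y)\<bar> < \<eta>" if "h \<in> polar p" for h
            proof -
              have "linear h" "\<bar>h (x - C *\<^sub>R y)\<bar> \<le> p (x - C *\<^sub>R y)" using that by (auto simp: polar_def)
              thus ?thesis using py linear_diff[of h x "C *\<^sub>R y"] by simp
            qed
            have "\<bar>g (C *\<^sub>R y) - g0 (C *\<^sub>R y)\<bar> < \<eta>" using g y(1) by (auto simp: W_def)
            with lin[of g] lin[of g0] g g0(1) d(2)[OF x] show ?thesis by fastforce
          qed
          moreover have "d + 3 * \<eta> < e" using d(1) by (simp add: \<eta>_def field_simps)
          ultimately show "g \<in> U" using g sub U by auto
        qed
        ultimately show ?thesis by blast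
      qed
      hence "openin (top_of_set (polar p)) (polar p \<inter> U)"
        by (subst openin_subopen) (metis IntD1 IntD2 Int_iff Int_subset_iff inf_le1 openin_open_Int)
      thus ?thesis by (simp add: Int_commute)
    qed
  qed (use sub in auto)
  hence "compactin (strong_dual T) ((\<lambda>f. f) ` polar p)"
    by (rule image_compactin[rotated]) (simp add: cpt compactin_subtopology)
  thus ?thesis by simp
qed

text \<open>Evaluation on a countable dense set embeds a polar homeomorphically into a Polish space,
  where finite Borel measures are inner regular.\<close>

lemma inner_regular_on_polar:
  fixes T :: "'a::real_vector topology"
  assumes T: "nuclear_space T" and p: "cont_hilbertian T p"
    and N: "finite_measure N" "sets N = sets (borel_of (strong_dual T))"
    and G: "\<Gamma> \<in> sets N" and e: "\<epsilon> > 0"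
  obtains K where "compactin (strong_dual T) K" "K \<subseteq> \<Gamma> \<inter> polar p"
    "emeasure N (\<Gamma> \<inter> polar p - K) < ennreal \<epsilon>"
proof -
  interpret N: finite_measure N by fact
  let ?X = "strong_dual T" and ?K = "polar p"
  note H = Hausdorff_strong_dual[OF T] and cK = compactin_polar[OF T p]
  have sK: "?K \<in> sets N" unfolding N(2) by (intro borel_of_closed compactin_imp_closedin H cK)
  have spN: "space N = dual T" using sets_eq_imp_space_eq[OF N(2)] by simp
  obtain R where R: "hilbertian_form p R" using p by (elim cont_hilbertianE)
  obtain D where D: "countable D" "\<And>x \<epsilon>. \<epsilon> > 0 \<Longrightarrow> \<exists>d\<in>D. p (x - d) < \<epsilon>"
    using nuclear_separable[OF T p] by blast
  have Dne: "D \<noteq> {}" using D(2)[of 1 0] by auto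
  define \<Theta> :: "('a \<Rightarrow> real) \<Rightarrow> nat \<Rightarrow> real" where "\<Theta> f k = f (from_nat_into D k)" for f k
  have \<Theta>c: "continuous_map ?X euclidean \<Theta>"
    unfolding \<Theta>_def[abs_def] by (rule continuous_map_strong_dual_product[OF T])
  have \<Theta>m: "\<Theta> \<in> N \<rightarrow>\<^sub>M borel"
    using measurable_borel_of_continuous[OF \<Theta>c] by (simp add: measurable_cong_sets[OF N(2)])
  have inj: "inj_on \<Theta> ?K"
  proof (rule inj_onI, rule ext, rule ccontr)
    fix f g x assume f: "f \<in> ?K" and g: "g \<in> ?K" and eq: "\<Theta> f = \<Theta> g" and ne: "f x \<noteq> g x"
    obtain d where d: "d \<in> D" "p (x - d) < \<bar>f x - g x\<bar> / 2" using D(2)[of "\<bar>f x - g x\<bar> / 2" x] ne by auto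
    obtain k where "from_nat_into D k = d" using from_nat_into_surj[OF D(1) d(1)] by blast
    hence "f d = g d" using fun_cong[OF eq, of k] by (simp add: \<Theta>_def)
    moreover have "\<bar>f x - f d\<bar> \<le> p (x - d)" "\<bar>g x - g d\<bar> \<le> p (x - d)"
      using f g linear_diff[of f x d] linear_diff[of g x d] by (auto simp: polar_def) metis+
    ultimately have "\<bar>f x - g x\<bar> \<le> 2 * p (x - d)" by linarith
    thus False using d(2) by (simp add: pos_less_divide_eq)
  qed
  have img_compact: "compact (\<Theta> ` C)" if "compactin ?X C" for C
    using image_compactin[OF that \<Theta>c] by simp
  \<comment> \<open>Images of Borel sets are Borel by induction on their generation. Injectivity on
    the polar lets images commute with complements, and for open \<open>U\<close> the rest of the
    polar is compact, so its image is compact.\<close>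
  have img: "\<Theta> ` (G \<inter> ?K) \<in> sets borel" if "G \<in> sets (borel_of ?X)" for G
    using that unfolding sets_borel_of
  proof (induction rule: sigma_sets.induct)
    case (Basic U)
    have "closedin ?X (topspace ?X - U)" using Basic by (intro closedin_diff closedin_topspace) auto
    hence "compactin ?X (?K \<inter> (topspace ?X - U))"
      using closed_Int_compactin cK by (metis Int_commute)
    hence "\<Theta> ` (?K \<inter> (topspace ?X - U)) \<in> sets borel" "\<Theta> ` ?K \<in> sets borel"
      using img_compact cK by (auto intro!: borel_compact)
    moreover have "\<Theta> ` (U \<inter> ?K) = \<Theta> ` ?K - \<Theta> ` (?K \<inter> (topspace ?X - U))"
      using inj compactin_subset_topspace[OF cK] by (auto simp: inj_on_def)
    ultimately show ?case by auto
  next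
    case (Compl G)
    have "\<Theta> ` ?K \<in> sets borel" using img_compact cK by (auto intro!: borel_compact)
    moreover have "\<Theta> ` ((topspace ?X - G) \<inter> ?K) = \<Theta> ` ?K - \<Theta> ` (G \<inter> ?K)"
      using inj compactin_subset_topspace[OF cK] by (auto simp: inj_on_def)
    ultimately show ?case using Compl by auto
  next
    case (Union G)
    have "\<Theta> ` (\<Union> (range G) \<inter> ?K) = (\<Union>i. \<Theta> ` (G i \<inter> ?K))" by blast
    thus ?case using Union by auto
  qed simp
  define \<pi> where "\<pi> = distr (density N (indicator ?K)) borel \<Theta>"
  have pi: "emeasure \<pi> A = emeasure N (?K \<inter> \<Theta> -` A)" if "A \<in> sets borel" for A
  proof -
    have A: "\<Theta> -` A \<inter> space N \<in> sets N" using \<Theta>m that by (rule measurable_sets)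
    have "emeasure \<pi> A = (\<integral>\<^sup>+x. indicator ?K x * indicator (\<Theta> -` A \<inter> space N) x \<partial>N)"
      unfolding \<pi>_def using \<Theta>m that A sK by (simp add: emeasure_distr emeasure_density)
    also have "\<dots> = emeasure N (?K \<inter> (\<Theta> -` A \<inter> space N))"
      using A sK by (subst indicator_inter_arith[symmetric]) simp
    also have "?K \<inter> (\<Theta> -` A \<inter> space N) = ?K \<inter> \<Theta> -` A"
      using sets.sets_into_space[OF sK] by auto
    finally show ?thesis .
  qed
  define A where "A = \<Theta> ` (\<Gamma> \<inter> ?K)"
  have A: "A \<in> sets borel" unfolding A_def using G N(2) by (intro img) simp
  have KA: "?K \<inter> \<Theta> -` A = \<Gamma> \<inter> ?K" unfolding A_def using inj by (auto simp: inj_on_def)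
  have "emeasure \<pi> A = (SUP C\<in>{C. C \<subseteq> A \<and> compact C}. emeasure \<pi> C)"
    by (rule inner_regular) (use A pi[of "space \<pi>"] in \<open>auto simp: \<pi>_def\<close>)
  moreover have fin: "emeasure \<pi> A \<noteq> \<infinity>" unfolding pi[OF A] by simp
  ultimately have "\<exists>C\<in>{C. C \<subseteq> A \<and> compact C}. emeasure \<pi> A < emeasure \<pi> C + ennreal \<epsilon>"
    using e by (intro SUP_approx_ennreal) auto
  then obtain C where C: "C \<subseteq> A" "compact C" "emeasure \<pi> A < emeasure \<pi> C + ennreal \<epsilon>" by auto
  \<comment> \<open>A closed subset of the compact polar, so continuity of \<open>\<Theta>\<close>
    alone makes it compact.\<close>
  define K where "K = ?K \<inter> \<Theta> -` C"
  have K': "K = ?K \<inter> {f \<in> topspace ?X. \<Theta> f \<in> C}"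
    using compactin_subset_topspace[OF cK] by (auto simp: K_def)
  have "closedin ?X {f \<in> topspace ?X. \<Theta> f \<in> C}"
    using C(2) by (intro closedin_continuous_map_preimage[OF \<Theta>c]) (simp add: compact_imp_closed)
  hence K: "compactin ?X K" unfolding K' using closed_Int_compactin cK by (metis Int_commute)
  have Ksub: "K \<subseteq> \<Gamma> \<inter> ?K" using C(1) KA by (auto simp: K_def)
  have sets: "K \<in> sets N" unfolding N(2) by (intro borel_of_closed compactin_imp_closedin H K)
  have lt: "emeasure N (\<Gamma> \<inter> ?K) < emeasure N K + ennreal \<epsilon>"
    using C(2,3) pi[OF A] pi[of C] KA by (simp add: K_def borel_compact)
  have "emeasure N (\<Gamma> \<inter> ?K - K) < ennreal \<epsilon>"
  proof -
    have "emeasure N (\<Gamma> \<inter> ?K - K) = emeasure N (\<Gamma> \<inter> ?K) - emeasure N K"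
      using Ksub sets G sK by (intro emeasure_Diff) auto
    moreover have "emeasure N K \<le> emeasure N (\<Gamma> \<inter> ?K)" "emeasure N K < top"
      using Ksub G sK by (auto intro!: emeasure_mono simp: less_top[symmetric])
    ultimately show ?thesis using lt by (simp add: minus_less_iff_ennreal add.commute)
  qed
  thus ?thesis using that K Ksub by blast
qed

text \<open>The polars increase to a set of full measure, so by continuity from above one of them
  misses less than \<open>\<epsilon> / 2\<close> of \<open>\<Gamma>\<close>. Inner regularity on
  that polar spends the other half.\<close>

lemma radon_if_concentrated_on_polars:
  assumes T: "nuclear_space T" and p: "\<And>n::nat. cont_hilbertian T (p n)"
    and mono: "\<And>n x. p n x \<le> p (Suc n) x"
    and N: "finite_measure N" "sets N = sets (borel_of (strong_dual T))"
    and null: "emeasure N (dual T - (\<Union>n. polar (p n))) = 0"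
  shows "radon_measure (strong_dual T) N"
  unfolding radon_measure_def
proof (intro conjI ballI allI impI)
  show "sets N = sets (borel_of (strong_dual T))" by fact
  interpret N: finite_measure N by fact
  fix \<Gamma> and \<epsilon> :: real assume G: "\<Gamma> \<in> sets N" and e: "\<epsilon> > 0"
  have spN: "space N = dual T" using sets_eq_imp_space_eq[OF N(2)] by simp
  have sK: "polar (p n) \<in> sets N" for n
    unfolding N(2) by (intro borel_of_closed compactin_imp_closedin Hausdorff_strong_dual compactin_polar T p)
  have "polar (p n) \<subseteq> polar (p (Suc n))" for n
    using mono by (auto simp: polar_def intro: order_trans)
  hence "decseq (\<lambda>n. \<Gamma> - polar (p n))" by (intro decseq_SucI) auto
  hence "(\<lambda>n. emeasure N (\<Gamma> - polar (p n))) \<longlonglongrightarrow> emeasure N (\<Inter>n. \<Gamma> - polar (p n))"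
    using G sK by (intro Lim_emeasure_decseq) auto
  moreover have "emeasure N (\<Inter>n. \<Gamma> - polar (p n)) = 0"
  proof -
    have "(\<Inter>n. \<Gamma> - polar (p n)) \<subseteq> dual T - (\<Union>n. polar (p n))"
      using sets.sets_into_space[OF G] spN by auto
    moreover have "dual T - (\<Union>n. polar (p n)) \<in> sets N" 
    proof -
      have "(\<Union>n. polar (p n)) \<in> sets N" using sK by auto
      from sets.compl_sets[OF this] show ?thesis unfolding spN .
    qed
    ultimately show ?thesis using null emeasure_mono by (metis le_zero_eq)
  qed
  ultimately have "eventually (\<lambda>n. emeasure N (\<Gamma> - polar (p n)) < ennreal (\<epsilon> / 2)) sequentially"
    using e by (intro order_tendstoD(2)) auto
  then obtain n where n: "emeasure N (\<Gamma> - polar (p n)) < ennreal (\<epsilon> / 2)"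
    by (auto simp: eventually_sequentially)
  obtain K where K: "compactin (strong_dual T) K" "K \<subseteq> \<Gamma> \<inter> polar (p n)"
    "emeasure N (\<Gamma> \<inter> polar (p n) - K) < ennreal (\<epsilon> / 2)"
    using inner_regular_on_polar[OF T p N G, of "\<epsilon> / 2" n] e by auto
  have sets: "K \<in> sets N"
    unfolding N(2) by (intro borel_of_closed compactin_imp_closedin Hausdorff_strong_dual T K)
  have "\<Gamma> - K = (\<Gamma> - polar (p n)) \<union> (\<Gamma> \<inter> polar (p n) - K)" using K(2) by auto
  hence "emeasure N (\<Gamma> - K) \<le> emeasure N (\<Gamma> - polar (p n)) + emeasure N (\<Gamma> \<inter> polar (p n) - K)"
    using G sK sets by (auto intro!: emeasure_subadditive)
  also have "\<dots> < ennreal (\<epsilon> / 2) + ennreal (\<epsilon> / 2)" using n K(3) by (rule add_strict_mono)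
  also have "\<dots> = ennreal \<epsilon>" using e by (simp flip: ennreal_plus)
  finally show "\<exists>K. compactin (strong_dual T) K \<and> K \<subseteq> \<Gamma> \<and> emeasure N (\<Gamma> - K) < ennreal \<epsilon>"
    using K by blast
qed

section \<open>Increments of the process\<close>

text \<open>In \<open>1 - z^n = (1 - z) * (\<Sum>k<n. z^k)\<close> every term of the sum has real
  part at least 1/2, so the sum has modulus at least \<open>n / 2\<close>, while the left side has
  modulus at most 1/2.\<close>

lemma powers_near_one:
  fixes z :: complex
  assumes "\<And>k. k \<le> n \<Longrightarrow> cmod (1 - z ^ k) \<le> 1 / 2"
  shows "real n * cmod (1 - z) \<le> 1"
proof -
  have re: "Re (z ^ k) \<ge> 1 / 2" if "k \<le> n" for k
    using assms[OF that] abs_Re_le_cmod[of "1 - z ^ k"] by simp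
  have "(\<Sum>k<n. 1 / 2) \<le> (\<Sum>k<n. Re (z ^ k))" using re by (intro sum_mono) auto
  also have "\<dots> \<le> cmod (\<Sum>k<n. z ^ k)"
    using complex_Re_le_cmod[of "\<Sum>k<n. z ^ k"] by (simp add: Re_sum)
  finally have "real n / 2 \<le> cmod (\<Sum>k<n. z ^ k)" by simp
  hence "cmod (1 - z) * (real n / 2) \<le> cmod (1 - z) * cmod (\<Sum>k<n. z ^ k)"
    by (rule mult_left_mono) simp
  also have "\<dots> = cmod (1 - z ^ n)" by (simp add: one_diff_power_eq norm_mult)
  also have "\<dots> \<le> 1 / 2" by (rule assms) simp
  finally show ?thesis by (simp add: mult.commute)
qed

text \<open>Follows from \<open>\<bar>sin (k * x)\<bar> \<le> k * \<bar>sin x\<bar>\<close> and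
  \<open>1 - cos (2 * t) = 2 * (sin t)^2\<close>. It carries a bound from the unit ball of a
  seminorm to the whole space, with quadratic growth.\<close>

lemma one_minus_cos_mult_le: "1 - cos (real k * y) \<le> (real k)\<^sup>2 * (1 - cos y)"
proof -
  have "\<bar>sin (real k * x)\<bar> \<le> real k * \<bar>sin x\<bar>" for x
  proof (induction k)
    case (Suc k)
    have "\<bar>sin (real (Suc k) * x)\<bar> = \<bar>sin (real k * x) * cos x + cos (real k * x) * sin x\<bar>"
      by (simp add: algebra_simps sin_add)
    also have "\<dots> \<le> \<bar>sin (real k * x)\<bar> * \<bar>cos x\<bar> + \<bar>cos (real k * x)\<bar> * \<bar>sin x\<bar>"
      using abs_triangle_ineq by (metis abs_mult)
    also have "\<dots> \<le> \<bar>sin (real k * x)\<bar> * 1 + 1 * \<bar>sin x\<bar>"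
      by (intro add_mono mult_left_mono mult_right_mono) auto
    finally show ?case using Suc by (simp add: algebra_simps)
  qed simp
  hence "(sin (real k * (y / 2)))\<^sup>2 \<le> (real k * \<bar>sin (y / 2)\<bar>)\<^sup>2"
    by (metis abs_le_square_iff abs_mult abs_of_nat abs_abs)
  hence "2 * (sin (real k * y / 2))\<^sup>2 \<le> (real k)\<^sup>2 * (2 * (sin (y / 2))\<^sup>2)"
    by (simp add: power_mult_distrib)
  moreover have "1 - cos (2 * t) = 2 * (sin t)\<^sup>2" for t :: real by (simp add: cos_double_sin)
  from this[of "real k * y / 2"] this[of "y / 2"]
  have "1 - cos (real k * y) = 2 * (sin (real k * y / 2))\<^sup>2" "1 - cos y = 2 * (sin (y / 2))\<^sup>2"
    by simp_all
  ultimately show ?thesis by simp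
qed

context prob_space
begin

text \<open>Where \<open>\<bar>Y\<bar> < a\<close> the integrand is at most
  \<open>\<bar>Y\<bar> < a\<close>; elsewhere it is at most 2, on an event of probability below
  \<open>a\<close>. Together this gives \<open>a + 2 * a\<close>.\<close>

lemma char_near_one:
  assumes Y: "random_variable borel Y" and a: "a > 0"
    and "prob {\<omega>\<in>space M. \<bar>Y \<omega>\<bar> \<ge> a} < a"
  shows "cmod (1 - char (distr M borel Y) 1) \<le> 3 * a"
proof -
  have ch: "char (distr M borel Y) 1 = (CLINT \<omega>|M. iexp (Y \<omega>))"
    using Y by (simp add: char_def integral_distr)
  have int: "integrable M (\<lambda>\<omega>. iexp (Y \<omega>))" using Y by (intro integrable_iexp) auto
  have "1 - char (distr M borel Y) 1 = (CLINT \<omega>|M. 1 - iexp (Y \<omega>))"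
    unfolding ch using int by (subst Bochner_Integration.integral_diff) (auto simp: prob_space)
  also have "cmod \<dots> \<le> (\<integral>\<omega>. cmod (1 - iexp (Y \<omega>)) \<partial>M)" by (rule integral_norm_bound)
  also have "\<dots> \<le> (\<integral>\<omega>. a + 2 * indicator {\<omega>\<in>space M. \<bar>Y \<omega>\<bar> \<ge> a} \<omega> \<partial>M)"
  proof (rule integral_mono)
    show "integrable M (\<lambda>\<omega>. cmod (1 - iexp (Y \<omega>)))" using int by auto
    show "integrable M (\<lambda>\<omega>. a + 2 * indicator {\<omega>\<in>space M. \<bar>Y \<omega>\<bar> \<ge> a} \<omega>)"
      using Y by (intro Bochner_Integration.integrable_add integrable_mult_right integrable_real_indicator)
        (auto simp: less_top[symmetric])
    fix \<omega> assume w: "\<omega> \<in> space M"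
    show "cmod (1 - iexp (Y \<omega>)) \<le> a + 2 * indicator {\<omega>\<in>space M. \<bar>Y \<omega>\<bar> \<ge> a} \<omega>"
    proof (cases "\<bar>Y \<omega>\<bar> \<ge> a")
      case True
      have "cmod (1 - iexp (Y \<omega>)) \<le> cmod 1 + cmod (iexp (Y \<omega>))" by (rule norm_triangle_ineq4)
      also have "\<dots> = 2" by (simp del: of_real_mult)
      finally show ?thesis using w True a by simp
    next
      case False
      have "cmod (1 - iexp (Y \<omega>)) \<le> \<bar>Y \<omega>\<bar>"
        using iexp_approx1[of "Y \<omega>" 0] by (simp add: norm_minus_commute)
      thus ?thesis using False w by simp
    qed
  qed
  also have "\<dots> = a + 2 * prob {\<omega>\<in>space M. \<bar>Y \<omega>\<bar> \<ge> a}"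
    using Y by (subst Bochner_Integration.integral_add) (auto simp: prob_space less_top[symmetric])
  also have "\<dots> \<le> 3 * a" using assms(3) by simp
  finally show ?thesis .
qed

lemma one_minus_cos_le_char:
  assumes Y: "random_variable borel Y"
  shows "expectation (\<lambda>\<omega>. 1 - cos (Y \<omega>)) \<le> cmod (1 - char (distr M borel Y) 1)"
proof -
  have ch: "char (distr M borel Y) 1 = (CLINT \<omega>|M. iexp (Y \<omega>))"
    using Y by (simp add: char_def integral_distr)
  have int: "integrable M (\<lambda>\<omega>. iexp (Y \<omega>))" using Y by (intro integrable_iexp) auto
  have "Re (char (distr M borel Y) 1) = (\<integral>\<omega>. Re (iexp (Y \<omega>)) \<partial>M)"
    unfolding ch using int by (rule integral_Re[symmetric])
  also have "\<dots> = (\<integral>\<omega>. cos (Y \<omega>) \<partial>M)" by (simp add: Re_exp)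
  finally have re: "Re (char (distr M borel Y) 1) = expectation (\<lambda>\<omega>. cos (Y \<omega>))" .
  have "integrable M (\<lambda>\<omega>. cos (Y \<omega>))"
    using Y by (intro integrable_const_bound[where B=1]) auto
  hence "expectation (\<lambda>\<omega>. 1 - cos (Y \<omega>)) = 1 - Re (char (distr M borel Y) 1)"
    unfolding re by (subst Bochner_Integration.integral_diff) (auto simp: prob_space)
  also have "\<dots> \<le> cmod (1 - char (distr M borel Y) 1)"
    using complex_Re_le_cmod[of "1 - char (distr M borel Y) 1"] by simp
  finally show ?thesis .
qed

end

text \<open>The cosine and sine integrals are the real and imaginary parts of the normal
  characteristic function, so only the cosine term of the addition formula survives. Each use
  produces one factor of the Gaussian exponential.\<close>

lemma integral_cos_std_normal:
  "integral\<^sup>L std_normal_distribution (\<lambda>g. cos (a + g * b)) = cos a * exp (- (b\<^sup>2) / 2)"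
proof -
  interpret N: real_distribution std_normal_distribution by (rule real_dist_normal_dist)
  have int: "integrable std_normal_distribution (\<lambda>g. iexp (b * g))"
    by (intro N.integrable_iexp) auto
  have "Re (char std_normal_distribution b) = (\<integral>g. Re (iexp (b * g)) \<partial>std_normal_distribution)"
    "Im (char std_normal_distribution b) = (\<integral>g. Im (iexp (b * g)) \<partial>std_normal_distribution)"
    unfolding char_def using int by (simp_all only: integral_Re[symmetric] integral_Im[symmetric])
  hence cs: "(\<integral>g. cos (b * g) \<partial>std_normal_distribution) = exp (- (b\<^sup>2) / 2)"
    "(\<integral>g. sin (b * g) \<partial>std_normal_distribution) = 0"
    by (simp_all add: char_std_normal_distribution Re_exp Im_exp)
  have "integrable std_normal_distribution (\<lambda>g. cos (b * g))" "integrable std_normal_distribution (\<lambda>g. sin (b * g))"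
    by (intro N.integrable_const_bound[where B=1]; simp)+
  thus ?thesis by (simp add: cos_add mult.commute[of _ b] cs)
qed

text \<open>Averaging a bound on \<open>1 - cos (Y \<phi>)\<close> over Gaussian \<open>\<phi>\<close>, one direction at a time.\<close>

lemma (in prob_space) gaussian_average:
  fixes Y :: "'a \<Rightarrow> 'b::real_vector \<Rightarrow> real"
  assumes hf: "hilbertian_form p Q" and meas: "\<And>\<phi>. random_variable borel (\<lambda>\<omega>. Y \<omega> \<phi>)"
    and lin: "\<And>\<omega>. \<omega> \<in> space M \<Longrightarrow> linear (Y \<omega>)" and c: "c \<ge> 0"
    and bound: "\<And>\<phi>. c * expectation (\<lambda>\<omega>. 1 - cos (Y \<omega> \<phi>)) \<le> A + B * (p \<phi>)\<^sup>2"
    and I: "finite I"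
  shows "c * expectation (\<lambda>\<omega>. 1 - cos (Y \<omega> \<phi>) * exp (- (\<Sum>i\<in>I. (Y \<omega> (b i))\<^sup>2) / 2))
    \<le> A + B * ((p \<phi>)\<^sup>2 + (\<Sum>i\<in>I. (p (b i))\<^sup>2))"
  using I
proof (induction I arbitrary: \<phi>)
  case empty
  thus ?case using bound by simp
next
  case (insert j I)
  let ?N = "std_normal_distribution"
  interpret N: real_distribution ?N by (rule real_dist_normal_dist)
  interpret P: pair_prob_space ?N M ..
  let ?G = "\<lambda>\<omega>. exp (- (\<Sum>i\<in>insert j I. (Y \<omega> (b i))\<^sup>2) / 2)"
  define G where "G \<omega> = exp (- (\<Sum>i\<in>I. (Y \<omega> (b i))\<^sup>2) / 2)" for \<omega>
  have G: "0 \<le> G \<omega>" "G \<omega> \<le> 1" for \<omega> by (auto simp: G_def sum_nonneg)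
  note meas [measurable]
  have Gm [measurable]: "G \<in> borel_measurable M"
    unfolding G_def[abs_def] by measurable
  have cosG: "\<bar>cos t * G \<omega>\<bar> \<le> 1" for t \<omega>
    using G[of \<omega>] abs_cos_le_one[of t] by (simp add: abs_mult mult_le_one)
  have intM: "integrable M (\<lambda>\<omega>. cos (Y \<omega> \<psi>) * G \<omega>)" for \<psi>
    by (rule integrable_const_bound[where B=1]) (use cosG in auto)
  have intP: "integrable (?N \<Otimes>\<^sub>M M) (\<lambda>(g, \<omega>). cos (Y \<omega> \<phi> + g * Y \<omega> (b j)) * G \<omega>)"
  proof (rule P.P.integrable_const_bound[where B=1])
    show "(\<lambda>(g, \<omega>). cos (Y \<omega> \<phi> + g * Y \<omega> (b j)) * G \<omega>) \<in> borel_measurable (?N \<Otimes>\<^sub>M M)"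
      by measurable
  qed (use cosG in auto)
  have eq: "expectation (\<lambda>\<omega>. 1 - cos (Y \<omega> \<psi>) * G \<omega>) = 1 - expectation (\<lambda>\<omega>. cos (Y \<omega> \<psi>) * G \<omega>)" for \<psi>
    using intM by (subst Bochner_Integration.integral_diff) (auto simp: prob_space)
  have Yl: "Y \<omega> (\<phi> + g *\<^sub>R b j) = Y \<omega> \<phi> + g * Y \<omega> (b j)" if "\<omega> \<in> space M" for \<omega> g
    using linear_add[OF lin[OF that]] linear_cmul[OF lin[OF that]] by simp
  let ?E = "\<lambda>g. expectation (\<lambda>\<omega>. cos (Y \<omega> \<phi> + g * Y \<omega> (b j)) * G \<omega>)"
  \<comment> \<open>The induction hypothesis at the shifted vector
    \<open>\<phi> + g *\<^sub>R b j\<close>; hence the induction with arbitrary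
    \<open>\<phi>\<close>.\<close>
  have le: "c * (1 - ?E g)
      \<le> A + B * ((p \<phi>)\<^sup>2 + 2 * g * Q \<phi> (b j) + g\<^sup>2 * (p (b j))\<^sup>2 + (\<Sum>i\<in>I. (p (b i))\<^sup>2))" for g
  proof -
    have "expectation (\<lambda>\<omega>. cos (Y \<omega> (\<phi> + g *\<^sub>R b j)) * G \<omega>)
        = ?E g"
      by (intro Bochner_Integration.integral_cong refl) (simp add: Yl)
    moreover have "(p (\<phi> + g *\<^sub>R b j))\<^sup>2 = (p \<phi>)\<^sup>2 + 2 * g * Q \<phi> (b j) + g\<^sup>2 * (p (b j))\<^sup>2"
      unfolding hilbertian_form_self[OF hf, symmetric] using hilbertian_sym[OF hf, of "b j" \<phi>]
      by (simp add: hilbertian_simps[OF hf] power2_eq_square algebra_simps)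
    ultimately show ?thesis
      using insert.IH[of "\<phi> + g *\<^sub>R b j"] unfolding G_def[symmetric] eq by simp
  qed
  \<comment> \<open>The zero mean removes the cross term \<open>2 * g * Q \<phi> (b j)\<close>, and
    the unit variance leaves exactly \<open>(p (b j))^2\<close>.\<close>
  have mom: "integrable ?N (\<lambda>g. g)" "(\<integral>g. g \<partial>?N) = 0" "integrable ?N (\<lambda>g. g\<^sup>2)" "(\<integral>g. g\<^sup>2 \<partial>?N) = 1"
    using integral_std_normal_distribution_moment_odd[of 1] std_normal_distribution_even_moments(1)[of 1]
      integrable_std_normal_distribution_moment[of 1] integrable_std_normal_distribution_moment[of 2]
    by (simp_all add: fact_numeral)
  have intN: "integrable ?N ?E"
    using P.integrable_fst'[OF intP] by simp
  have "c * (1 - (\<integral>g. ?E g \<partial>?N))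
      = (\<integral>g. c * (1 - ?E g) \<partial>?N)"
    using intN N.prob_space by simp
  also have "\<dots> \<le> (\<integral>g. A + B * ((p \<phi>)\<^sup>2 + 2 * g * Q \<phi> (b j) + g\<^sup>2 * (p (b j))\<^sup>2 + (\<Sum>i\<in>I. (p (b i))\<^sup>2)) \<partial>?N)"
    using le by (intro integral_mono) (use intN mom in auto)
  also have "\<dots> = A + B * ((p \<phi>)\<^sup>2 + (p (b j))\<^sup>2 + (\<Sum>i\<in>I. (p (b i))\<^sup>2))"
    using mom N.prob_space by simp
  also have "(\<integral>g. ?E g \<partial>?N)
      = expectation (\<lambda>\<omega>. (\<integral>g. cos (Y \<omega> \<phi> + g * Y \<omega> (b j)) * G \<omega> \<partial>?N))"
    using P.Fubini_integral[OF intP] by simp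
  also have "\<dots> = expectation (\<lambda>\<omega>. cos (Y \<omega> \<phi>) * ?G \<omega>)"
  proof (intro Bochner_Integration.integral_cong refl)
    fix \<omega>
    have "exp (- ((Y \<omega> (b j))\<^sup>2) / 2) * G \<omega> = ?G \<omega>"
      using insert(1,2) by (simp add: G_def exp_add[symmetric] field_simps)
    thus "(\<integral>g. cos (Y \<omega> \<phi> + g * Y \<omega> (b j)) * G \<omega> \<partial>?N)
        = cos (Y \<omega> \<phi>) * ?G \<omega>"
      by (simp add: integral_cos_std_normal mult.assoc)
  qed
  also have "1 - expectation (\<lambda>\<omega>. cos (Y \<omega> \<phi>) * ?G \<omega>)
      = expectation (\<lambda>\<omega>. 1 - cos (Y \<omega> \<phi>) * ?G \<omega>)"
  proof (subst Bochner_Integration.integral_diff)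
    show "integrable M (\<lambda>\<omega>. cos (Y \<omega> \<phi>) * ?G \<omega>)"
    proof (rule integrable_const_bound[where B=1])
      have "\<bar>cos t * ?G \<omega>\<bar> \<le> 1" for t \<omega>
        by (simp add: abs_mult mult_le_one sum_nonneg)
      thus "AE \<omega> in M. norm (cos (Y \<omega> \<phi>) * ?G \<omega>) \<le> 1" by simp
      show "(\<lambda>\<omega>. cos (Y \<omega> \<phi>) * ?G \<omega>) \<in> borel_measurable M"
        by measurable
    qed
  qed (auto simp: prob_space)
  finally show ?case using insert(1,2) by (simp add: algebra_simps)
qed

section \<open>Characteristic functions of the increments over a partition\<close>

lemma measurable_strong_dual_eval:
  "nuclear_space T \<Longrightarrow> (\<lambda>f. f x) \<in> borel_of (strong_dual T) \<rightarrow>\<^sub>M borel"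
  by (intro measurable_borel_of_continuous continuous_map_strong_dual_eval)

text \<open>All powers \<open>z\<^sup>k\<close> with \<open>k \<le> n\<close> are close to 1, where \<open>z\<close> is the characteristic function at 1
  of an increment over time \<open>1/n\<close>; hence \<open>z\<close> is within \<open>1/n\<close> of 1.\<close>

lemma levy_increment_char:
  assumes T: "nuclear_space T" and M: "prob_space M" and L: "levy_process M T L"
    and small: "\<And>t. t \<in> {0..1} \<Longrightarrow> measure M {\<omega>\<in>space M. \<bar>L t \<omega> \<phi>\<bar> \<ge> 1 / 6} < 1 / 6"
    and i: "i < n"
  shows "real n * (\<integral>\<omega>. 1 - cos (L (real (Suc i) / n) \<omega> \<phi> - L (real i / n) \<omega> \<phi>) \<partial>M) \<le> 1"
proof -
  interpret prob_space M by fact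
  define t where "t j = real j / real n" for j
  define X where "X j \<omega> = (L (t (Suc j)) \<omega> - L (t j) \<omega>) \<phi>" for j \<omega>
  have n: "n > 0" using i by simp
  have Lm: "L s \<in> M \<rightarrow>\<^sub>M borel_of (strong_dual T)" if "s \<ge> 0" for s
    using L that by (auto simp: levy_process_def)
  note ev = measurable_strong_dual_eval[OF T, of \<phi>]
  have Lpm: "random_variable borel (\<lambda>\<omega>. L s \<omega> \<phi>)" if "s \<ge> 0" for s
    using measurable_compose[OF Lm[OF that] ev] .
  have ind: "indep_vars (\<lambda>_. borel_of (strong_dual T)) (\<lambda>i \<omega>. L (t (Suc i)) \<omega> - L (t i) \<omega>) {..<n}"
  proof -
    have "0 \<le> t 0 \<and> strict_mono_on {..n} t"
      using n by (auto simp: t_def strict_mono_on_def divide_strict_right_mono)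
    thus ?thesis using L unfolding levy_process_def by blast
  qed
  have indX: "indep_vars (\<lambda>_. borel) X {..<n}"
    unfolding X_def[abs_def] by (rule indep_vars_compose2[OF ind ev])
  define z where "z = char (distr M borel (\<lambda>\<omega>. L (1 / n) \<omega> \<phi>)) 1"
  have chX: "char (distr M borel (X j)) 1 = z" if j: "j < n" for j
  proof -
    have m: "(\<lambda>\<omega>. L (t (Suc j)) \<omega> - L (t j) \<omega>) \<in> M \<rightarrow>\<^sub>M borel_of (strong_dual T)"
      using ind j unfolding indep_vars_def by auto
    have "t (Suc j) - t j = 1 / n" by (simp add: t_def diff_divide_distrib[symmetric])
    moreover have "0 \<le> t j" "t j \<le> t (Suc j)" by (auto simp: t_def divide_right_mono)
    ultimately have "law M T (\<lambda>\<omega>. L (t (Suc j)) \<omega> - L (t j) \<omega>) = law M T (L (1 / n))"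
      using L unfolding levy_process_def by metis
    hence "distr (distr M (borel_of (strong_dual T)) (\<lambda>\<omega>. L (t (Suc j)) \<omega> - L (t j) \<omega>)) borel (\<lambda>f. f \<phi>)
        = distr (distr M (borel_of (strong_dual T)) (L (1 / n))) borel (\<lambda>f. f \<phi>)"
      by (simp add: law_def)
    hence "distr M borel (X j) = distr M borel (\<lambda>\<omega>. L (1 / n) \<omega> \<phi>)"
      using ev m Lm[of "1 / n"] by (simp add: distr_distr o_def X_def[abs_def])
    thus ?thesis by (simp add: z_def)
  qed
  \<comment> \<open>As \<open>L 0 = 0\<close> almost surely, \<open>L (k / n)\<close> is a sum of
    \<open>k\<close> independent increments, each with the law of \<open>L (1 / n)\<close>.\<close>
  have pow: "char (distr M borel (\<lambda>\<omega>. L (t k) \<omega> \<phi>)) 1 = z ^ k" if k: "k \<le> n" for k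
  proof -
    have "AE \<omega> in M. L 0 \<omega> = (\<lambda>_. 0)" using L by (simp add: levy_process_def)
    hence "AE \<omega> in M. L (t k) \<omega> \<phi> = (\<Sum>j<k. X j \<omega>)"
    proof eventually_elim
      case (elim \<omega>)
      have "(\<Sum>j<k. X j \<omega>) = L (t k) \<omega> \<phi> - L (t 0) \<omega> \<phi>"
        unfolding X_def by (simp add: sum_lessThan_telescope[of "\<lambda>j. L (t j) \<omega> \<phi>"])
      thus ?case using elim by (simp add: t_def)
    qed
    hence "distr M borel (\<lambda>\<omega>. L (t k) \<omega> \<phi>) = distr M borel (\<lambda>\<omega>. \<Sum>j<k. X j \<omega>)"
      using Lpm[of "t k"] indX k
      by (intro distr_cong_AE refl) (auto simp: t_def indep_vars_def intro!: borel_measurable_sum)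
    hence "char (distr M borel (\<lambda>\<omega>. L (t k) \<omega> \<phi>)) 1 = (\<Prod>j<k. char (distr M borel (X j)) 1)"
      using char_distr_sum[OF indep_vars_subset[OF indX], of "{..<k}"] k by simp
    thus ?thesis using chX k by simp
  qed
  have "real n * cmod (1 - z) \<le> 1"
  proof (rule powers_near_one)
    fix k assume k: "k \<le> n"
    have "t k \<in> {0..1}" using k n by (simp add: t_def)
    \<comment> \<open>The level 1/6 is chosen so that the factor 3 of \<open>char_near_one\<close>
      yields the 1/2 of \<open>powers_near_one\<close>.\<close>
    from small[OF this] have "cmod (1 - char (distr M borel (\<lambda>\<omega>. L (t k) \<omega> \<phi>)) 1) \<le> 3 * (1 / 6)"
      using \<open>t k \<in> {0..1}\<close> by (intro char_near_one Lpm) auto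
    thus "cmod (1 - z ^ k) \<le> 1 / 2" using pow[OF k] by simp
  qed
  moreover have "expectation (\<lambda>\<omega>. 1 - cos (X i \<omega>)) \<le> cmod (1 - z)"
    using one_minus_cos_le_char[of "X i"] indX i chX[OF i] by (auto simp: indep_vars_def)
  ultimately have "real n * expectation (\<lambda>\<omega>. 1 - cos (X i \<omega>)) \<le> 1"
    by (meson mult_left_mono of_nat_0_le_iff order_trans)
  thus ?thesis by (simp add: X_def t_def)
qed

text \<open>The mean of \<open>1 - cos (f \<phi>)\<close> over the Gaussian vector
  \<open>\<phi>\<close> that combines the \<open>b j\<close> with independent standard normal
  weights.\<close>

definition gauss_fun :: "'i set \<Rightarrow> ('i \<Rightarrow> 'a) \<Rightarrow> ('a \<Rightarrow> real) \<Rightarrow> real" where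
  "gauss_fun I b f = 1 - exp (- (\<Sum>j\<in>I. (f (b j))\<^sup>2) / 2)"

lemma gauss_fun_bounds: "0 \<le> gauss_fun I b f" "gauss_fun I b f \<le> 1"
  by (auto simp: gauss_fun_def sum_nonneg)

lemma gauss_fun_zero: "gauss_fun I b (\<lambda>_. 0) = 0"
  by (simp add: gauss_fun_def)

text \<open>Equicontinuity at 0 supplies a seminorm \<open>p\<close> on whose open unit ball
  \<open>levy_increment_char\<close> holds. Scaling extends this to the bound
  \<open>2 + 2 * (p \<phi>)^2\<close> for all \<open>\<phi>\<close>, which is then averaged.\<close>

lemma levy_increment_gaussian_bound:
  assumes T: "nuclear_space T" and M: "prob_space M" and L: "levy_process M T L"
    and eq: "equicontinuous_in_prob M T L {0..1}"
  obtains p where "cont_hilbertian T p"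
    "\<And>(I::'i set) b i n. finite I \<Longrightarrow> i < n \<Longrightarrow>
      real n * (\<integral>\<omega>. gauss_fun I b (L (real (Suc i) / n) \<omega> - L (real i / n) \<omega>) \<partial>M)
        \<le> 2 * (1 + (\<Sum>j\<in>I. (p (b j))\<^sup>2))"
proof -
  interpret prob_space M by fact
  have Lm: "L s \<in> M \<rightarrow>\<^sub>M borel_of (strong_dual T)" if "s \<ge> 0" for s
    using L that by (auto simp: levy_process_def)
  have Lpm: "random_variable borel (\<lambda>\<omega>. L s \<omega> \<phi>)" if "s \<ge> 0" for s \<phi>
    using measurable_compose[OF Lm[OF that] measurable_strong_dual_eval[OF T]] .
  have lin: "linear (L s \<omega>)" if "s \<ge> 0" "\<omega> \<in> space M" for s \<omega>
    using measurable_space[OF Lm[OF that(1)] that(2)] by (simp add: dual_def)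
  have "\<exists>U. openin T U \<and> 0 \<in> U \<and> (\<forall>t\<in>{0..1}. \<forall>\<phi>\<in>U.
      measure M {\<omega> \<in> space M. \<bar>L t \<omega> \<phi> - L t \<omega> 0\<bar> \<ge> 1 / 6} < 1 / 6)"
    by (rule eq[unfolded equicontinuous_in_prob_def, rule_format]) auto
  then obtain U where U: "openin T U" "0 \<in> U" and
    small: "\<And>t \<phi>. t \<in> {0..1} \<Longrightarrow> \<phi> \<in> U \<Longrightarrow> measure M {\<omega> \<in> space M. \<bar>L t \<omega> \<phi> - L t \<omega> 0\<bar> \<ge> 1 / 6} < 1 / 6"
    by blast
  obtain p where p: "cont_hilbertian T p" "{x. p x < 1} \<subseteq> U" using nuclear_nbhd[OF T U] by blast
  obtain Q where Q: "hilbertian_form p Q" using p by (elim cont_hilbertianE)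
  have small': "measure M {\<omega> \<in> space M. \<bar>L t \<omega> \<phi>\<bar> \<ge> 1 / 6} < 1 / 6" if "t \<in> {0..1}" "p \<phi> < 1" for t \<phi>
  proof -
    have "{\<omega> \<in> space M. \<bar>L t \<omega> \<phi> - L t \<omega> 0\<bar> \<ge> 1 / 6} = {\<omega> \<in> space M. \<bar>L t \<omega> \<phi>\<bar> \<ge> 1 / 6}"
      using lin[of t] that(1) by (auto simp: linear_0)
    thus ?thesis using small[of t \<phi>] that p(2) by auto
  qed
  show ?thesis
  proof (rule that[OF p(1)])
    fix I :: "'i set" and b i n assume I: "finite I" and i: "i < (n::nat)"
    define Y where "Y \<omega> = L (real (Suc i) / n) \<omega> - L (real i / n) \<omega>" for \<omega>
    have Ym: "random_variable borel (\<lambda>\<omega>. Y \<omega> \<phi>)" for \<phi>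
      unfolding Y_def by (simp, intro borel_measurable_diff Lpm) auto
    have Yl: "linear (Y \<omega>)" if "\<omega> \<in> space M" for \<omega>
    proof -
      have "linear (\<lambda>x. L (real (Suc i) / n) \<omega> x - L (real i / n) \<omega> x)"
        using that by (intro linear_compose_sub lin) auto
      thus ?thesis by (simp add: Y_def fun_diff_def)
    qed
    have intc: "integrable M (\<lambda>\<omega>. 1 - cos (Y \<omega> \<phi>))" for \<phi>
    proof (rule integrable_const_bound[where B=2])
      have "\<bar>1 - cos t\<bar> \<le> 2" for t :: real
        using cos_le_one[of t] cos_ge_minus_one[of t] by (simp only: abs_le_iff) linarith
      thus "AE \<omega> in M. norm (1 - cos (Y \<omega> \<phi>)) \<le> 2" by simp
      show "random_variable borel (\<lambda>\<omega>. 1 - cos (Y \<omega> \<phi>))" using Ym[of \<phi>] by measurable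
    qed
    have "real n * expectation (\<lambda>\<omega>. 1 - cos (Y \<omega> \<phi>)) \<le> 2 + 2 * (p \<phi>)\<^sup>2" for \<phi>
    proof -
      \<comment> \<open>A natural number, as \<open>one_minus_cos_mult_le\<close> requires, that
        exceeds \<open>p \<phi>\<close> strictly, so that \<open>\<phi> / k\<close> lies in the open
        unit ball, and is at most \<open>p \<phi> + 1\<close>.\<close>
      define k where "k = nat \<lfloor>p \<phi>\<rfloor> + 1"
      have k: "p \<phi> < k" "k \<le> p \<phi> + 1" "real k > 0"
        using hilbertian_nonneg[OF Q, of \<phi>] by (auto simp: k_def) linarith+
      define \<psi> where "\<psi> = (1 / k) *\<^sub>R \<phi>"
      have "p \<psi> < 1" using k by (simp add: \<psi>_def hilbertian_scaleR[OF Q])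
      hence 1: "real n * expectation (\<lambda>\<omega>. 1 - cos (Y \<omega> \<psi>)) \<le> 1"
        using levy_increment_char[OF T M L small' i, of \<psi>] by (simp add: Y_def)
      have "expectation (\<lambda>\<omega>. 1 - cos (Y \<omega> \<phi>)) \<le> expectation (\<lambda>\<omega>. (real k)\<^sup>2 * (1 - cos (Y \<omega> \<psi>)))"
      proof (rule integral_mono)
        fix \<omega> assume w: "\<omega> \<in> space M"
        have "\<phi> = real k *\<^sub>R \<psi>" using k(3) by (simp add: \<psi>_def)
        hence "Y \<omega> \<phi> = real k * Y \<omega> \<psi>" using linear_cmul[OF Yl[OF w], of "real k" \<psi>] by simp
        thus "1 - cos (Y \<omega> \<phi>) \<le> (real k)\<^sup>2 * (1 - cos (Y \<omega> \<psi>))" using one_minus_cos_mult_le by simp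
      qed (intro intc integrable_mult_right)+
      hence "real n * expectation (\<lambda>\<omega>. 1 - cos (Y \<omega> \<phi>)) \<le> real n * ((real k)\<^sup>2 * expectation (\<lambda>\<omega>. 1 - cos (Y \<omega> \<psi>)))"
        by (intro mult_left_mono) auto
      also have "\<dots> = (real k)\<^sup>2 * (real n * expectation (\<lambda>\<omega>. 1 - cos (Y \<omega> \<psi>)))" by simp
      also have "\<dots> \<le> (real k)\<^sup>2 * 1" by (intro mult_left_mono 1) auto
      also have "\<dots> \<le> (p \<phi> + 1)\<^sup>2" using k by simp
      also have "\<dots> \<le> 2 + 2 * (p \<phi>)\<^sup>2"
        using zero_le_power2[of "p \<phi> - 1"] by (simp add: power2_eq_square algebra_simps)
      finally show ?thesis .
    qed
    \<comment> \<open>At \<open>\<phi> = 0\<close> the cosine is 1, and the averaged integrand is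
      \<open>gauss_fun\<close>.\<close>
    hence ga: "real n * expectation (\<lambda>\<omega>. 1 - cos (Y \<omega> 0) * exp (- (\<Sum>j\<in>I. (Y \<omega> (b j))\<^sup>2) / 2))
        \<le> 2 + 2 * ((p 0)\<^sup>2 + (\<Sum>j\<in>I. (p (b j))\<^sup>2))"
      using Q Ym Yl I by (intro gaussian_average) auto
    have "expectation (\<lambda>\<omega>. 1 - cos (Y \<omega> 0) * exp (- (\<Sum>j\<in>I. (Y \<omega> (b j))\<^sup>2) / 2))
        = expectation (\<lambda>\<omega>. gauss_fun I b (Y \<omega>))"
      by (intro Bochner_Integration.integral_cong refl) (simp add: linear_0[OF Yl] gauss_fun_def)
    with ga show "real n * expectation (\<lambda>\<omega>. gauss_fun I b (L (real (Suc i) / n) \<omega> - L (real i / n) \<omega>))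
        \<le> 2 * (1 + (\<Sum>j\<in>I. (p (b j))\<^sup>2))"
      by (simp add: hilbertian_0[OF Q] Y_def)
  qed
qed

section \<open>Jumps of cadlag paths\<close>

lemma weaker_countably_hilbertianD:
  assumes "weaker_countably_hilbertian T r"
  shows "cont_hilbertian T (r n)" "hilbertian_seminorm (r n)" "r n x \<le> r (Suc n) x"
  using assms by (auto simp: weaker_countably_hilbertian_def cont_hilbertian_def)

lemma dual_weaker_le:
  assumes r: "weaker_countably_hilbertian T r" and f: "f \<in> dual (seminorm_topology (range r))"
  obtains n c where "c \<ge> 0" "\<And>x. \<bar>f x\<bar> \<le> c * r n x"
  by (rule dual_increasing_seminorms[OF weaker_countably_hilbertianD(2,3)[OF r] f]) blast

lemma dual_weaker_subset:
  assumes T: "nuclear_space T" and r: "weaker_countably_hilbertian T r"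
  shows "dual (seminorm_topology (range r)) \<subseteq> dual T"
proof
  fix f assume f: "f \<in> dual (seminorm_topology (range r))"
  then obtain n c where "c \<ge> 0" "\<And>x. \<bar>f x\<bar> \<le> c * r n x" using dual_weaker_le[OF r] by blast
  thus "f \<in> dual T"
    using f dual_if_le_cont_hilbertian[OF T cont_hilbertian_scale[OF weaker_countably_hilbertianD(1)[OF r]]]
    by (auto simp: dual_def)
qed

lemma extend_const [simp]: "extend f (\<lambda>_. x) = f x"
  by (simp add: extend_def)

text \<open>A bounded set of \<open>T\<close>, read as a set of constant sequences, is bounded in
  the completion; so uniform convergence on the bounded sets of the completion is the stronger
  notion.\<close>

lemma continuous_map_completion_strong_dual:
  assumes T: "nuclear_space T" and r: "weaker_countably_hilbertian T r"
  shows "continuous_map (completion_strong_dual r) (strong_dual T) (\<lambda>f. f)"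
  unfolding strong_dual_def uniform_conv_topology_def
proof (rule continuous_on_generated_topo)
  let ?X = "completion_strong_dual r" and ?D = "dual (seminorm_topology (range r))"
  have tX: "topspace ?X = ?D" by (simp add: completion_strong_dual_def)
  fix U assume U: "U \<in> insert (dual T) {{g \<in> dual T. \<exists>d<e. \<forall>x\<in>B. \<bar>g x - f x\<bar> \<le> d} | f B e.
        f \<in> dual T \<and> B \<in> {B. tvs_bounded T B} \<and> (e::real) > 0}"
  show "openin ?X ((\<lambda>f. f) -` U \<inter> topspace ?X)"
  proof (cases "U = dual T")
    case True
    hence "(\<lambda>f. f) -` U \<inter> topspace ?X = topspace ?X" using dual_weaker_subset[OF T r] tX by auto
    thus ?thesis by (simp only: openin_topspace)
  next
    case False
    then obtain f B e where B: "tvs_bounded T B" and U: "U = {g \<in> dual T. \<exists>d<e. \<forall>x\<in>B. \<bar>g x - f x\<bar> \<le> d}"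
      using U by auto
    define B' :: "(nat \<Rightarrow> 'a) set" where "B' = (\<lambda>x _. x) ` B"
    have B': "B' \<subseteq> cauchy_seqs (range r) \<and> (\<forall>n. \<exists>C. \<forall>x\<in>B'. extend (r n) x \<le> C)"
    proof (intro conjI allI)
      have "r n 0 = 0" for n
        using weaker_countably_hilbertianD(2)[OF r, of n] hilbertian_0 by (auto simp: hilbertian_seminorm_def)
      thus "B' \<subseteq> cauchy_seqs (range r)" by (auto simp: B'_def cauchy_seqs_def)
      fix n
      obtain C where "\<And>x. x \<in> B \<Longrightarrow> r n x \<le> C"
        using tvs_bounded_cont_hilbertian[OF nuclear_topspace[OF T] B weaker_countably_hilbertianD(1)[OF r, of n]]
        by blast
      thus "\<exists>C. \<forall>x\<in>B'. extend (r n) x \<le> C" by (auto simp: B'_def)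
    qed
    show ?thesis
    proof (subst openin_subopen, intro ballI)
      fix g0 assume "g0 \<in> (\<lambda>f. f) -` U \<inter> topspace ?X"
      hence g0: "g0 \<in> U" "g0 \<in> ?D" using tX by auto
      then obtain d where d: "d < e" "\<And>x. x \<in> B \<Longrightarrow> \<bar>g0 x - f x\<bar> \<le> d" using U by auto
      define W where "W = {g\<in>?D. \<exists>d'<e - d. \<forall>x\<in>B'. \<bar>extend g x - extend g0 x\<bar> \<le> d'}"
      have "openin ?X W"
        unfolding completion_strong_dual_def uniform_conv_topology_def W_def
        using g0(2) B' d(1) by (intro topology_generated_by_Basis) (auto intro!: exI[of _ g0] exI[of _ B'] exI[of _ "e - d"])
      moreover have "g0 \<in> W" using g0(2) d(1) by (auto simp: W_def intro!: exI[of _ 0])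
      moreover have "W \<subseteq> (\<lambda>f. f) -` U \<inter> topspace ?X"
      proof
        fix g assume g: "g \<in> W"
        then obtain d' where d': "d' < e - d" "\<And>x. x \<in> B \<Longrightarrow> \<bar>g x - g0 x\<bar> \<le> d'"
          by (auto simp: W_def B'_def)
        have "\<bar>g x - f x\<bar> \<le> d' + d" if "x \<in> B" for x
          using d(2)[OF that] d'(2)[OF that] by linarith
        moreover have "d' + d < e" using d'(1) by simp
        moreover have "g \<in> ?D" using g by (simp add: W_def)
        ultimately show "g \<in> (\<lambda>f. f) -` U \<inter> topspace ?X"
          using dual_weaker_subset[OF T r] tX unfolding U by blast
      qed
      ultimately show "\<exists>W. openin ?X W \<and> g0 \<in> W \<and> W \<subseteq> (\<lambda>f. f) -` U \<inter> topspace ?X" by blast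
    qed
  qed
qed (use dual_weaker_subset[OF T r] in \<open>auto simp: completion_strong_dual_def\<close>)

lemma limitin_completion_strong_dual:
  assumes T: "nuclear_space T" and r: "weaker_countably_hilbertian T r"
    and lim: "limitin (completion_strong_dual r) l y F"
  shows "limitin (strong_dual T) l y F" "((\<lambda>t. l t x) \<longlongrightarrow> y x) F"
    "y \<in> dual (seminorm_topology (range r))"
proof -
  show 1: "limitin (strong_dual T) l y F"
    using continuous_map_limit[OF continuous_map_completion_strong_dual[OF T r] lim] by (simp add: o_def)
  show "((\<lambda>t. l t x) \<longlongrightarrow> y x) F"
    using continuous_map_limit[OF continuous_map_strong_dual_eval[OF T, of x] 1] by (simp add: o_def)
  show "y \<in> dual (seminorm_topology (range r))"
    using limitin_topspace[OF lim] by (simp add: completion_strong_dual_def)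
qed

lemma cadlag_values:
  assumes "cadlag_in (completion_strong_dual r) l" "t \<ge> 0"
  shows "l t \<in> dual (seminorm_topology (range r))"
  using limitin_topspace[of "completion_strong_dual r" l "l t" "at_right t"] assms
  by (auto simp: cadlag_in_def completion_strong_dual_def)

lemma cadlag_right:
  assumes "nuclear_space T" "weaker_countably_hilbertian T r"
    and "cadlag_in (completion_strong_dual r) l" "t \<ge> 0"
  shows "((\<lambda>t. l t x) \<longlongrightarrow> l t x) (at_right t)"
  using assms(3,4) limitin_completion_strong_dual(2)[OF assms(1,2), of l "l t" "at_right t"]
  unfolding cadlag_in_def by blast

text \<open>The left limit exists in the strong dual of the completion. Since the strong dual of
  \<open>T\<close> is Hausdorff, the definite description in \<open>left_limit\<close> denotes that
  same functional, which therefore is continuous for the countably Hilbertian topology.\<close>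

lemma cadlag_jump:
  assumes T: "nuclear_space T" and r: "weaker_countably_hilbertian T r"
    and l: "cadlag_in (completion_strong_dual r) l" and s: "s > 0"
  obtains y where "y \<in> dual (seminorm_topology (range r))" "jump T l s = l s - y"
    "\<And>x. ((\<lambda>t. l t x) \<longlongrightarrow> y x) (at_left s)"
proof -
  obtain y where y: "limitin (completion_strong_dual r) l y (at_left s)"
    using l s by (auto simp: cadlag_in_def)
  note lim = limitin_completion_strong_dual[OF T r y]
  have "(THE y. limitin (strong_dual T) l y (at_left s)) = y"
  proof (rule the_equality)
    fix y' assume "limitin (strong_dual T) l y' (at_left s)"
    thus "y' = y"
      using limitin_Hausdorff_unique[OF _ lim(1)] Hausdorff_strong_dual[OF T]
      by (simp add: trivial_limit_at_left_real)
  qed (rule lim(1))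
  hence "jump T l s = l s - y" using s by (simp add: jump_def left_limit_def)
  thus ?thesis using that lim(2,3) by blast
qed

lemma jump_zero: "jump T l 0 = (\<lambda>_. 0)"
  by (simp add: jump_def left_limit_def fun_diff_def)

text \<open>Index \<open>i\<close> of the cell from \<open>i / n\<close> (excluded) to
  \<open>(i + 1) / n\<close> (included) that contains \<open>s\<close>. The ceiling puts a jump at a
  partition point at the right end of its cell, so that the increment over the cell contains the
  jump. The subtraction is exact for \<open>s > 0\<close>, \<open>n > 0\<close>.\<close>

definition cell :: "nat \<Rightarrow> real \<Rightarrow> nat" where
  "cell n s = nat \<lceil>s * n\<rceil> - 1"

lemma cell_bounds:
  assumes "0 < s" "s \<le> 1" "n > 0"
  shows "cell n s < n" "real (cell n s) / n < s" "s \<le> real (Suc (cell n s)) / n"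
    "real (Suc (cell n s)) / n - s < 1 / n" "s - real (cell n s) / n \<le> 1 / n"
proof -
  have pos: "0 < s * n" "s * n \<le> n" using assms by (auto simp: mult_left_le_one_le)
  hence c: "\<lceil>s * n\<rceil> \<ge> 1" "\<lceil>s * n\<rceil> \<le> n" by (simp_all add: ceiling_le_iff)
  hence S: "Suc (cell n s) = nat \<lceil>s * n\<rceil>" by (simp add: cell_def)
  hence rS: "real (Suc (cell n s)) = of_int \<lceil>s * n\<rceil>" using c by simp
  show "cell n s < n" using S c by linarith
  have b: "s * n \<le> real (Suc (cell n s))" "real (Suc (cell n s)) < s * n + 1" unfolding rS by linarith+
  show 1: "s \<le> real (Suc (cell n s)) / n" using b(1) assms(3) by (simp add: pos_le_divide_eq)
  have 2: "real (Suc (cell n s)) / n < s + 1 / n" using b(2) assms(3) by (simp add: field_simps)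
  have 3: "real (Suc (cell n s)) / n = real (cell n s) / n + 1 / n" by (simp add: add_divide_distrib)
  show "real (cell n s) / n < s" "real (Suc (cell n s)) / n - s < 1 / n" "s - real (cell n s) / n \<le> 1 / n"
    using 1 2 3 by linarith+
qed

lemma cell_endpoints_tendsto:
  assumes "0 < s" "s \<le> 1"
  shows "(\<lambda>n. real (Suc (cell n s)) / n) \<longlonglongrightarrow> s" "(\<lambda>n. real (cell n s) / n) \<longlonglongrightarrow> s"
proof -
  have ev: "eventually (\<lambda>n::nat. n > 0) sequentially" by (rule eventually_gt_at_top)
  have inv: "(\<lambda>n. 1 / real n) \<longlonglongrightarrow> 0" by real_asymp
  show "(\<lambda>n. real (Suc (cell n s)) / n) \<longlonglongrightarrow> s"
  proof (rule LIM_zero_cancel, rule Lim_null_comparison[OF _ inv])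
    show "eventually (\<lambda>n. norm (real (Suc (cell n s)) / n - s) \<le> 1 / real n) sequentially"
      using ev
    proof eventually_elim
      case (elim n)
      show ?case using cell_bounds(3,4)[OF assms elim] by (simp only: real_norm_def abs_le_iff) linarith
    qed
  qed
  show "(\<lambda>n. real (cell n s) / n) \<longlonglongrightarrow> s"
  proof (rule LIM_zero_cancel, rule Lim_null_comparison[OF _ inv])
    show "eventually (\<lambda>n. norm (real (cell n s) / n - s) \<le> 1 / real n) sequentially"
      using ev
    proof eventually_elim
      case (elim n)
      show ?case using cell_bounds(2,5)[OF assms elim] by (simp only: real_norm_def abs_le_iff) linarith
    qed
  qed
qed

text \<open>\<open>gauss_fun\<close> sees only the finitely many values at \<open>b j\<close>, so
  pointwise limits suffice: the left ends approach \<open>s\<close> strictly from below, the right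
  ends from above or at \<open>s\<close> itself.\<close>

lemma gauss_fun_increment_tendsto:
  assumes T: "nuclear_space T" and r: "weaker_countably_hilbertian T r"
    and l: "cadlag_in (completion_strong_dual r) l" and s: "0 < s" "s \<le> 1"
  shows "(\<lambda>n. gauss_fun I b (l (real (Suc (cell n s)) / n) - l (real (cell n s) / n)))
    \<longlonglongrightarrow> gauss_fun I b (jump T l s)"
proof -
  obtain y where y: "jump T l s = l s - y" "\<And>x. ((\<lambda>t. l t x) \<longlongrightarrow> y x) (at_left s)"
    using cadlag_jump[OF T r l s(1)] by metis
  have ev: "eventually (\<lambda>n::nat. n > 0) sequentially" by (rule eventually_gt_at_top)
  have "filterlim (\<lambda>n. real (cell n s) / n) (at_left s) sequentially"
    unfolding filterlim_at
  proof (intro conjI cell_endpoints_tendsto s)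
    show "eventually (\<lambda>n. real (cell n s) / n \<in> {..<s} \<and> real (cell n s) / n \<noteq> s) sequentially"
      using ev
    proof eventually_elim
      case (elim n)
      show ?case using cell_bounds(2)[OF s elim] by simp
    qed
  qed
  hence left: "(\<lambda>n. l (real (cell n s) / n) x) \<longlonglongrightarrow> y x" for x
    using filterlim_compose[OF y(2)] by blast
  have right: "(\<lambda>n. l (real (Suc (cell n s)) / n) x) \<longlonglongrightarrow> l s x" for x
  proof (rule tendstoI)
    fix e :: real assume e: "e > 0"
    have "eventually (\<lambda>t. dist (l t x) (l s x) < e) (at_right s)"
      using cadlag_right[OF T r l, of s x] s e by (intro tendstoD) auto
    then obtain c where c: "c > s" "\<And>t. t > s \<Longrightarrow> t < c \<Longrightarrow> dist (l t x) (l s x) < e"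
      by (auto simp: eventually_at_right_field)
    have "eventually (\<lambda>n. real (Suc (cell n s)) / n < c) sequentially"
      by (rule order_tendstoD(2)[OF cell_endpoints_tendsto(1)[OF s] c(1)])
    thus "eventually (\<lambda>n. dist (l (real (Suc (cell n s)) / n) x) (l s x) < e) sequentially"
      using ev
    proof eventually_elim
      case (elim n)
      \<comment> \<open>The right limit at \<open>s\<close> says nothing about \<open>s\<close>
        itself, which occurs as an endpoint when \<open>s * n\<close> is an integer.\<close>
      from cell_bounds(3)[OF s elim(2)] consider "real (Suc (cell n s)) / n = s" | "real (Suc (cell n s)) / n > s"
        by linarith
      thus ?case using e c(2) elim(1) by cases auto
    qed
  qed
  show ?thesis unfolding gauss_fun_def y(1) fun_diff_def
    by (intro tendsto_intros left right) simp
qed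

text \<open>Distinct jump times eventually lie in distinct cells of the partition of \<open>{0<..1}\<close>.\<close>

lemma jump_sum_le_liminf:
  assumes T: "nuclear_space T" and r: "weaker_countably_hilbertian T r"
    and l: "cadlag_in (completion_strong_dual r) l" and S: "finite S" "S \<subseteq> {0<..1}"
  shows "ennreal (\<Sum>s\<in>S. gauss_fun I b (jump T l s))
    \<le> liminf (\<lambda>n. ennreal (\<Sum>i<n. gauss_fun I b (l (real (Suc i) / n) - l (real i / n))))"
proof -
  define h where "h n i = gauss_fun I b (l (real (Suc i) / real n) - l (real i / real n))" for n i
  have "(\<lambda>n. ennreal (\<Sum>s\<in>S. h n (cell n s))) \<longlonglongrightarrow> ennreal (\<Sum>s\<in>S. gauss_fun I b (jump T l s))"
    unfolding h_def using S
    by (intro tendsto_ennrealI tendsto_sum gauss_fun_increment_tendsto[OF T r l]) auto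
  hence "ennreal (\<Sum>s\<in>S. gauss_fun I b (jump T l s)) = liminf (\<lambda>n. ennreal (\<Sum>s\<in>S. h n (cell n s)))"
    by (simp add: lim_imp_Liminf)
  also have "\<dots> \<le> liminf (\<lambda>n. ennreal (\<Sum>i<n. h n i))"
  proof (rule Liminf_mono)
    have "eventually (\<lambda>n. \<forall>s\<in>S. \<forall>s'\<in>S. s \<noteq> s' \<longrightarrow> 1 / real n < \<bar>s - s'\<bar>) sequentially"
    proof (intro eventually_ball_finite ballI S(1))
      fix s s' :: real
      have inv: "(\<lambda>n. 1 / real n) \<longlonglongrightarrow> 0" by real_asymp
      show "eventually (\<lambda>n. s \<noteq> s' \<longrightarrow> 1 / real n < \<bar>s - s'\<bar>) sequentially"
      proof (cases "s = s'")
        case False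
        thus ?thesis using order_tendstoD(2)[OF inv, of "\<bar>s - s'\<bar>"] by simp
      qed simp
    qed
    moreover have "eventually (\<lambda>n::nat. n > 0) sequentially" by (rule eventually_gt_at_top)
    ultimately show "eventually (\<lambda>n. ennreal (\<Sum>s\<in>S. h n (cell n s)) \<le> ennreal (\<Sum>i<n. h n i)) sequentially"
    proof eventually_elim
      case (elim n)
      have "inj_on (cell n) S"
      proof (rule inj_onI, rule ccontr)
        fix s s' assume ss: "s \<in> S" "s' \<in> S" "cell n s = cell n s'" "s \<noteq> s'"
        have "0 < s" "s \<le> 1" "0 < s'" "s' \<le> 1" using ss S(2) by auto
        from cell_bounds(2,3)[OF this(1,2) elim(2)] cell_bounds(2,3)[OF this(3,4) elim(2), folded ss(3)]
        have "\<bar>s - s'\<bar> \<le> real (Suc (cell n s)) / n - real (cell n s) / n" by linarith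
        also have "\<dots> = 1 / n" by (simp add: diff_divide_distrib[symmetric])
        finally show False using elim(1) ss by force
      qed
      hence "(\<Sum>s\<in>S. h n (cell n s)) = (\<Sum>i\<in>cell n ` S. h n i)" by (simp add: sum.reindex)
      also have "\<dots> \<le> (\<Sum>i<n. h n i)"
      proof (rule sum_mono2)
        show "cell n ` S \<subseteq> {..<n}" using cell_bounds(1)[OF _ _ elim(2)] S(2) by auto
      qed (simp_all add: h_def gauss_fun_bounds)
      finally show ?case by (rule ennreal_leI)
    qed
  qed
  finally show ?thesis by (simp add: h_def)
qed

text \<open>The value and the left limit are each bounded by a multiple of some \<open>r n\<close>.
  Taking \<open>m\<close> above both indices and above the sum of both constants, a single sequence
  of polars captures the jumps of all paths.\<close>

lemma jump_in_polar:
  assumes T: "nuclear_space T" and r: "weaker_countably_hilbertian T r"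
    and l: "cadlag_in (completion_strong_dual r) l" and s: "s \<ge> 0"
  shows "jump T l s \<in> (\<Union>m. polar (\<lambda>x. real m * r m x))"
proof -
  have mono: "r i x \<le> r j x" if "i \<le> j" for i j x
    using lift_Suc_mono_le[of "\<lambda>n. r n x" i j] weaker_countably_hilbertianD(3)[OF r] that by simp
  have nn: "0 \<le> r i x" for i x
    using weaker_countably_hilbertianD(2)[OF r, of i] hilbertian_nonneg by (auto simp: hilbertian_seminorm_def)
  have "\<exists>y. y \<in> dual (seminorm_topology (range r)) \<and> jump T l s = l s - y"
  proof (cases "s = 0")
    case True
    have "l 0 \<in> dual (seminorm_topology (range r))" by (rule cadlag_values[OF l]) simp
    thus ?thesis using True by (auto simp: jump_def left_limit_def)
  next
    case False
    hence s0: "s > 0" using s by simp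
    show ?thesis by (rule cadlag_jump[OF T r l s0]) blast
  qed
  then obtain y where y: "y \<in> dual (seminorm_topology (range r))" "jump T l s = l s - y" by blast
  obtain n1 c1 where 1: "c1 \<ge> 0" "\<And>x. \<bar>l s x\<bar> \<le> c1 * r n1 x"
    by (rule dual_weaker_le[OF r cadlag_values[OF l s]]) (rule that)
  obtain n2 c2 where 2: "c2 \<ge> 0" "\<And>x. \<bar>y x\<bar> \<le> c2 * r n2 x"
    by (rule dual_weaker_le[OF r y(1)]) (rule that)
  obtain m0 :: nat where m0: "c1 + c2 \<le> real m0" using real_arch_simple by blast
  define m where "m = max m0 (max n1 n2)"
  have "\<bar>l s x - y x\<bar> \<le> real m * r m x" for x
  proof -
    have "c1 * r n1 x \<le> c1 * r m x" "c2 * r n2 x \<le> c2 * r m x"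
      using 1(1) 2(1) by (auto intro!: mult_left_mono mono simp: m_def)
    hence "\<bar>l s x - y x\<bar> \<le> (c1 + c2) * r m x"
      using 1(2)[of x] 2(2)[of x] by (simp add: distrib_right)
    also have "\<dots> \<le> real m * r m x" using m0 nn by (intro mult_right_mono) (auto simp: m_def)
    finally show ?thesis .
  qed
  moreover have "linear (\<lambda>x. l s x - y x)"
    using cadlag_values[OF l s] y(1) by (intro linear_compose_sub) (auto simp: dual_def)
  ultimately have "jump T l s \<in> polar (\<lambda>x. real m * r m x)"
    by (simp add: y(2) polar_def fun_diff_def)
  thus ?thesis by blast
qed

section \<open>The jump intensity\<close>

text \<open>The integral of a non-measurable function, as a jump count may be, is its lower integral.\<close>

lemma nn_integral_measurable_minorant:
  obtains g where "g \<in> borel_measurable M" "\<And>x. g x \<le> f x" "integral\<^sup>N M g = integral\<^sup>N M f"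
proof -
  let ?S = "{g. simple_function M g \<and> g \<le> f}"
  have "(\<lambda>_. 0) \<in> ?S" by (simp add: le_fun_def)
  hence "integral\<^sup>S M ` ?S \<noteq> {}" by blast
  \<comment> \<open>Countably many simple functions already approach the supremum that defines the
    integral; their pointwise supremum is the measurable minorant.\<close>
  from ennreal_Sup_countable_SUP[OF this] obtain u where
    "incseq u \<and> range u \<subseteq> integral\<^sup>S M ` ?S \<and> (SUP g\<in>?S. integral\<^sup>S M g) = (SUP i. u i)" by blast
  hence u: "range u \<subseteq> integral\<^sup>S M ` ?S" "(SUP g\<in>?S. integral\<^sup>S M g) = (SUP i. u i)" by blast+
  have "\<forall>i. \<exists>g\<in>?S. u i = integral\<^sup>S M g" using u(1) by blast
  then obtain g where g: "\<And>i. g i \<in> ?S" "\<And>i. u i = integral\<^sup>S M (g i)" by metis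
  have gm: "g i \<in> borel_measurable M" for i using g(1)[of i] by (auto intro: borel_measurable_simple_function)
  define G where "G x = (SUP i. g i x)" for x
  show ?thesis
  proof (rule that)
    show "G \<in> borel_measurable M" unfolding G_def[abs_def] using gm by measurable
    show le: "G x \<le> f x" for x
      unfolding G_def using g(1) by (intro SUP_least) (auto simp: le_fun_def)
    show "integral\<^sup>N M G = integral\<^sup>N M f"
    proof (rule antisym)
      show "integral\<^sup>N M G \<le> integral\<^sup>N M f" by (intro nn_integral_mono le)
      have "integral\<^sup>N M f = (SUP i. u i)" unfolding nn_integral_def u(2) ..
      also have "\<dots> \<le> integral\<^sup>N M G"
      proof (rule SUP_least)
        fix i
        have "u i = integral\<^sup>N M (g i)"
          using g[of i] by (simp add: nn_integral_eq_simple_integral)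
        also have "\<dots> \<le> integral\<^sup>N M G"
          unfolding G_def by (intro nn_integral_mono SUP_upper) auto
        finally show "u i \<le> integral\<^sup>N M G" .
      qed
      finally show "integral\<^sup>N M f \<le> integral\<^sup>N M G" .
    qed
  qed
qed

text \<open>Superadditivity of lower integrals: each \<open>f y\<close> is replaced by a measurable
  minorant with the same integral, and for these the sum and the integral commute.\<close>

lemma sum_cmult_nn_integral_le:
  fixes c :: "'i \<Rightarrow> ennreal"
  assumes "finite Y"
  shows "(\<Sum>y\<in>Y. c y * integral\<^sup>N M (f y)) \<le> (\<integral>\<^sup>+x. (\<Sum>y\<in>Y. c y * f y x) \<partial>M)"
proof -
  have "\<forall>y. \<exists>g. g \<in> borel_measurable M \<and> (\<forall>x. g x \<le> f y x) \<and> integral\<^sup>N M g = integral\<^sup>N M (f y)"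
    using nn_integral_measurable_minorant by metis
  then obtain g where g: "\<And>y. g y \<in> borel_measurable M" "\<And>y x. g y x \<le> f y x"
    "\<And>y. integral\<^sup>N M (g y) = integral\<^sup>N M (f y)" by metis
  have "(\<Sum>y\<in>Y. c y * integral\<^sup>N M (f y)) = (\<integral>\<^sup>+x. (\<Sum>y\<in>Y. c y * g y x) \<partial>M)"
    using g(1) by (simp add: nn_integral_sum nn_integral_cmult g(3))
  also have "\<dots> \<le> (\<integral>\<^sup>+x. (\<Sum>y\<in>Y. c y * f y x) \<partial>M)"
    by (intro nn_integral_mono sum_mono mult_left_mono g(2)) auto
  finally show ?thesis .
qed

text \<open>The sets \<open>A y\<close> may be infinite a priori. If \<open>R\<close> is finite, an
  infinite \<open>A y\<close> would contain finite subsets with more than \<open>R / c y\<close>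
  points, contradicting the bound; so all are finite, and their union is an admissible
  \<open>S\<close>.\<close>

lemma weighted_count_le:
  fixes c :: "'y \<Rightarrow> real" and k :: "'s \<Rightarrow> real"
  assumes Y: "finite Y" and c: "\<And>y. y \<in> Y \<Longrightarrow> c y > 0"
    and disj: "disjoint_family_on A Y" and k: "\<And>y s. y \<in> Y \<Longrightarrow> s \<in> A y \<Longrightarrow> c y \<le> k s"
    and R: "\<And>S. finite S \<Longrightarrow> S \<subseteq> (\<Union>y\<in>Y. A y) \<Longrightarrow> ennreal (\<Sum>s\<in>S. k s) \<le> R"
  shows "(\<Sum>y\<in>Y. ennreal (c y) * emeasure (count_space UNIV) (A y)) \<le> R"
proof (cases R)
  case (real R')
  have fin: "finite (A y)" if y: "y \<in> Y" for y
  proof (rule ccontr)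
    assume "infinite (A y)"
    obtain m :: nat where m: "real m > R' / c y" using reals_Archimedean2 by blast
    obtain S where S: "finite S" "card S = m" "S \<subseteq> A y"
      using infinite_arbitrarily_large[OF \<open>infinite (A y)\<close>] by blast
    have "real m * c y \<le> (\<Sum>s\<in>S. k s)"
      using sum_mono[of S "\<lambda>_. c y" k] k[OF y] S by auto
    also have "(\<Sum>s\<in>S. k s) \<le> R'"
      using R[of S] S y real by (auto simp: ennreal_le_iff2)
    finally show False using m c[OF y] by (simp add: field_simps)
  qed
  have "(\<Sum>y\<in>Y. ennreal (c y) * emeasure (count_space UNIV) (A y)) = (\<Sum>y\<in>Y. ennreal (c y * card (A y)))"
  proof (intro sum.cong refl)
    fix y assume y: "y \<in> Y"
    have "emeasure (count_space UNIV) (A y) = ennreal (real (card (A y)))"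
      using fin[OF y] by (simp add: ennreal_of_nat_eq_real_of_nat)
    thus "ennreal (c y) * emeasure (count_space UNIV) (A y) = ennreal (c y * card (A y))"
      using c[OF y] by (simp add: ennreal_mult)
  qed
  also have "\<dots> = ennreal (\<Sum>y\<in>Y. c y * card (A y))"
    using c by (intro sum_ennreal) (simp add: less_imp_le)
  also have "\<dots> \<le> ennreal (\<Sum>s\<in>(\<Union>y\<in>Y. A y). k s)"
  proof (rule ennreal_leI)
    have "(\<Sum>y\<in>Y. c y * card (A y)) = (\<Sum>y\<in>Y. \<Sum>s\<in>A y. c y)" by (simp add: mult.commute)
    also have "\<dots> \<le> (\<Sum>y\<in>Y. \<Sum>s\<in>A y. k s)" by (intro sum_mono k)
    also have "\<dots> = (\<Sum>s\<in>(\<Union>y\<in>Y. A y). k s)"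
      using Y fin disj by (intro sum.UNION_disjoint[symmetric]) (auto simp: disjoint_family_on_def)
    finally show "(\<Sum>y\<in>Y. c y * card (A y)) \<le> (\<Sum>s\<in>(\<Union>y\<in>Y. A y). k s)" .
  qed
  also have "\<dots> \<le> R" using Y fin by (intro R) auto
  finally show ?thesis .
qed simp

text \<open>From \<open>exp (- y / 2) \<le> 1 / (1 + y / 2)\<close> the right side is at least
  \<open>3 * y / (2 + y)\<close>, which is at least \<open>y\<close> for
  \<open>0 \<le> y \<le> 1\<close> and at least 1 beyond.\<close>

lemma min_le_gauss_fun: "min 1 (\<Sum>j\<in>I. (f (b j))\<^sup>2) \<le> 3 * gauss_fun I b f"
proof -
  define y where "y = (\<Sum>j\<in>I. (f (b j))\<^sup>2)"
  have y: "y \<ge> 0" unfolding y_def by (intro sum_nonneg) auto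
  have "exp (- y / 2) = 1 / exp (y / 2)" by (simp add: exp_minus field_simps)
  also have "\<dots> \<le> 1 / (1 + y / 2)"
    using y exp_ge_add_one_self[of "y / 2"] by (intro divide_left_mono) auto
  finally have "3 * (1 - 1 / (1 + y / 2)) \<le> 3 * gauss_fun I b f"
    by (simp add: gauss_fun_def y_def)
  moreover have "min 1 y \<le> 3 * (1 - 1 / (1 + y / 2))"
  proof (cases "y \<le> 1")
    case True
    have "y * y \<le> y * 1" using True y by (intro mult_left_mono)
    thus ?thesis using True y by (simp add: field_simps)
  next
    case False
    thus ?thesis by (simp add: field_simps)
  qed
  ultimately show ?thesis by (simp add: y_def)
qed

lemma dual_ball_eq_polar:
  assumes T: "nuclear_space T" and s: "cont_hilbertian T s"
  shows "dual_ball T s = polar s"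
proof -
  obtain S where S: "hilbertian_form s S" using s by (elim cont_hilbertianE)
  have "\<bar>f x\<bar> \<le> s x" if f: "linear f" and u: "\<And>x. s x \<le> 1 \<Longrightarrow> \<bar>f x\<bar> \<le> 1" for f x
  proof (rule field_le_epsilon)
    fix e :: real assume e: "e > 0"
    define t where "t = s x + e"
    have t: "t > 0" "s x < t" using hilbertian_nonneg[OF S, of x] e by (auto simp: t_def)
    have "\<bar>f ((1 / t) *\<^sub>R x)\<bar> \<le> 1" using t by (intro u) (simp add: hilbertian_scaleR[OF S])
    thus "\<bar>f x\<bar> \<le> s x + e" using t by (simp add: linear_cmul[OF f] abs_mult t_def)
  qed
  moreover have "dual_seminorm s f \<le> 1 \<longleftrightarrow> (\<forall>x. s x \<le> 1 \<longrightarrow> \<bar>f x\<bar> \<le> 1)" for f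
    by (auto simp: dual_seminorm_def SUP_le_iff)
  moreover have "\<bar>f x\<bar> \<le> 1" if "\<And>x. \<bar>f x\<bar> \<le> s x" "s x \<le> 1" for f x
    using that by (rule order_trans)
  moreover have "linear f" if "f \<in> dual T" for f using that by (simp add: dual_def)
  ultimately show ?thesis
    using dual_if_le_cont_hilbertian[OF T s] unfolding dual_ball_def polar_def by blast
qed

text \<open>On a functional bounded by some \<open>r k\<close> the dual seminorm is determined by its values on a
  set that is dense for \<open>r k\<close> and \<open>s\<close>.\<close>

lemma dual_seminorm_le_liminf:
  fixes f :: "'a::real_vector \<Rightarrow> real"
  assumes hs: "hilbertian_form s S" and f: "linear f" and le: "\<And>x. \<bar>f x\<bar> \<le> k * r x" and k: "k \<ge> 0"
    and dense: "\<And>x \<epsilon>. \<epsilon> > 0 \<Longrightarrow> \<exists>i::nat. r (x - d i) < \<epsilon> \<and> s (x - d i) < \<epsilon>"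
    and dom: "\<And>m i. i \<le> m \<Longrightarrow> (f (d i))\<^sup>2 \<le> ((s (d i))\<^sup>2 + 1 / (real m + 1)) * R m"
  shows "min 1 ((dual_seminorm s f)\<^sup>2) \<le> liminf (\<lambda>m. ennreal (min 1 (R m)))"
  unfolding le_Liminf_iff
proof (intro allI impI)
  fix y assume y: "y < min 1 ((dual_seminorm s f)\<^sup>2)"
  then obtain y' where y': "y = ennreal y'" "y' \<ge> 0" by (cases y) auto
  have y1: "y' < 1" using y y' by simp
  define a where "a = sqrt y'"
  have a: "a \<ge> 0" "y' = a\<^sup>2" using y' by (auto simp: a_def)
  have "ennreal a < dual_seminorm s f"
  proof (rule ccontr)
    assume "\<not> ennreal a < dual_seminorm s f"
    hence "(dual_seminorm s f)\<^sup>2 \<le> (ennreal a)\<^sup>2" by (intro power_mono) auto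
    also have "\<dots> = y" using a y' by (simp add: ennreal_power)
    finally show False using y by (auto dest: leD)
  qed
  then obtain x where x: "s x \<le> 1" "a < \<bar>f x\<bar>"
    using a by (auto simp: dual_seminorm_def less_SUP_iff ennreal_less_iff)
  \<comment> \<open>Passing from \<open>x\<close> to \<open>d i\<close> lowers
    \<open>\<bar>f\<bar>\<close> by at most \<open>k * \<eta>\<close> and raises \<open>s\<close> by
    at most \<open>\<eta>\<close>. This choice keeps \<open>\<bar>f (d i)\<bar>\<close> above
    \<open>a * (1 + \<eta>)\<close>, with the added 1 in the denominator giving strictness.\<close>
  define \<eta> where "\<eta> = (\<bar>f x\<bar> - a) / (k + a + 1)"
  have \<eta>: "\<eta> > 0" using x a k by (simp add: \<eta>_def)
  have "\<eta> * (k + a + 1) = \<bar>f x\<bar> - a" using a k by (simp add: \<eta>_def)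
  hence \<eta>': "a * (1 + \<eta>) < \<bar>f x\<bar> - k * \<eta>" using \<eta> by (simp add: algebra_simps)
  obtain i where i: "r (x - d i) < \<eta>" "s (x - d i) < \<eta>" using dense[OF \<eta>] by blast
  have "\<bar>f x - f (d i)\<bar> \<le> k * r (x - d i)" using le[of "x - d i"] by (simp add: linear_diff[OF f])
  also have "\<dots> \<le> k * \<eta>" using i(1) k by (intro mult_left_mono) auto
  finally have fd: "a * (1 + \<eta>) < \<bar>f (d i)\<bar>" using \<eta>' by linarith
  have "s (d i) \<le> 1 + \<eta>"
    using hilbertian_triangle_diff[OF hs, of x "d i"] i(2) x(1) by linarith
  hence "a * s (d i) \<le> a * (1 + \<eta>)" using a by (intro mult_left_mono)
  hence "a * s (d i) < \<bar>f (d i)\<bar>" using fd by linarith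
  hence "(a * s (d i))\<^sup>2 < \<bar>f (d i)\<bar>\<^sup>2"
    using a hilbertian_nonneg[OF hs] by (intro power_strict_mono) auto
  hence lt: "y' * (s (d i))\<^sup>2 < (f (d i))\<^sup>2" using a by (simp add: power_mult_distrib)
  \<comment> \<open>The inequality \<open>lt\<close> is strict, so it survives the perturbation
    \<open>1 / (m + 1)\<close> for large \<open>m\<close>; comparison with \<open>dom\<close> then
    cancels the common factor and leaves \<open>y' < R m\<close>.\<close>
  have "(\<lambda>m. y' * ((s (d i))\<^sup>2 + 1 / (real m + 1))) \<longlonglongrightarrow> y' * ((s (d i))\<^sup>2 + 0)"
    by (intro tendsto_intros) real_asymp
  hence "eventually (\<lambda>m. y' * ((s (d i))\<^sup>2 + 1 / (real m + 1)) < (f (d i))\<^sup>2) sequentially"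
    using lt by (intro order_tendstoD(2)) auto
  thus "eventually (\<lambda>m. y < ennreal (min 1 (R m))) sequentially"
    using eventually_ge_at_top[of i]
  proof eventually_elim
    case (elim m)
    have "y' * ((s (d i))\<^sup>2 + 1 / (real m + 1)) < R m * ((s (d i))\<^sup>2 + 1 / (real m + 1))"
      using elim(1) dom[OF elim(2)] by (simp add: mult.commute)
    moreover have "(s (d i))\<^sup>2 + 1 / (real m + 1) > 0" by (intro add_nonneg_pos) auto
    ultimately have "y' < R m" by simp
    thus ?case using y1 y' by (simp add: ennreal_less_iff)
  qed
qed

lemma emeasure_restrict_to:
  assumes "A \<in> sets m" "\<Gamma> \<in> sets m"
  shows "emeasure (restrict_to m A) \<Gamma> = emeasure m (\<Gamma> \<inter> A)"
proof -
  have "emeasure (restrict_to m A) \<Gamma> = (\<integral>\<^sup>+x. indicator A x * indicator \<Gamma> x \<partial>m)"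
    unfolding restrict_to_def using assms by (intro emeasure_density) auto
  also have "\<dots> = (\<integral>\<^sup>+x. indicator (\<Gamma> \<inter> A) x \<partial>m)"
    by (intro nn_integral_cong) (auto simp: indicator_def)
  finally show ?thesis using assms by simp
qed

lemma bounded_radon_restrict_to:
  assumes T: "nuclear_space T" and p: "\<And>n::nat. cont_hilbertian T (p n)"
    and mono: "\<And>n x. p n x \<le> p (Suc n) x"
    and m: "sets m = sets (borel_of (strong_dual T))"
    and null: "emeasure m (dual T - (\<Union>n. polar (p n))) = 0"
    and A: "A \<in> sets m" "emeasure m A < \<infinity>"
  shows "bounded_radon_measure (strong_dual T) (restrict_to m A)"
  unfolding bounded_radon_measure_def
proof (intro conjI)
  have sp: "space m = dual T" using sets_eq_imp_space_eq[OF m] by simp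
  have s: "sets (restrict_to m A) = sets m" "space (restrict_to m A) = space m"
    by (simp_all add: restrict_to_def)
  show fin: "finite_measure (restrict_to m A)"
  proof (rule finite_measureI)
    have "space m \<inter> A = A" using sets.sets_into_space[OF A(1)] by auto
    thus "emeasure (restrict_to m A) (space (restrict_to m A)) \<noteq> \<infinity>"
      using A by (simp add: s emeasure_restrict_to)
  qed
  have "polar (p n) \<in> sets m" for n
    unfolding m by (intro borel_of_closed compactin_imp_closedin Hausdorff_strong_dual compactin_polar T p)
  hence D: "dual T - (\<Union>n. polar (p n)) \<in> sets m" unfolding sp[symmetric] by auto
  hence "emeasure (restrict_to m A) (dual T - (\<Union>n. polar (p n))) \<le> emeasure m (dual T - (\<Union>n. polar (p n)))"
    using A by (simp add: emeasure_restrict_to emeasure_mono)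
  thus "radon_measure (strong_dual T) (restrict_to m A)"
    using null m by (intro radon_if_concentrated_on_polars[where p = p, OF T p mono fin]) (simp_all add: s)
qed

section \<open>The truncated second moment of the jump intensity and the Levy property\<close>

locale levy_jump_intensity =
  fixes \<Phi> :: "'a::real_vector topology" and M :: "'w measure"
    and L :: "real \<Rightarrow> 'w \<Rightarrow> 'a \<Rightarrow> real" and \<nu> :: "('a \<Rightarrow> real) measure" and r :: "nat \<Rightarrow> 'a \<Rightarrow> real"
  assumes nuclear: "nuclear_space \<Phi>" and prob: "prob_space M" and levy: "levy_process M \<Phi> L"
    and equicont: "equicontinuous_in_prob M \<Phi> L {0..1}"
    and r: "weaker_countably_hilbertian \<Phi> r"
    and cadlag: "AE \<omega> in M. cadlag_in (completion_strong_dual r) (\<lambda>t. L t \<omega>)"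
    and sets_nu: "sets \<nu> = sets (borel_of (strong_dual \<Phi>))"
    and intensity: "\<And>\<Gamma>. \<Gamma> \<in> sets \<nu> \<Longrightarrow> (\<lambda>_. 0) \<notin> \<Gamma> \<Longrightarrow>
      (\<integral>\<^sup>+\<omega>. jump_count \<Phi> (\<lambda>s. L s \<omega>) 1 \<Gamma> \<partial>M) = emeasure \<nu> \<Gamma>"
begin

lemma space_nu: "space \<nu> = dual \<Phi>"
  using sets_eq_imp_space_eq[OF sets_nu] by simp

text \<open>The factor \<open>m\<close> absorbs multiplicative constants: a functional bounded by a
  multiple of some \<open>r n\<close> lies in all but finitely many of the polars.\<close>

definition exhausting :: "nat \<Rightarrow> 'a \<Rightarrow> real" where
  "exhausting m x = real m * r m x"

lemma exhausting_cont: "cont_hilbertian \<Phi> (exhausting m)"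
  unfolding exhausting_def[abs_def]
  using cont_hilbertian_scale[OF weaker_countably_hilbertianD(1)[OF r]] by simp

lemma exhausting_mono: "exhausting m x \<le> exhausting (Suc m) x"
proof -
  have "0 \<le> r m x"
    using weaker_countably_hilbertianD(2)[OF r, of m] hilbertian_nonneg by (auto simp: hilbertian_seminorm_def)
  thus ?thesis unfolding exhausting_def using weaker_countably_hilbertianD(3)[OF r, of m x]
    by (intro mult_mono) auto
qed

lemma polar_sets: "cont_hilbertian \<Phi> p \<Longrightarrow> polar p \<in> sets \<nu>"
  unfolding sets_nu
  by (intro borel_of_closed compactin_imp_closedin Hausdorff_strong_dual compactin_polar nuclear)

text \<open>Almost every path has no jump in the complement, so the jump count there integrates to
  0. The intensity identity applies because the zero functional lies in the polar of
  \<open>exhausting 0\<close>.\<close>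

lemma concentrated: "emeasure \<nu> (dual \<Phi> - (\<Union>m. polar (exhausting m))) = 0"
proof -
  let ?\<Gamma> = "dual \<Phi> - (\<Union>m. polar (exhausting m))"
  have "?\<Gamma> \<in> sets \<nu>" unfolding space_nu[symmetric] using polar_sets[OF exhausting_cont] by auto
  moreover have "(\<lambda>_. 0) \<in> polar (exhausting 0)" by (simp add: polar_def exhausting_def linear_iff)
  hence "(\<lambda>_. 0) \<notin> ?\<Gamma>" by blast
  ultimately have "emeasure \<nu> ?\<Gamma> = (\<integral>\<^sup>+\<omega>. jump_count \<Phi> (\<lambda>s. L s \<omega>) 1 ?\<Gamma> \<partial>M)"
    by (rule intensity[symmetric])
  also have "\<dots> \<le> (\<integral>\<^sup>+\<omega>. 0 \<partial>M)"
  proof (rule nn_integral_mono_AE)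
    show "AE \<omega> in M. jump_count \<Phi> (\<lambda>s. L s \<omega>) 1 ?\<Gamma> \<le> 0"
      using cadlag
    proof eventually_elim
      case (elim \<omega>)
      have "{s. 0 \<le> s \<and> s \<le> 1 \<and> jump \<Phi> (\<lambda>s. L s \<omega>) s \<in> ?\<Gamma>} = {}"
        using jump_in_polar[OF nuclear r elim] unfolding exhausting_def[abs_def] by blast
      thus ?case by (simp only: jump_count_def) simp
    qed
  qed
  finally show ?thesis by simp
qed

text \<open>A jump in the level set of value \<open>y\<close> contributes \<open>y\<close>, which is
  at most the value of \<open>gauss_fun\<close> at that jump; so the weighted counts reduce to sums
  over finitely many jump times.\<close>

lemma weighted_jump_count_le:
  assumes l: "cadlag_in (completion_strong_dual r) l"
    and g: "simple_function \<nu> g" "\<And>f. f \<in> dual \<Phi> \<Longrightarrow> g f \<le> ennreal (gauss_fun I b f)"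
  shows "(\<Sum>y\<in>g ` space \<nu> - {0}. y * jump_count \<Phi> l 1 (g -` {y} \<inter> space \<nu>))
    \<le> liminf (\<lambda>n. ennreal (\<Sum>i<n. gauss_fun I b (l (real (Suc i) / n) - l (real i / n))))" (is "_ \<le> ?R")
proof -
  let ?Y = "g ` space \<nu> - {0}" and ?j = "jump \<Phi> l"
  let ?A = "\<lambda>y. {s. 0 \<le> s \<and> s \<le> 1 \<and> ?j s \<in> g -` {y} \<inter> space \<nu>}"
  have le1: "y \<le> 1" if "y \<in> g ` space \<nu>" for y
  proof -
    obtain f where f: "f \<in> dual \<Phi>" "y = g f" using \<open>y \<in> g ` space \<nu>\<close> space_nu by auto
    have "g f \<le> ennreal (gauss_fun I b f)" by (rule g(2)[OF f(1)])
    also have "\<dots> \<le> 1" using gauss_fun_bounds(2)[of I b f] by simp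
    finally show ?thesis using f(2) by simp
  qed
  \<comment> \<open>Values of \<open>g\<close> are at most 1, so they may be handled as real
    weights.\<close>
  have y: "ennreal (enn2real y) = y" "enn2real y > 0" if "y \<in> ?Y" for y
    using le1[of y] that
    by (auto simp: enn2real_positive_iff zero_less_iff_neq_zero intro!: ennreal_enn2real
        dest: order_le_less_trans[OF _ ennreal_one_less_top])
  \<comment> \<open>Time 0, which the partition into left-open cells misses, has zero jump by
    convention, and \<open>g\<close> vanishes at the zero functional.\<close>
  have zero: "s > 0" if "s \<in> ?A y" "y \<in> ?Y" for s y
  proof -
    have "?j s \<noteq> (\<lambda>_. 0)"
    proof
      assume z: "?j s = (\<lambda>_. 0)"
      hence "(\<lambda>_. 0) \<in> dual \<Phi>" "y = g (\<lambda>_. 0)" using that space_nu by auto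
      thus False using g(2)[of "\<lambda>_. 0"] that by (simp add: gauss_fun_zero)
    qed
    hence "s \<noteq> 0" using jump_zero[of \<Phi> l] by metis
    thus ?thesis using that by auto
  qed
  have "(\<Sum>y\<in>?Y. y * jump_count \<Phi> l 1 (g -` {y} \<inter> space \<nu>))
      = (\<Sum>y\<in>?Y. ennreal (enn2real y) * emeasure (count_space UNIV) (?A y))"
    unfolding jump_count_def using y by (intro sum.cong) auto
  also have "\<dots> \<le> ?R"
  proof (rule weighted_count_le[where k = "\<lambda>s. gauss_fun I b (?j s)"])
    show "finite ?Y" using simple_functionD(1)[OF g(1)] by simp
    show "enn2real y > 0" if "y \<in> ?Y" for y by (rule y(2)[OF that])
    show "disjoint_family_on ?A ?Y" by (auto simp: disjoint_family_on_def)
    show "enn2real y \<le> gauss_fun I b (?j s)" if "y \<in> ?Y" "s \<in> ?A y" for y s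
    proof -
      have "y \<le> ennreal (gauss_fun I b (?j s))" using g(2)[of "?j s"] that space_nu by auto
      thus ?thesis by (intro enn2real_leI gauss_fun_bounds(1))
    qed
    fix S assume S: "finite S" "S \<subseteq> (\<Union>y\<in>?Y. ?A y)"
    have "S \<subseteq> {0<..1}"
    proof
      fix s assume "s \<in> S"
      then obtain y where "y \<in> ?Y" "s \<in> ?A y" using S(2) by blast
      thus "s \<in> {0<..1}" using zero[of s y] by auto
    qed
    thus "ennreal (\<Sum>s\<in>S. gauss_fun I b (?j s))
        \<le> ?R"
      by (rule jump_sum_le_liminf[OF nuclear r l S(1)])
  qed
  finally show ?thesis .
qed

lemma nn_integral_gauss_fun_bound:
  obtains p where "cont_hilbertian \<Phi> p"
    "\<And>(I::'i set) b. finite I \<Longrightarrow>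
      (\<integral>\<^sup>+f. ennreal (gauss_fun I b f) \<partial>\<nu>) \<le> ennreal (2 * (1 + (\<Sum>j\<in>I. (p (b j))\<^sup>2)))"
proof -
  interpret prob_space M by (rule prob)
  obtain p where p: "cont_hilbertian \<Phi> p"
    "\<And>(I::'i set) b i n. finite I \<Longrightarrow> i < n \<Longrightarrow>
      real n * (\<integral>\<omega>. gauss_fun I b (L (real (Suc i) / n) \<omega> - L (real i / n) \<omega>) \<partial>M)
        \<le> 2 * (1 + (\<Sum>j\<in>I. (p (b j))\<^sup>2))"
    using levy_increment_gaussian_bound[OF nuclear prob levy equicont] by blast
  show ?thesis
  proof (rule that[OF p(1)])
    fix I :: "'i set" and b assume I: "finite I"
    define K where "K = 2 * (1 + (\<Sum>j\<in>I. (p (b j))\<^sup>2))"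
    have K: "K \<ge> 0" unfolding K_def by (simp add: sum_nonneg)
    define X where "X n i \<omega> = gauss_fun I b (L (real (Suc i) / real n) \<omega> - L (real i / real n) \<omega>)" for n i \<omega>
    define H where "H n \<omega> = ennreal (\<Sum>i<n. X n i \<omega>)" for n \<omega>
    have Lm: "random_variable borel (\<lambda>\<omega>. L s \<omega> x)" if "s \<ge> 0" for s x
      using measurable_compose[OF _ measurable_strong_dual_eval[OF nuclear, of x]] levy that
      by (auto simp: levy_process_def)
    have Xm: "random_variable borel (X n i)" for n i
    proof -
      have [measurable]: "random_variable borel (\<lambda>\<omega>. L (real (Suc i) / real n) \<omega> x)"
        "random_variable borel (\<lambda>\<omega>. L (real i / real n) \<omega> x)" for x
        by (rule Lm, simp)+
      show ?thesis unfolding X_def[abs_def] gauss_fun_def fun_diff_def by measurable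
    qed
    have X01: "0 \<le> X n i \<omega>" "X n i \<omega> \<le> 1" for n i \<omega> by (simp_all add: X_def gauss_fun_bounds)
    have Xi: "integrable M (X n i)" for n i
      by (rule integrable_const_bound[where B=1, OF _ Xm]) (simp add: X01)
    have HK: "integral\<^sup>N M (H n) \<le> ennreal K" for n
    proof -
      have "integral\<^sup>N M (H n) = ennreal (\<integral>\<omega>. (\<Sum>i<n. X n i \<omega>) \<partial>M)"
        unfolding H_def using X01 Xi by (intro nn_integral_eq_integral) (auto intro!: sum_nonneg)
      also have "(\<integral>\<omega>. (\<Sum>i<n. X n i \<omega>) \<partial>M) = (\<Sum>i<n. expectation (X n i))"
        using Xi by simp
      also have "\<dots> \<le> (\<Sum>i<n. K / n)"
      proof (rule sum_mono)
        fix i assume "i \<in> {..<n}"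
        hence i: "i < n" by simp
        have "real n * expectation (X n i) \<le> K"
          using p(2)[OF I i, of b] unfolding X_def[abs_def] K_def .
        thus "expectation (X n i) \<le> K / n" using i by (simp add: pos_le_divide_eq mult.commute)
      qed
      also have "\<dots> \<le> K" using K by simp
      finally show ?thesis by (simp add: ennreal_leI)
    qed
    have liminf: "(\<integral>\<^sup>+\<omega>. liminf (\<lambda>n. H n \<omega>) \<partial>M) \<le> ennreal K"
    proof -
      have "(\<integral>\<^sup>+\<omega>. liminf (\<lambda>n. H n \<omega>) \<partial>M) \<le> liminf (\<lambda>n. integral\<^sup>N M (H n))"
        using Xm by (intro nn_integral_liminf) (auto simp: H_def[abs_def])
      also have "\<dots> \<le> liminf (\<lambda>n::nat. ennreal K)" by (intro Liminf_mono) (simp add: HK)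
      finally show ?thesis by (simp add: Liminf_const)
    qed
    \<comment> \<open>The intensity identity concerns sets, so it is applied to the level sets of
      simple functions below \<open>gauss_fun\<close>. The level 0 is dropped: it contributes
      nothing, and it contains the zero functional, to which the identity does not extend.\<close>
    show "(\<integral>\<^sup>+f. ennreal (gauss_fun I b f) \<partial>\<nu>) \<le> ennreal (2 * (1 + (\<Sum>j\<in>I. (p (b j))\<^sup>2)))"
      unfolding nn_integral_def K_def[symmetric]
    proof (rule SUP_least)
      fix g assume "g \<in> {g. simple_function \<nu> g \<and> g \<le> (\<lambda>f. ennreal (gauss_fun I b f))}"
      hence g: "simple_function \<nu> g" "\<And>f. g f \<le> ennreal (gauss_fun I b f)" by (auto simp: le_fun_def)
      let ?Y = "g ` space \<nu> - {0}" and ?N = "\<lambda>y \<omega>. jump_count \<Phi> (\<lambda>s. L s \<omega>) 1 (g -` {y} \<inter> space \<nu>)"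
      have fin: "finite (g ` space \<nu>)" by (rule simple_functionD(1)[OF g(1)])
      have "integral\<^sup>S \<nu> g = (\<Sum>y\<in>?Y. y * emeasure \<nu> (g -` {y} \<inter> space \<nu>))"
        unfolding simple_integral_def using fin by (intro sum.mono_neutral_right) auto
      also have "\<dots> = (\<Sum>y\<in>?Y. y * (\<integral>\<^sup>+\<omega>. ?N y \<omega> \<partial>M))"
      proof (intro sum.cong refl)
        fix y assume y: "y \<in> ?Y"
        have "g (\<lambda>_. 0) = 0" using g(2)[of "\<lambda>_. 0"] by (simp add: gauss_fun_zero)
        hence "(\<lambda>_. 0) \<notin> g -` {y} \<inter> space \<nu>" using y by auto
        moreover have "g -` {y} \<inter> space \<nu> \<in> sets \<nu>" by (rule simple_functionD(2)[OF g(1)])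
        ultimately have "(\<integral>\<^sup>+\<omega>. ?N y \<omega> \<partial>M)
            = emeasure \<nu> (g -` {y} \<inter> space \<nu>)"
          by (intro intensity)
        thus "y * emeasure \<nu> (g -` {y} \<inter> space \<nu>)
            = y * (\<integral>\<^sup>+\<omega>. ?N y \<omega> \<partial>M)"
          by (rule arg_cong[OF sym])
      qed
      also have "\<dots> \<le> (\<integral>\<^sup>+\<omega>. (\<Sum>y\<in>?Y. y * ?N y \<omega>) \<partial>M)"
        using fin by (intro sum_cmult_nn_integral_le) auto
      also have "\<dots> \<le> (\<integral>\<^sup>+\<omega>. liminf (\<lambda>n. H n \<omega>) \<partial>M)"
      proof (rule nn_integral_mono_AE)
        show "AE \<omega> in M. (\<Sum>y\<in>?Y. y * ?N y \<omega>)
            \<le> liminf (\<lambda>n. H n \<omega>)"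
          using cadlag
        proof eventually_elim
          case (elim \<omega>)
          show ?case unfolding H_def X_def by (rule weighted_jump_count_le[OF elim g])
        qed
      qed
      also have "\<dots> \<le> ennreal K" by (rule liminf)
      finally show "integral\<^sup>S \<nu> g \<le> ennreal K" .
    qed
  qed
qed

text \<open>The constant is \<open>3 * 2 * (1 + 1)\<close>: the 3 from
  \<open>min_le_gauss_fun\<close>, and \<open>2 * (1 + trace)\<close> from the Gaussian bound with
  trace at most 1 by the choice of \<open>s\<close>.\<close>

lemma truncated_second_moment:
  obtains s where "cont_hilbertian \<Phi> s"
    "(\<integral>\<^sup>+f. min 1 ((dual_seminorm s f)\<^sup>2) \<partial>\<nu>) \<le> ennreal 12"
proof -
  obtain p where p: "cont_hilbertian \<Phi> p" and bound: "\<And>(I::'a set) b. finite I \<Longrightarrow>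
      (\<integral>\<^sup>+f. ennreal (gauss_fun I b f) \<partial>\<nu>) \<le> ennreal (2 * (1 + (\<Sum>j\<in>I. (p (b j))\<^sup>2)))"
    using nn_integral_gauss_fun_bound by blast
  obtain s where s: "cont_hilbertian \<Phi> s" and hb: "hs_bounded p s 1"
    using nuclear_hs_bounded[OF nuclear p] by blast
  obtain S where S: "hilbertian_form s S" using s by (elim cont_hilbertianE)
  have "\<exists>D. countable D \<and> (\<forall>x \<epsilon>. \<epsilon> > 0 \<longrightarrow> (\<exists>d\<in>D. r n (x - d) < \<epsilon> \<and> s (x - d) < \<epsilon>))" for n
  proof -
    \<comment> \<open>Density for \<open>r n\<close> and \<open>s\<close> simultaneously is obtained
      from one continuous Hilbertian seminorm above both.\<close>
    define q where "q x = sqrt (\<Sum>i\<in>{True, False}. ((if i then r n else s) x)\<^sup>2)" for x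
    have q: "cont_hilbertian \<Phi> q"
      unfolding q_def[abs_def] using s weaker_countably_hilbertianD(1)[OF r]
      by (intro cont_hilbertian_sum) auto
    have rq: "r n x \<le> q x" "s x \<le> q x" for x by (auto simp: q_def intro: real_le_rsqrt)
    obtain D where D: "countable D" "\<And>x \<epsilon>. \<epsilon> > 0 \<Longrightarrow> \<exists>d\<in>D. q (x - d) < \<epsilon>"
      using nuclear_separable[OF nuclear q] by blast
    have "\<exists>d\<in>D. r n (x - d) < \<epsilon> \<and> s (x - d) < \<epsilon>" if "\<epsilon> > 0" for x \<epsilon>
      using D(2)[OF that, of x] rq by (meson order_le_less_trans)
    thus ?thesis using D(1) by blast
  qed
  then obtain D where D: "\<And>n. countable (D n)"
    "\<And>n x \<epsilon>. \<epsilon> > 0 \<Longrightarrow> \<exists>d\<in>D n. r n (x - d) < \<epsilon> \<and> s (x - d) < \<epsilon>" by metis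
  \<comment> \<open>The index \<open>n\<close> for which \<open>f\<close> is bounded by a multiple
    of \<open>r n\<close> varies with \<open>f\<close>, so one enumeration must serve all
    \<open>n\<close>.\<close>
  define d where "d = from_nat_into (\<Union>n. D n)"
  have cD: "countable (\<Union>n. D n)" using D(1) by simp
  have dense: "\<exists>i. r n (x - d i) < \<epsilon> \<and> s (x - d i) < \<epsilon>" if e: "\<epsilon> > 0" for n x \<epsilon>
  proof -
    obtain y where y: "y \<in> D n" "r n (x - y) < \<epsilon>" "s (x - y) < \<epsilon>" using D(2)[OF e] by blast
    obtain i where "d i = y" using from_nat_into_surj[OF cD, of y] y(1) by (auto simp: d_def)
    thus ?thesis using y by blast
  qed
  \<comment> \<open>The \<open>m\<close>-th family tests \<open>d 0\<close> up to
    \<open>d m\<close>, with the share of null vectors tending to 0 as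
    \<open>1 / (m + 1)\<close>.\<close>
  have "\<exists>(I::'a set) b. contractive s I b \<and> (\<forall>f::'a \<Rightarrow> real. linear f \<longrightarrow>
      (\<forall>x\<in>d ` {..m}. (f x)\<^sup>2 \<le> ((s x)\<^sup>2 + 1 / (real m + 1)) * (\<Sum>i\<in>I. (f (b i))\<^sup>2)))" for m
    by (rule contractive_family_dominating[OF S]) auto
  then obtain I :: "nat \<Rightarrow> 'a set" and b where Ib: "\<And>m. contractive s (I m) (b m)"
    "\<And>m f x. linear f \<Longrightarrow> x \<in> d ` {..m} \<Longrightarrow>
      (f x)\<^sup>2 \<le> ((s x)\<^sup>2 + 1 / (real m + 1)) * (\<Sum>i\<in>I m. (f (b m i))\<^sup>2)" by metis
  note measurable_strong_dual_eval[OF nuclear, measurable]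
  define R where "R m f = (\<Sum>i\<in>I m. (f (b m i))\<^sup>2)" for m and f :: "'a \<Rightarrow> real"
  have Rb: "(\<integral>\<^sup>+f. ennreal (min 1 (R m f)) \<partial>\<nu>) \<le> ennreal 12" for m
  proof -
    have fin: "finite (I m)" using Ib(1) by (simp add: contractive_def)
    have gm: "(\<lambda>f. ennreal (gauss_fun (I m) (b m) f)) \<in> borel_measurable \<nu>"
      unfolding gauss_fun_def measurable_cong_sets[OF sets_nu refl]
      by measurable
    have "(\<integral>\<^sup>+f. ennreal (min 1 (R m f)) \<partial>\<nu>) \<le> (\<integral>\<^sup>+f. ennreal 3 * ennreal (gauss_fun (I m) (b m) f) \<partial>\<nu>)"
    proof (rule nn_integral_mono)
      fix f
      have "ennreal (min 1 (R m f)) \<le> ennreal (3 * gauss_fun (I m) (b m) f)"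
        unfolding R_def by (intro ennreal_leI min_le_gauss_fun)
      also have "\<dots> = ennreal 3 * ennreal (gauss_fun (I m) (b m) f)"
        by (rule ennreal_mult) (simp_all add: gauss_fun_bounds)
      finally show "ennreal (min 1 (R m f)) \<le> ennreal 3 * ennreal (gauss_fun (I m) (b m) f)" .
    qed
    also have "\<dots> = ennreal 3 * (\<integral>\<^sup>+f. ennreal (gauss_fun (I m) (b m) f) \<partial>\<nu>)"
      by (rule nn_integral_cmult[OF gm])
    also have "\<dots> \<le> ennreal 3 * ennreal (2 * (1 + (\<Sum>j\<in>I m. (p (b m j))\<^sup>2)))"
      by (intro mult_left_mono bound fin) auto
    also have "\<dots> \<le> ennreal 3 * ennreal 4"
      using hb Ib(1)[of m] unfolding hs_bounded_def by (intro mult_left_mono ennreal_leI) auto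
    also have "\<dots> = ennreal 12" by (subst ennreal_mult[symmetric]) auto
    finally show ?thesis .
  qed
  have "(\<integral>\<^sup>+f. min 1 ((dual_seminorm s f)\<^sup>2) \<partial>\<nu>) \<le> (\<integral>\<^sup>+f. liminf (\<lambda>m. ennreal (min 1 (R m f))) \<partial>\<nu>)"
  proof (rule nn_integral_mono_AE)
    have N: "dual \<Phi> - (\<Union>m. polar (exhausting m)) \<in> null_sets \<nu>"
      using concentrated polar_sets[OF exhausting_cont] unfolding space_nu[symmetric]
      by (intro null_setsI) auto
    have "AE f in \<nu>. f \<in> (\<Union>m. polar (exhausting m))"
      using AE_not_in[OF N] AE_space
      by eventually_elim (auto simp: space_nu)
    thus "AE f in \<nu>. min 1 ((dual_seminorm s f)\<^sup>2) \<le> liminf (\<lambda>m. ennreal (min 1 (R m f)))"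
    proof eventually_elim
      case (elim f)
      then obtain n where n: "f \<in> polar (exhausting n)" by blast
      have lin: "linear f" and le: "\<And>x. \<bar>f x\<bar> \<le> real n * r n x"
        using n by (auto simp: polar_def exhausting_def)
      show ?case
      proof (rule dual_seminorm_le_liminf[OF S lin le])
        show "\<exists>i. r n (x - d i) < \<epsilon> \<and> s (x - d i) < \<epsilon>" if "\<epsilon> > 0" for x \<epsilon> by (rule dense[OF that])
        show "(f (d i))\<^sup>2 \<le> ((s (d i))\<^sup>2 + 1 / (real m + 1)) * R m f" if "i \<le> m" for m i
          unfolding R_def using that by (intro Ib(2) lin) auto
      qed simp
    qed
  qed
  \<comment> \<open>The families for different \<open>m\<close> are unrelated, so \<open>R m\<close>
    need not be monotone in \<open>m\<close>; hence Fatou's lemma in place of monotone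
    convergence.\<close>
  also have "\<dots> \<le> liminf (\<lambda>m. \<integral>\<^sup>+f. ennreal (min 1 (R m f)) \<partial>\<nu>)"
  proof (rule nn_integral_liminf)
    show "(\<lambda>f. ennreal (min 1 (R m f))) \<in> borel_measurable \<nu>" for m
      unfolding R_def measurable_cong_sets[OF sets_nu refl]
      by measurable
  qed
  also have "\<dots> \<le> liminf (\<lambda>m::nat. ennreal 12)" by (intro Liminf_mono always_eventually allI Rb)
  finally have "(\<integral>\<^sup>+f. min 1 ((dual_seminorm s f)\<^sup>2) \<partial>\<nu>) \<le> ennreal 12" by (simp add: Liminf_const)
  with s show ?thesis by (rule that)
qed

text \<open>One seminorm serves every condition: Chebyshev's inequality gives finiteness wherever
  the dual seminorm is bounded away from 0, and on its unit ball the truncation by 1 has no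
  effect.\<close>

lemma levy_measure_nu:
  assumes zero: "emeasure \<nu> {\<lambda>_. 0} = 0"
  shows "levy_measure \<Phi> \<nu>"
proof -
  obtain s where s: "cont_hilbertian \<Phi> s"
    and bound: "(\<integral>\<^sup>+f. min 1 ((dual_seminorm s f)\<^sup>2) \<partial>\<nu>) \<le> ennreal 12"
    by (rule truncated_second_moment)
  let ?m = "\<lambda>f. min 1 ((dual_seminorm s f)\<^sup>2)"
  obtain S where S: "hilbertian_form s S" using s by (elim cont_hilbertianE)
  note ball = dual_ball_eq_polar[OF nuclear s]
  have ball_sets: "dual_ball \<Phi> s \<in> sets \<nu>" unfolding ball by (rule polar_sets[OF s])
  have finite: "emeasure \<nu> A < \<infinity>"
    if A: "A \<in> sets \<nu>" and c: "c > 0" and le: "\<And>f. f \<in> A \<Longrightarrow> ennreal c \<le> dual_seminorm s f" for A c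
  proof -
    define a where "a = min 1 (c\<^sup>2)"
    have a: "a > 0" using c by (simp add: a_def)
    have "ennreal a * emeasure \<nu> A = (\<integral>\<^sup>+f. ennreal a * indicator A f \<partial>\<nu>)"
      using A by (simp add: nn_integral_cmult_indicator)
    also have "\<dots> \<le> (\<integral>\<^sup>+f. ?m f \<partial>\<nu>)"
    proof (rule nn_integral_mono)
      fix f
      show "ennreal a * indicator A f \<le> ?m f"
      proof (cases "f \<in> A")
        case True
        have "ennreal (c\<^sup>2) = (ennreal c)\<^sup>2" using c by (simp add: ennreal_power)
        also have "\<dots> \<le> (dual_seminorm s f)\<^sup>2" using le[OF True] by (intro power_mono) auto
        finally have "ennreal (c\<^sup>2) \<le> (dual_seminorm s f)\<^sup>2" .
        moreover have "ennreal a \<le> ennreal (c\<^sup>2)" by (intro ennreal_leI) (simp add: a_def)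
        ultimately have "ennreal a \<le> (dual_seminorm s f)\<^sup>2" by (rule order_trans[rotated])
        moreover have "ennreal a \<le> 1" by (simp add: a_def)
        ultimately have "ennreal a \<le> ?m f" by simp
        thus ?thesis using True by simp
      qed simp
    qed
    also have "\<dots> < \<infinity>" using bound by (rule order_le_less_trans) simp
    finally show ?thesis using a by (auto simp: ennreal_mult_less_top)
  qed
  have radon: "bounded_radon_measure (strong_dual \<Phi>) (restrict_to \<nu> A)"
    if "A \<in> sets \<nu>" "emeasure \<nu> A < \<infinity>" for A
    by (rule bounded_radon_restrict_to[OF nuclear exhausting_cont exhausting_mono sets_nu concentrated that])
  show ?thesis
    unfolding levy_measure_def
  proof (intro conjI ballI impI)
    show "sets \<nu> = sets (borel_of (strong_dual \<Phi>))" by (rule sets_nu)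
    show "emeasure \<nu> {\<lambda>_. 0} = 0" by (rule zero)
    fix U assume U: "U \<in> sets (borel_of (strong_dual \<Phi>))"
      and "\<exists>V. openin (strong_dual \<Phi>) V \<and> (\<lambda>_. 0) \<in> V \<and> V \<subseteq> U"
    then obtain V where V: "openin (strong_dual \<Phi>) V" "(\<lambda>_. 0) \<in> V" "V \<subseteq> U" by blast
    obtain B e where B: "tvs_bounded \<Phi> B" "e > 0" "{f\<in>dual \<Phi>. \<forall>x\<in>B. \<bar>f x\<bar> \<le> e} \<subseteq> V"
      using strong_dual_nbhd_zero[OF V(1,2)] by blast
    obtain C where C: "C > 0" "\<And>x. x \<in> B \<Longrightarrow> s x \<le> C"
      using tvs_bounded_cont_hilbertian[OF nuclear_topspace[OF nuclear] B(1) s] by blast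
    have A: "dual \<Phi> - U \<in> sets \<nu>"
      using sets.compl_sets[of U \<nu>] U sets_nu space_nu by simp
    \<comment> \<open>Off \<open>U\<close> some \<open>x \<in> B\<close> has
      \<open>\<bar>f x\<bar> > e\<close>, and \<open>x\<close> divided by \<open>C\<close> lies in
      the unit ball of \<open>s\<close>.\<close>
    have "ennreal (e / C) \<le> dual_seminorm s f" if "f \<in> dual \<Phi> - U" for f
    proof -
      have "f \<in> dual \<Phi>" "f \<notin> {f\<in>dual \<Phi>. \<forall>x\<in>B. \<bar>f x\<bar> \<le> e}" using that B(3) V(3) by auto
      then obtain x where x: "x \<in> B" "\<bar>f x\<bar> > e" and lin: "linear f" by (auto simp: dual_def)
      have "s ((1 / C) *\<^sub>R x) \<le> 1" using C x by (simp add: hilbertian_scaleR[OF S])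
      hence "ennreal \<bar>f ((1 / C) *\<^sub>R x)\<bar> \<le> dual_seminorm s f"
        unfolding dual_seminorm_def by (intro SUP_upper) simp
      moreover have "e / C \<le> \<bar>f ((1 / C) *\<^sub>R x)\<bar>"
        using x C(1) by (simp add: linear_cmul[OF lin] abs_mult divide_right_mono)
      ultimately show ?thesis by (meson ennreal_leI order_trans)
    qed
    with A C(1) B(2) have "emeasure \<nu> (dual \<Phi> - U) < \<infinity>" by (intro finite[of _ "e / C"]) auto
    thus "bounded_radon_measure (strong_dual \<Phi>) (restrict_to \<nu> (dual \<Phi> - U))" by (rule radon[OF A])
  next
    have A: "dual \<Phi> - dual_ball \<Phi> s \<in> sets \<nu>"
      using sets.compl_sets[OF ball_sets] space_nu by simp
    have "ennreal 1 \<le> dual_seminorm s f" if "f \<in> dual \<Phi> - dual_ball \<Phi> s" for f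
      using that by (auto simp: dual_ball_def not_le)
    hence "emeasure \<nu> (dual \<Phi> - dual_ball \<Phi> s) < \<infinity>" by (intro finite[OF A, of 1]) auto
    hence "bounded_radon_measure (strong_dual \<Phi>) (restrict_to \<nu> (dual \<Phi> - dual_ball \<Phi> s))"
      by (rule radon[OF A])
    moreover have "(\<integral>\<^sup>+f\<in>dual_ball \<Phi> s. (dual_seminorm s f)\<^sup>2 \<partial>\<nu>) < \<infinity>"
    proof -
      have "(\<integral>\<^sup>+f\<in>dual_ball \<Phi> s. (dual_seminorm s f)\<^sup>2 \<partial>\<nu>) \<le> (\<integral>\<^sup>+f. ?m f \<partial>\<nu>)"
      proof (rule nn_integral_mono)
        fix f
        show "(dual_seminorm s f)\<^sup>2 * indicator (dual_ball \<Phi> s) f \<le> ?m f"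
        proof (cases "f \<in> dual_ball \<Phi> s")
          case True
          hence "dual_seminorm s f \<le> 1" by (simp add: dual_ball_def)
          hence "(dual_seminorm s f)\<^sup>2 \<le> 1\<^sup>2" by (rule power_mono) simp
          thus ?thesis using True by simp
        qed simp
      qed
      also have "\<dots> < \<infinity>" using bound by (rule order_le_less_trans) simp
      finally show ?thesis .
    qed
    ultimately show "\<exists>\<rho>. cont_hilbertian \<Phi> \<rho> \<and>
        (\<integral>\<^sup>+f\<in>dual_ball \<Phi> \<rho>. (dual_seminorm \<rho> f)\<^sup>2 \<partial>\<nu>) < \<infinity> \<and>
        bounded_radon_measure (strong_dual \<Phi>) (restrict_to \<nu> (dual \<Phi> - dual_ball \<Phi> \<rho>))"
      using s by blast
  qed
qed

end

theorem theorem4p11: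
  fixes \<Phi> :: "'a::real_vector topology"
    and M :: "'w measure"
    and F :: "real \<Rightarrow> 'w measure"
    and L :: "real \<Rightarrow> 'w \<Rightarrow> 'a \<Rightarrow> real"
    and \<nu> :: "('a \<Rightarrow> real) measure"
  assumes "nuclear_space \<Phi>"
    and "prob_space M" and "complete_measure M"
    and "usual_filtration M F"
    and "levy_process M \<Phi> L"
    and "\<forall>t\<ge>0. L t \<in> F t \<rightarrow>\<^sub>M borel_of (strong_dual \<Phi>)"
    and "increments_indep_of_past M F \<Phi> L"
    and "\<forall>T>0. equicontinuous_in_prob M \<Phi> L {0..T}"
    and "regular_cadlag_process M \<Phi> L"
    and "sets \<nu> = sets (borel_of (strong_dual \<Phi>))"
    and "emeasure \<nu> {\<lambda>_. 0} = 0"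
    and "\<forall>t\<ge>0. \<forall>\<Gamma>\<in>sets (borel_of (strong_dual \<Phi>)). (\<lambda>_. 0) \<notin> \<Gamma> \<longrightarrow>
           (\<integral>\<^sup>+\<omega>. jump_count \<Phi> (\<lambda>s. L s \<omega>) t \<Gamma> \<partial>M) = ennreal t * emeasure \<nu> \<Gamma>"
  shows "levy_measure \<Phi> \<nu>"
proof -
  obtain r where r: "weaker_countably_hilbertian \<Phi> r"
    "AE \<omega> in M. cadlag_in (completion_strong_dual r) (\<lambda>t. L t \<omega>)"
    using assms(9) unfolding regular_cadlag_process_def by blast
  interpret levy_jump_intensity \<Phi> M L \<nu> r
  proof (rule levy_jump_intensity.intro)
    show "equicontinuous_in_prob M \<Phi> L {0..1}" using assms(8) zero_less_one by blast
    fix \<Gamma> assume G: "\<Gamma> \<in> sets \<nu>" "(\<lambda>_. 0) \<notin> \<Gamma>"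
    have "(\<integral>\<^sup>+\<omega>. jump_count \<Phi> (\<lambda>s. L s \<omega>) 1 \<Gamma> \<partial>M) = ennreal 1 * emeasure \<nu> \<Gamma>"
      using assms(12)[rule_format, of 1 \<Gamma>] G assms(10) by simp
    thus "(\<integral>\<^sup>+\<omega>. jump_count \<Phi> (\<lambda>s. L s \<omega>) 1 \<Gamma> \<partial>M) = emeasure \<nu> \<Gamma>" by simp
  qed (rule assms(1) assms(2) assms(5) assms(10) r)+
  show ?thesis by (rule levy_measure_nu) (rule assms(11))
qed

end
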